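(* Let $S$ be a semitopological semigroup that satisfies one of the fixed point properties $(D)$, $(E)$, $(E')$, $(F)$, $(F^* )$, $(G)$, $(G^* )$ listed in the context; call it $(P)$. Let $X$ be a locally convex space whose topology $\tau$ is determined by a family $Q$ of continuous seminorms, let $K\subset X$ be nonempty, and let $(S,K)$ be a $Q$-nonexpansive dynamical system satisfying all the hypotheses in property $(P)$. Then the set of fixed points $F(S)=\{x\in K: sx=x \text{ for every } s\in S\}$ is a $Q$-nonexpansive retract of $K$, i.e. there is a mapping $r:K\to K$ with $r(K)=F(S)$, $r\circ r=r$ and $p(r(x)-r(y))\le p(x-y)$ for all $p\in Q$ and $x,y\in K$.
   Context: A semitopological semigroup is a (nonempty) semigroup $S$ with a Hausdorff topology such that for each $t\in S$ the maps $s\mapsto ts$ and $s\mapsto st$ are continuous. Locally convex spaces are Hausdorff. A dynamical system $(S,K)$ consists of a semitopological semigroup $S$, a topological space $K$ and an action $\pi:S\times K\to K$, $(s,x)\mapsto sx$, with $s_1(s_2x)=(s_1s_2)x$, which is separately continuous (all maps $s\mapsto sx$ and all translations $\lambda_s:x\mapsto sx$ are continuous). It is called continuous if $\pi$ is jointly continuous. $(S,(K,\tau))$, respectively $(S,(K,\mathrm{weak}))$, means that $K$ carries the topology $\tau$, respectively the weak topology. The enveloping semigroup $E(S,K)$ of a compact dynamical system is the closure of $\{\lambda_s:s\in S\}$ in $K^K$ with the product topology. For $K$ in a locally convex space with topology determined by the family $Q$ of seminorms, the system is $Q$-nonexpansive if $p(sx-sy)\le p(x-y)$ for all $p\in Q$,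 $s\in S$, $x,y\in K$. A set $A\subset X$ is $Q$-bounded if for each $p\in Q$ there is $d>0$ with $p(x)\le d$ for all $x\in A$. A subset $K$ of $X$ has $Q$-normal structure if for each $Q$-bounded subset $A$ of $K$ containing more than one point there are $u\in\overline{\mathrm{co}}\,K$ and $p\in Q$ with $\sup\{p(x-u):x\in A\}<\sup\{p(x-y):x,y\in A\}$. A fixed point is $x\in K$ with $sx=x$ for all $s\in S$. The fixed point properties of $S$ are the following; in each, $(X,\tau)$ ranges over all locally convex spaces, $Q$ over all families of continuous seminorms determining $\tau$, and $K$ over nonempty subsets of $X$. $(D)$: every $Q$-nonexpansive dynamical system $(S,(K,\tau))$ with $K$ $\tau$-compact and convex has a fixed point. $(E)$: every $Q$-nonexpansive dynamical system $(S,(K,\mathrm{weak}))$ with $K$ weakly compact and convex, such that the family of translations $\{\lambda_s\}_{s\in S}$ is equicontinuous in the weak topology, has a fixed point. $(E')$: every $Q$-nonexpansive dynamical system $(S,(K,\mathrm{weak}))$ with $K$ weakly compact, convex and having $Q$-normal structure, such that the family $\{\lambda_s\}_{s\in S}$ is equicontinuous in the weak topology, has a fixed point. $(F)$: every $Q$-nonexpansive dynamical system $(S,(K,\mathrm{weak}))$ with $K$ weakly compact and convex, such that $E(S,(K,\mathrm{weak}))$ consists of weakly continuous functions, has a fixed point. $(F^* )$: every $Q$-nonexpansive and continuous dynamical system $(S,(K,\mathrm{weak}))$ with $K$ weakly compact and convex, such that $E(S,(K,\mathrm{weak}))$ consists of weakly continuous functions, has a fixed point. $(G)$: every $Q$-nonexpansive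 dynamical system $(S,(K,\mathrm{weak}))$ with $K$ weakly compact and convex has a fixed point. $(G^* )$: every $Q$-nonexpansive and continuous dynamical system $(S,(K,\mathrm{weak}))$ with $K$ weakly compact and convex has a fixed point. *)

theory Defs
  imports "HOL-Analysis.Analysis" "HOL-Library.Function_Algebras"
begin

text \<open>The pointwise real vector space structure on a function space \<open>'i \<Rightarrow> 'a\<close>; addition is
  already pointwise.\<close>

instantiation "fun" :: (type, real_vector) real_vector
begin

definition scaleR_fun :: "real \<Rightarrow> ('a \<Rightarrow> 'b) \<Rightarrow> 'a \<Rightarrow> 'b"
  where "scaleR_fun c f = (\<lambda>i. c *\<^sub>R f i)"

instance
  by standard (simp_all add: scaleR_fun_def fun_eq_iff scaleR_add_right scaleR_add_left)

end

text \<open>The Hausdorff condition is part of the class \<open>t2_space\<close>.\<close>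

class semitopological_semigroup = semigroup_mult + t2_space +
  assumes continuous_left_mult: "open U \<Longrightarrow> open ((\<lambda>s. t * s) -` U)"
    and continuous_right_mult: "open U \<Longrightarrow> open ((\<lambda>s. s * t) -` U)"

definition locally_convex_topology :: "'x::real_vector topology \<Rightarrow> bool"
  where "locally_convex_topology \<tau> \<longleftrightarrow>
    topspace \<tau> = UNIV \<and> Hausdorff_space \<tau> \<and>
    continuous_map (prod_topology \<tau> \<tau>) \<tau> (\<lambda>(x, y). x + y) \<and>
    continuous_map (prod_topology euclideanreal \<tau>) \<tau> (\<lambda>(c, x). c *\<^sub>R x) \<and>
    (\<forall>U. openin \<tau> U \<and> 0 \<in> U \<longrightarrow> (\<exists>V. openin \<tau> V \<and> convex V \<and> 0 \<in> V \<and> V \<subseteq> U))"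

text \<open>Nonnegativity of a seminorm follows from the two conditions.\<close>

definition seminorm :: "('x::real_vector \<Rightarrow> real) \<Rightarrow> bool"
  where "seminorm p \<longleftrightarrow> (\<forall>x y. p (x + y) \<le> p x + p y) \<and> (\<forall>c x. p (c *\<^sub>R x) = \<bar>c\<bar> * p x)"

definition determines :: "('x::real_vector \<Rightarrow> real) set \<Rightarrow> 'x topology \<Rightarrow> bool"
  where "determines Q \<tau> \<longleftrightarrow>
    (\<forall>p\<in>Q. seminorm p \<and> continuous_map \<tau> euclideanreal p) \<and>
    (\<forall>U. openin \<tau> U \<longleftrightarrow>
      (\<forall>x\<in>U. \<exists>F e. finite F \<and> F \<subseteq> Q \<and> e > 0 \<and> {y. \<forall>p\<in>F. p (y - x) < e} \<subseteq> U))"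

definition weak_topology :: "'x::real_vector topology \<Rightarrow> 'x topology"
  where "weak_topology \<tau> = topology_generated_by
    {f -` U | f U. linear f \<and> continuous_map \<tau> euclideanreal f \<and> open (U :: real set)}"

text \<open>A dynamical system whose phase space is the topological space \<open>T\<close>, i.e. the underlying set
  \<open>K\<close> is \<open>topspace T\<close>. That each translation maps \<open>K\<close> into itself is part of
  \<open>continuous_map\<close>; the values of \<open>act s\<close> outside \<open>K\<close> are irrelevant.\<close>

definition dynamical_system ::
    "'x topology \<Rightarrow> ('s::semitopological_semigroup \<Rightarrow> 'x \<Rightarrow> 'x) \<Rightarrow> bool"
  where "dynamical_system T act \<longleftrightarrow>
    (\<forall>s t. \<forall>x\<in>topspace T. act s (act t x) = act (s * t) x) \<and>
    (\<forall>x\<in>topspace T. continuous_map euclidean T (\<lambda>s. act s x)) \<and>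
    (\<forall>s. continuous_map T T (act s))"

definition jointly_continuous ::
    "'x topology \<Rightarrow> ('s::topological_space \<Rightarrow> 'x \<Rightarrow> 'x) \<Rightarrow> bool"
  where "jointly_continuous T act \<longleftrightarrow>
    continuous_map (prod_topology euclidean T) T (\<lambda>(s, x). act s x)"

text \<open>The product space \<open>K\<^sup>K\<close> consists of extensional functions, whence the restriction of
  the translations to \<open>K\<close>.\<close>

definition enveloping_semigroup :: "'x topology \<Rightarrow> ('s \<Rightarrow> 'x \<Rightarrow> 'x) \<Rightarrow> ('x \<Rightarrow> 'x) set"
  where "enveloping_semigroup T act =
    product_topology (\<lambda>_. T) (topspace T) closure_of range (\<lambda>s. restrict (act s) (topspace T))"

text \<open>Equicontinuity on \<open>K\<close> with respect to the translation-invariant uniformity of the vector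
  topology \<open>T\<close>.\<close>

definition equicontinuous_family :: "'x::real_vector topology \<Rightarrow> 'x set \<Rightarrow> ('x \<Rightarrow> 'x) set \<Rightarrow> bool"
  where "equicontinuous_family T K \<Phi> \<longleftrightarrow>
    (\<forall>x\<in>K. \<forall>V. openin T V \<and> 0 \<in> V \<longrightarrow>
      (\<exists>W. openin T W \<and> x \<in> W \<and> (\<forall>y\<in>K \<inter> W. \<forall>f\<in>\<Phi>. f y - f x \<in> V)))"

definition nonexpansive_action ::
    "('x::real_vector \<Rightarrow> real) set \<Rightarrow> 'x set \<Rightarrow> ('s \<Rightarrow> 'x \<Rightarrow> 'x) \<Rightarrow> bool"
  where "nonexpansive_action Q K act \<longleftrightarrow>
    (\<forall>p\<in>Q. \<forall>s. \<forall>x\<in>K. \<forall>y\<in>K. p (act s x - act s y) \<le> p (x - y))"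

definition Q_bounded :: "('x::real_vector \<Rightarrow> real) set \<Rightarrow> 'x set \<Rightarrow> bool"
  where "Q_bounded Q A \<longleftrightarrow> (\<forall>p\<in>Q. \<exists>d>0. \<forall>x\<in>A. p x \<le> d)"

text \<open>Both suprema are taken over nonempty sets that are bounded above, since \<open>A\<close> is
  \<open>Q\<close>-bounded.\<close>

definition normal_structure ::
    "'x::real_vector topology \<Rightarrow> ('x \<Rightarrow> real) set \<Rightarrow> 'x set \<Rightarrow> bool"
  where "normal_structure \<tau> Q K \<longleftrightarrow>
    (\<forall>A\<subseteq>K. Q_bounded Q A \<and> (\<exists>a\<in>A. \<exists>b\<in>A. a \<noteq> b) \<longrightarrow>
      (\<exists>u \<in> \<tau> closure_of (convex hull K). \<exists>p\<in>Q.
        (SUP x\<in>A. p (x - u)) < (SUP (x, y)\<in>A \<times> A. p (x - y))))"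

definition fixed_points :: "'x set \<Rightarrow> ('s \<Rightarrow> 'x \<Rightarrow> 'x) \<Rightarrow> 'x set"
  where "fixed_points K act = {x \<in> K. \<forall>s. act s x = x}"

datatype fixed_point_property_name =
  FP_D | FP_E | FP_E' | FP_F | FP_F_star | FP_G | FP_G_star

abbreviation weak_on :: "'x::real_vector topology \<Rightarrow> 'x set \<Rightarrow> 'x topology"
  where "weak_on \<tau> K \<equiv> subtopology (weak_topology \<tau>) K"

text \<open>The hypotheses that the property \<open>P\<close> imposes on a space, a subset and an action.\<close>

definition hypotheses_of ::
    "fixed_point_property_name \<Rightarrow> 'x::real_vector topology \<Rightarrow> ('x \<Rightarrow> real) set \<Rightarrow> 'x set \<Rightarrow>
      ('s::semitopological_semigroup \<Rightarrow> 'x \<Rightarrow> 'x) \<Rightarrow> bool"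
  where "hypotheses_of P \<tau> Q K act \<longleftrightarrow>
    locally_convex_topology \<tau> \<and> determines Q \<tau> \<and> K \<noteq> {} \<and> convex K \<and>
    nonexpansive_action Q K act \<and>
    (case P of
      FP_D \<Rightarrow>
        compactin \<tau> K \<and> dynamical_system (subtopology \<tau> K) act
    | FP_E \<Rightarrow>
        compactin (weak_topology \<tau>) K \<and> dynamical_system (weak_on \<tau> K) act \<and>
        equicontinuous_family (weak_topology \<tau>) K (range act)
    | FP_E' \<Rightarrow>
        compactin (weak_topology \<tau>) K \<and> dynamical_system (weak_on \<tau> K) act \<and>
        normal_structure \<tau> Q K \<and>
        equicontinuous_family (weak_topology \<tau>) K (range act)
    | FP_F \<Rightarrow>
        compactin (weak_topology \<tau>) K \<and> dynamical_system (weak_on \<tau> K) act \<and>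
        (\<forall>f \<in> enveloping_semigroup (weak_on \<tau> K) act.
          continuous_map (weak_on \<tau> K) (weak_on \<tau> K) f)
    | FP_F_star \<Rightarrow>
        compactin (weak_topology \<tau>) K \<and> dynamical_system (weak_on \<tau> K) act \<and>
        jointly_continuous (weak_on \<tau> K) act \<and>
        (\<forall>f \<in> enveloping_semigroup (weak_on \<tau> K) act.
          continuous_map (weak_on \<tau> K) (weak_on \<tau> K) f)
    | FP_G \<Rightarrow>
        compactin (weak_topology \<tau>) K \<and> dynamical_system (weak_on \<tau> K) act
    | FP_G_star \<Rightarrow>
        compactin (weak_topology \<tau>) K \<and> dynamical_system (weak_on \<tau> K) act \<and>
        jointly_continuous (weak_on \<tau> K) act)"

text \<open>The semigroup \<open>'s\<close> has the property \<open>P\<close> with respect to all locally convex spaces on the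
  vector space \<open>'x\<close>. A property of \<open>'s\<close> that ranges over all locally convex spaces cannot be
  written as a single formula, because types cannot be quantified over inside a formula.
  Nothing is lost by letting the topology live on all of \<open>'x\<close> instead of a linear subspace: any
  locally convex topology of a subspace extends to \<open>'x\<close> by adding a complement with its finest
  locally convex topology. So up to isomorphism this covers every locally convex space
  whose algebraic dimension is at most that of \<open>'x\<close>.

  In the theorem, where \<open>X\<close> has type \<open>'x\<close>, the property is only assumed on the vector space
  \<open>('x \<Rightarrow> real) \<Rightarrow> 'x\<close>, which is implied by the property for all locally convex spaces. It has
  linear copies of \<open>X\<close>, of the power of \<open>X\<close> with exponent \<open>X\<close>, and of the space of functionals on
  real functions on \<open>X\<close>.\<close>

definition has_fixed_point_property ::
    "fixed_point_property_name \<Rightarrow> 's::semitopological_semigroup itself \<Rightarrow> 'x::real_vector itself \<Rightarrow> bool"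
  where "has_fixed_point_property P _ _ \<longleftrightarrow>
    (\<forall>(\<tau> :: 'x topology) Q K (act :: 's \<Rightarrow> 'x \<Rightarrow> 'x).
      hypotheses_of P \<tau> Q K act \<longrightarrow> fixed_points K act \<noteq> {})"

definition nonexpansive_retract :: "('x::real_vector \<Rightarrow> real) set \<Rightarrow> 'x set \<Rightarrow> 'x set \<Rightarrow> bool"
  where "nonexpansive_retract Q K F \<longleftrightarrow>
    (\<exists>r. r \<in> K \<rightarrow> K \<and> r ` K = F \<and> (\<forall>x\<in>K. r (r x) = r x) \<and>
      (\<forall>p\<in>Q. \<forall>x\<in>K. \<forall>y\<in>K. p (r x - r y) \<le> p (x - y)))"

end

theory Submission
  imports Defs
begin

text \<open>By Bruck's argument it suffices that every nonempty weakly compact convex invariant subset of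
  \<open>K\<close> contains a fixed point. For all properties except \<open>(E')\<close> the hypotheses are inherited by such
  subsets. A \<open>\<tau>\<close>-compact convex set has normal structure and carries the weak topology, so \<open>(E')\<close>
  implies \<open>(D)\<close>; applied to the means on the continuous functions of a weakly compact set, where
  suprema over orbits are nonexpansive seminorms, \<open>(D)\<close> gives an invariant mean and hence a weakly
  closed set \<open>A\<close> with \<open>sA = A\<close> for all \<open>s\<close>. By equicontinuity and recurrence the translations are
  isometries on \<open>A\<close>, and fragmentability of weakly compact sets makes minimal parts of \<open>A\<close> totally
  bounded for each seminorm, so that a Chebyshev center argument yields a fixed point.\<close>

text \<open>Property \<open>(E')\<close> needs the detour because normal structure asks for a center
  in the closed convex hull of \<open>K\<close>, which may fall outside a smaller invariant subset.
  The set of means is compact for pointwise convergence, but the pointwise seminorms need not be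
  nonexpansive under translation. Suprema over orbits are, and equicontinuity makes orbits totally
  bounded in the sup norm, so that on means these suprema define no finer topology. The hypothesis
  is available only on the vector space \<open>('x \<Rightarrow> real) \<Rightarrow> 'x\<close>;
  each auxiliary space is therefore embedded linearly into it, and a topology given on a subspace is
  extended by adding the absolute values of all linear functionals on a complement. These vanish on
  differences of points of the embedded set and so leave nonexpansiveness intact. The Hahn-Banach
  theorem enters through functionals dominated by a seminorm \<open>p\<close>: they make
  \<open>p\<close> weakly lower semicontinuous and thus link weak compactness to the distances
  \<open>p (x - y)\<close>.\<close>

section \<open>Elementary properties of seminorms\<close>

lemma seminorm_add: "seminorm p \<Longrightarrow> p (x + y) \<le> p x + p y"
  and seminorm_scale: "seminorm p \<Longrightarrow> p (c *\<^sub>R x) = \<bar>c\<bar> * p x"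
  by (auto simp: seminorm_def)

lemma seminorm_zero: "seminorm p \<Longrightarrow> p 0 = 0"
  using seminorm_scale[of p 0 0] by simp

lemma seminorm_minus: "seminorm p \<Longrightarrow> p (- x) = p x"
  using seminorm_scale[of p "-1" x] by simp

lemma seminorm_nonneg: "seminorm p \<Longrightarrow> 0 \<le> p x"
  using seminorm_add[of p x "- x"] seminorm_zero[of p] seminorm_minus[of p x] by simp

lemma seminorm_commute: "seminorm p \<Longrightarrow> p (x - y) = p (y - x)"
  using seminorm_minus[of p "x - y"] by simp

lemma seminorm_triangle: "seminorm p \<Longrightarrow> p (x - z) \<le> p (x - y) + p (y - z)"
  using seminorm_add[of p "x - y" "y - z"] by simp

lemma seminorm_sum: "seminorm p \<Longrightarrow> p (sum f X) \<le> (\<Sum>x\<in>X. p (f x))"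
proof (induction X rule: infinite_finite_induct)
  case (insert x X)
  then show ?case using seminorm_add[of p "f x" "sum f X"] by simp
qed (auto simp: seminorm_zero)

lemma seminorm_convex_combination:
  assumes "seminorm p" "0 \<le> u" "0 \<le> v" "u + v = 1"
    and "p (a - b) \<le> c" "p (a' - b') \<le> c"
  shows "p ((u *\<^sub>R a + v *\<^sub>R a') - (u *\<^sub>R b + v *\<^sub>R b')) \<le> c"
proof -
  have "(u *\<^sub>R a + v *\<^sub>R a') - (u *\<^sub>R b + v *\<^sub>R b') = u *\<^sub>R (a - b) + v *\<^sub>R (a' - b')"
    by (simp add: algebra_simps)
  then have "p ((u *\<^sub>R a + v *\<^sub>R a') - (u *\<^sub>R b + v *\<^sub>R b')) \<le> u * p (a - b) + v * p (a' - b')"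
    using seminorm_add[OF assms(1)] seminorm_scale[OF assms(1)] assms(2,3) by (metis abs_of_nonneg)
  also have "\<dots> \<le> u * c + v * c"
    using assms by (intro add_mono mult_left_mono) auto
  finally show ?thesis
    using assms(4) by (metis distrib_right mult_1)
qed

text \<open>Suprema and infima of seminorms yield homogeneity only as an inequality; for
  \<open>c \<noteq> 0\<close> the reverse one is the hypothesis for \<open>inverse c\<close> at
  \<open>c *\<^sub>R x\<close>.\<close>

lemma seminormI:
  assumes add: "\<And>x y. p (x + y) \<le> p x + p y" and scale: "\<And>c x. p (c *\<^sub>R x) \<le> \<bar>c\<bar> * p x"
  shows "seminorm p"
proof -
  have "p (c *\<^sub>R x) = \<bar>c\<bar> * p x" for c x
  proof (cases "c = 0")
    case True
    have "p 0 = 0" using scale[of 0 0] add[of 0 0] by simp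
    then show ?thesis using True by simp
  next
    case False
    have "p x \<le> \<bar>inverse c\<bar> * p (c *\<^sub>R x)" using scale[of "inverse c" "c *\<^sub>R x"] False by simp
    then have "\<bar>c\<bar> * p x \<le> p (c *\<^sub>R x)" using False by (simp add: field_simps)
    then show ?thesis using scale[of c x] by simp
  qed
  then show ?thesis using add by (simp add: seminorm_def)
qed

lemma seminorm_abs_linear: "linear (f :: 'a::real_vector \<Rightarrow> real) \<Longrightarrow> seminorm (\<lambda>x. \<bar>f x\<bar>)"
  by (auto simp: seminorm_def linear_add linear_scale abs_mult)

lemma seminorm_comp_linear: "seminorm p \<Longrightarrow> linear f \<Longrightarrow> seminorm (\<lambda>x. p (f x))"
  by (auto simp: seminorm_def linear_add linear_scale)

section \<open>The Hahn-Banach theorem for seminorms\<close>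

definition sublinear :: "('a::real_vector \<Rightarrow> real) \<Rightarrow> bool"
  where "sublinear p \<longleftrightarrow> (\<forall>x y. p (x + y) \<le> p x + p y) \<and> (\<forall>c\<ge>0. \<forall>x. p (c *\<^sub>R x) = c * p x)"

lemma sublinear_lower_bound:
  assumes "sublinear p" shows "- p (- x) \<le> p x"
proof -
  have "p (x + - x) \<le> p x + p (- x)" using assms unfolding sublinear_def by blast
  moreover have "p (0 *\<^sub>R 0) = 0 * p 0" using assms unfolding sublinear_def by blast
  ultimately show ?thesis by simp
qed

text \<open>The infimal convolution of \<open>p\<close> with the functional \<open>- t y \<mapsto> - t p y\<close> on the ray through \<open>- y\<close>:
  the device that makes minimal sublinear functionals linear.\<close>

lemma sublinear_directional:
  assumes p: "sublinear p"
  obtains q where "sublinear q" "\<And>x. q x \<le> p x" "\<And>x. q x \<le> p (x + y) - p y"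
proof -
  define g where "g x t = p (x + t *\<^sub>R y) - t * p y" for x t
  define q where "q x = (INF t\<in>{0..}. g x t)" for x
  have sub: "p (a + b) \<le> p a + p b" for a b using p unfolding sublinear_def by blast
  have hom: "c \<ge> 0 \<Longrightarrow> p (c *\<^sub>R a) = c * p a" for c a using p unfolding sublinear_def by blast
  \<comment> \<open>Subadditivity for \<open>t *\<^sub>R y = (x + t *\<^sub>R y) + (- x)\<close>;
    this keeps the infimum finite.\<close>
  have lower: "- p (- x) \<le> g x t" if "t \<ge> 0" for x t
    using sub[of "x + t *\<^sub>R y" "- x"] hom[OF that, of y] by (simp add: g_def)
  have bdd: "bdd_below (g x ` {0..})" for x
    using lower by (auto intro!: bdd_belowI[of _ "- p (- x)"])
  have qle: "q x \<le> g x t" if "t \<ge> 0" for x t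
    unfolding q_def using bdd that by (intro cINF_lower) auto
  have "q (a + b) \<le> q a + q b" for a b
  proof -
    \<comment> \<open>The parameters of the two infima add: \<open>t\<close> for \<open>a\<close>
      and \<open>u\<close> for \<open>b\<close> give \<open>t + u\<close> for
      \<open>a + b\<close>.\<close>
    have "q (a + b) - g a t \<le> q b" if t: "t \<ge> 0" for t
      unfolding q_def[of b]
    proof (rule cINF_greatest)
      fix u :: real assume u: "u \<in> {0..}"
      have eq: "a + b + (t + u) *\<^sub>R y = (a + t *\<^sub>R y) + (b + u *\<^sub>R y)" by (simp add: algebra_simps)
      have "q (a + b) \<le> g (a + b) (t + u)" using t u by (intro qle) auto
      also have "\<dots> \<le> g a t + g b u"
        unfolding g_def eq using sub[of "a + t *\<^sub>R y" "b + u *\<^sub>R y"] by (simp add: algebra_simps)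
      finally show "q (a + b) - g a t \<le> g b u" by simp
    qed auto
    then have "q (a + b) - q b \<le> q a"
      unfolding q_def[of a] by (intro cINF_greatest) (auto simp: algebra_simps)
    then show ?thesis by simp
  qed
  moreover have "q (c *\<^sub>R x) = c * q x" if "c \<ge> 0" for c x
  proof (cases "c = 0")
    case True
    have "p 0 = 0" using hom[of 0 0] by simp
    then have "q 0 \<le> 0" using qle[of 0 0] by (simp add: g_def)
    moreover have "0 \<le> q 0"
      unfolding q_def using lower[of _ 0] \<open>p 0 = 0\<close> by (intro cINF_greatest) auto
    ultimately show ?thesis using True by simp
  next
    case False
    with that have c: "c > 0" by simp
    \<comment> \<open>The substitution \<open>t \<mapsto> t / d\<close> gives one inequality; the
      other is the same one for \<open>inverse c\<close>.\<close>
    have le: "d * q z \<le> q (d *\<^sub>R z)" if d: "d > 0" for d z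
      unfolding q_def[of "d *\<^sub>R z"]
    proof (rule cINF_greatest)
      fix t :: real assume t: "t \<in> {0..}"
      have "d * q z \<le> d * g z (t / d)" using t d by (intro mult_left_mono qle) auto
      also have "\<dots> = g (d *\<^sub>R z) t"
        using hom[of d "z + (t / d) *\<^sub>R y"] d by (simp add: g_def algebra_simps)
      finally show "d * q z \<le> g (d *\<^sub>R z) t" .
    qed auto
    have "inverse c * q (c *\<^sub>R x) \<le> q x" using le[of "inverse c" "c *\<^sub>R x"] c by simp
    then have "q (c *\<^sub>R x) \<le> c * q x" using c by (simp add: field_simps)
    with le[OF c, of x] show ?thesis by simp
  qed
  ultimately have "sublinear q" by (simp add: sublinear_def)
  moreover have "q x \<le> p x" "q x \<le> p (x + y) - p y" for x
    using qle[of 0 x] qle[of 1 x] by (auto simp: g_def)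
  ultimately show thesis by (rule that)
qed

text \<open>Zorn's lemma gives a sublinear functional that is minimal below \<open>p\<close>. It is
  linear because its directional variants lie below it and hence coincide with it.\<close>

lemma sublinear_dominates_linear:
  assumes p: "sublinear p"
  obtains f where "linear f" "\<And>x. f x \<le> p x"
proof -
  define A where "A = {q. sublinear q \<and> q \<le> p}"
  have "\<exists>m\<in>A. \<forall>a\<in>A. m \<ge> a \<longrightarrow> a = m"
  proof (rule predicate_Zorn)
    show "partial_order_on A (relation_of (\<lambda>a b. a \<ge> b) A)"
      by (intro partial_order_on_relation_ofI) auto
  next
    fix C assume C: "C \<in> Chains (relation_of (\<lambda>a b. a \<ge> b) A)"
    then have CA: "C \<subseteq> A" by (auto simp: Chains_def relation_of_def)
    have tot: "a \<ge> b \<or> b \<ge> a" if "a \<in> C" "b \<in> C" for a b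
      using C that by (auto simp: Chains_def relation_of_def)
    show "\<exists>u\<in>A. \<forall>a\<in>C. a \<ge> u"
    proof (cases "C = {}")
      case True
      then show ?thesis using p by (auto simp: A_def)
    next
      case False
      define u where "u x = (INF q\<in>C. q x)" for x
      have lower: "- p (- x) \<le> q x" if "q \<in> C" for q x
        using sublinear_lower_bound[of q x] that CA le_funD[of q p "- x"] by (auto simp: A_def)
      have ule: "u x \<le> q x" if "q \<in> C" for q x
        unfolding u_def using that lower by (intro cINF_lower bdd_belowI2) auto
      have "u (x + y) \<le> u x + u y" for x y
      proof -
        have "u (x + y) - q x \<le> u y" if q: "q \<in> C" for q
          unfolding u_def[of y]
        proof (rule cINF_greatest[OF False])
          fix q' assume q': "q' \<in> C"
          \<comment> \<open>A common lower member of the chain lets both infima be estimated with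
            the same functional.\<close>
          obtain r where r: "r \<in> C" "r \<le> q" "r \<le> q'" using tot[OF q q'] q q' by blast
          have "u (x + y) \<le> r (x + y)" using ule r by blast
          also have "\<dots> \<le> r x + r y" using r CA by (auto simp: A_def sublinear_def)
          also have "\<dots> \<le> q x + q' y" using r by (intro add_mono) (auto simp: le_fun_def)
          finally show "u (x + y) - q x \<le> q' y" by simp
        qed
        then have "u (x + y) - u y \<le> u x"
          unfolding u_def[of x] using False by (intro cINF_greatest) (auto simp: algebra_simps)
        then show ?thesis by simp
      qed
      moreover have "u (c *\<^sub>R x) = c * u x" if c: "c \<ge> 0" for c x
      proof -
        have "u (c *\<^sub>R x) = (INF q\<in>C. c * q x)"
          unfolding u_def using CA c by (intro INF_cong) (auto simp: A_def sublinear_def)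
        also have "\<dots> = c * u x"
        proof (cases "c = 0")
          case False
          then have "c > 0" using c by simp
          show ?thesis
          proof (rule antisym)
            show "c * u x \<le> (INF q\<in>C. c * q x)"
              using \<open>C \<noteq> {}\<close> ule c by (intro cINF_greatest mult_left_mono) auto
            have "(INF q\<in>C. c * q x) / c \<le> q x" if "q \<in> C" for q
            proof -
              have "(INF q\<in>C. c * q x) \<le> c * q x"
                using that lower c
                by (intro cINF_lower bdd_belowI2[of _ "c * - p (- x)"] mult_left_mono) auto
              then show ?thesis using \<open>c > 0\<close> by (simp add: field_simps)
            qed
            then have "(INF q\<in>C. c * q x) / c \<le> u x"
              unfolding u_def using \<open>C \<noteq> {}\<close> by (intro cINF_greatest) auto
            then show "(INF q\<in>C. c * q x) \<le> c * u x" using \<open>c > 0\<close> by (simp add: field_simps)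
          qed
        qed (use \<open>C \<noteq> {}\<close> in simp)
        finally show ?thesis .
      qed
      ultimately have "sublinear u" by (simp add: sublinear_def)
      moreover have "u \<le> p"
      proof -
        obtain q where "q \<in> C" using False by blast
        then have "u \<le> q" "q \<le> p" using ule CA by (auto simp: A_def le_fun_def)
        then show ?thesis by simp
      qed
      ultimately show ?thesis using ule by (auto simp: A_def le_fun_def)
    qed
  qed
  then obtain m where m: "m \<in> A" and min: "\<And>a. a \<in> A \<Longrightarrow> a \<le> m \<Longrightarrow> a = m" by blast
  have sub: "m (a + b) \<le> m a + m b" and hom: "c \<ge> 0 \<Longrightarrow> m (c *\<^sub>R a) = c * m a" for a b c
    using m unfolding A_def sublinear_def by blast+
  have add: "m (x + y) = m x + m y" for x y
  proof -
    have "sublinear m" using m by (simp add: A_def)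
    then obtain q where q: "sublinear q" "\<And>x. q x \<le> m x" "\<And>x. q x \<le> m (x + y) - m y"
      using sublinear_directional by blast
    then have "q \<in> A" using m by (auto simp: A_def le_fun_def intro: order_trans)
    \<comment> \<open>Now the bound \<open>q x \<le> m (x + y) - m y\<close> is the missing
      superadditivity of \<open>m\<close>.\<close>
    then have "q = m" using min q(2) by (auto simp: le_fun_def)
    then show ?thesis using q(3)[of x] sub[of x y] by simp
  qed
  have "m (- x) = - m x" for x
    using add[of x "- x"] hom[of 0 0] by simp
  then have "m (c *\<^sub>R x) = c * m x" for c x
    using hom[of c x] hom[of "- c" "- x"] by (cases "c \<ge> 0") auto
  then have "linear m" using add by (intro linearI) auto
  moreover have "m x \<le> p x" for x using m by (auto simp: A_def le_fun_def)
  ultimately show thesis by (rule that)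
qed

text \<open>Equality at \<open>a\<close> is built in by taking a linear minorant of the directional
  variant \<open>q\<close> of \<open>p\<close> at \<open>a\<close>: from
  \<open>q (- a) \<le> p 0 - p a\<close> follows \<open>f a \<ge> p a\<close>.\<close>

theorem seminorm_supporting_functional:
  assumes p: "seminorm p"
  obtains f where "linear f" "\<And>x. \<bar>f x\<bar> \<le> p x" "f a = p a"
proof -
  have "sublinear p" using p by (auto simp: seminorm_def sublinear_def)
  then obtain q where q: "sublinear q" "\<And>x. q x \<le> p x" "\<And>x. q x \<le> p (x + a) - p a"
    using sublinear_directional by blast
  obtain f where f: "linear f" "\<And>x. f x \<le> q x" using sublinear_dominates_linear[OF q(1)] by blast
  have le: "f x \<le> p x" for x using f(2) q(2) order_trans by blast
  have "f (- a) \<le> - p a" using f(2)[of "- a"] q(3)[of "- a"] seminorm_zero[OF p] by simp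
  then have "f a = p a" using le[of a] f(1) by (simp add: linear_neg)
  moreover have "\<bar>f x\<bar> \<le> p x" for x
    using le[of x] le[of "- x"] f(1) seminorm_minus[OF p] by (simp add: linear_neg)
  ultimately show thesis using f(1) that by blast
qed

section \<open>Locally convex topologies and weak topologies\<close>

definition seminorm_topology :: "('x::real_vector \<Rightarrow> real) set \<Rightarrow> 'x topology"
  where "seminorm_topology Q = topology (\<lambda>U. \<forall>x\<in>U. \<exists>F e. finite F \<and> F \<subseteq> Q \<and> e > 0 \<and>
    {y. \<forall>p\<in>F. p (y - x) < e} \<subseteq> U)"

lemma openin_seminorm_topology:
  "openin (seminorm_topology Q) U \<longleftrightarrow>
    (\<forall>x\<in>U. \<exists>F e. finite F \<and> F \<subseteq> Q \<and> e > 0 \<and> {y. \<forall>p\<in>F. p (y - x) < e} \<subseteq> U)"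
proof -
  define L where "L U \<longleftrightarrow> (\<forall>x\<in>U. \<exists>F e. finite F \<and> F \<subseteq> Q \<and> e > 0 \<and>
    {y. \<forall>p\<in>F. p (y - x) < (e::real)} \<subseteq> U)" for U
  have "L (S \<inter> T)" if S: "L S" and T: "L T" for S T
    unfolding L_def
  proof
    fix x assume x: "x \<in> S \<inter> T"
    obtain F e where F: "finite F" "F \<subseteq> Q" "e > 0" "{y. \<forall>p\<in>F. p (y - x) < e} \<subseteq> S"
      using bspec[OF S[unfolded L_def] IntD1[OF x]] by (elim exE conjE) (rule that)
    obtain G d where G: "finite G" "G \<subseteq> Q" "d > 0" "{y. \<forall>p\<in>G. p (y - x) < d} \<subseteq> T"
      using bspec[OF T[unfolded L_def] IntD2[OF x]] by (elim exE conjE) (rule that)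
    have "{y. \<forall>p\<in>F \<union> G. p (y - x) < min e d} \<subseteq> S \<inter> T"
      using F(4) G(4) by auto
    then show "\<exists>F e. finite F \<and> F \<subseteq> Q \<and> e > 0 \<and> {y. \<forall>p\<in>F. p (y - x) < e} \<subseteq> S \<inter> T"
      using F G by (intro exI[of _ "F \<union> G"] exI[of _ "min e d"]) auto
  qed
  moreover have "L (\<Union>\<K>)" if LK: "\<forall>S\<in>\<K>. L S" for \<K>
    unfolding L_def
  proof
    fix x assume "x \<in> \<Union>\<K>"
    then obtain S where S: "S \<in> \<K>" "x \<in> S" by blast
    then obtain F e where "finite F" "F \<subseteq> Q" "e > 0" "{y. \<forall>p\<in>F. p (y - x) < e} \<subseteq> S"
      using bspec[OF bspec[OF LK S(1), unfolded L_def] S(2)] by (elim exE conjE) (rule that)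
    then show "\<exists>F e. finite F \<and> F \<subseteq> Q \<and> e > 0 \<and> {y. \<forall>p\<in>F. p (y - x) < e} \<subseteq> \<Union>\<K>"
      using Union_upper[OF S(1)] by (intro exI[of _ F] exI[of _ e]) simp
  qed
  ultimately have "istopology L" by (simp add: istopology_def)
  then have "openin (topology L) = L" by (rule topology_inverse')
  moreover have "seminorm_topology Q = topology L"
    unfolding seminorm_topology_def L_def ..
  ultimately have "openin (seminorm_topology Q) U = L U" by simp
  then show ?thesis by (simp only: L_def)
qed

section \<open>Topologies determined by families of seminorms\<close>

lemma determines_seminorm: "determines Q \<tau> \<Longrightarrow> p \<in> Q \<Longrightarrow> seminorm p"
  by (auto simp: determines_def)

lemma determines_openin_iff:
  "determines Q \<tau> \<Longrightarrow> openin \<tau> U \<longleftrightarrow>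
      (\<forall>x\<in>U. \<exists>F e. finite F \<and> F \<subseteq> Q \<and> e > 0 \<and> {y. \<forall>p\<in>F. p (y - x) < e} \<subseteq> U)"
  unfolding determines_def by blast

lemma determines_neighbourhood:
  assumes "determines Q \<tau>" "openin \<tau> U" "x \<in> U"
  obtains F e where "finite F" "F \<subseteq> Q" "e > 0" "{y. \<forall>p\<in>F. p (y - x) < e} \<subseteq> U"
proof -
  have "\<exists>F e. finite F \<and> F \<subseteq> Q \<and> e > 0 \<and> {y. \<forall>p\<in>F. p (y - x) < e} \<subseteq> U"
    using determines_openin_iff[OF assms(1)] assms(2,3) by simp
  then show thesis by (elim exE conjE) (rule that)
qed

text \<open>Only the description of the open sets is assumed, so that it applies to
  \<open>seminorm_topology\<close> before that topology is known to be determined by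
  \<open>Q\<close>.\<close>

lemma basic_neighbourhood_open:
  assumes sn: "\<And>p. p \<in> Q \<Longrightarrow> seminorm p"
    and op: "\<And>U. openin \<tau> U \<longleftrightarrow>
      (\<forall>x\<in>U. \<exists>F e. finite F \<and> F \<subseteq> Q \<and> e > 0 \<and> {y. \<forall>p\<in>F. p (y - x) < e} \<subseteq> U)"
    and F: "finite F" "F \<subseteq> Q"
  shows "openin \<tau> {y. \<forall>p\<in>F. p (y - x) < e}"
  unfolding op
proof
  fix z assume z: "z \<in> {y. \<forall>p\<in>F. p (y - x) < e}"
  \<comment> \<open>The least slack at \<open>z\<close> over \<open>F\<close>; the \<open>1\<close>
    covers the case \<open>F = {}\<close>.\<close>
  define d where "d = Min (insert 1 ((\<lambda>p. e - p (z - x)) ` F))"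
  have "d > 0" using z F by (auto simp: d_def)
  have dle: "d \<le> e - p (z - x)" if "p \<in> F" for p
    unfolding d_def using that F by (intro Min_le) auto
  have "{y. \<forall>p\<in>F. p (y - z) < d} \<subseteq> {y. \<forall>p\<in>F. p (y - x) < e}"
  proof (intro subsetI CollectI ballI)
    fix y p assume "y \<in> {y. \<forall>p\<in>F. p (y - z) < d}" "p \<in> F"
    then show "p (y - x) < e"
      using seminorm_triangle[OF sn, of p y x z] dle[of p] F by fastforce
  qed
  then show "\<exists>G d. finite G \<and> G \<subseteq> Q \<and> d > 0 \<and> {y. \<forall>p\<in>G. p (y - z) < d} \<subseteq> {y. \<forall>p\<in>F. p (y - x) < e}"
    using F \<open>d > 0\<close> by blast
qed

lemma determines_basic_open:
  assumes "determines Q \<tau>" "finite F" "F \<subseteq> Q"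
  shows "openin \<tau> {y. \<forall>p\<in>F. p (y - x) < e}"
  using basic_neighbourhood_open[OF _ _ assms(2,3)] determines_seminorm[OF assms(1)]
    determines_openin_iff[OF assms(1)] by blast

lemma determines_ball_open:
  "determines Q \<tau> \<Longrightarrow> p \<in> Q \<Longrightarrow> openin \<tau> {y. p (y - x) < e}"
  using determines_basic_open[of Q \<tau> "{p}" x e] by simp

lemma determines_topspace: "determines Q \<tau> \<Longrightarrow> topspace \<tau> = UNIV"
  using determines_basic_open[of Q \<tau> "{}" undefined 1] openin_subset by fastforce

lemma continuous_map_dominated_functional:
  fixes f :: "'x::real_vector \<Rightarrow> real"
  assumes top: "topspace \<tau> = UNIV" and op: "\<And>x e. openin \<tau> {y. p (y - x) < e}"
    and "p 0 = 0" and dom: "\<And>x y. \<bar>f x - f y\<bar> \<le> p (x - y)"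
  shows "continuous_map \<tau> euclideanreal f"
  unfolding continuous_map_def
proof (intro conjI allI impI)
  fix U :: "real set" assume "openin euclidean U"
  then have U: "open U" by simp
  show "openin \<tau> {x \<in> topspace \<tau>. f x \<in> U}"
  proof (subst openin_subopen, intro ballI)
    fix x assume "x \<in> {x \<in> topspace \<tau>. f x \<in> U}"
    then obtain e where e: "e > 0" "ball (f x) e \<subseteq> U" using U openE by blast
    have "{y. p (y - x) < e} \<subseteq> {x \<in> topspace \<tau>. f x \<in> U}"
    proof
      fix y assume "y \<in> {y. p (y - x) < e}"
      then have "f y \<in> ball (f x) e" using dom[of y x] by (auto simp: dist_real_def)
      then show "y \<in> {x \<in> topspace \<tau>. f x \<in> U}" using e top by auto
    qed
    then show "\<exists>T. openin \<tau> T \<and> x \<in> T \<and> T \<subseteq> {x \<in> topspace \<tau>. f x \<in> U}"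
      using op[of x e] e assms(3) by (intro exI[of _ "{y. p (y - x) < e}"]) auto
  qed
qed auto

lemma determines_seminorm_topology:
  assumes sn: "\<And>p. p \<in> Q \<Longrightarrow> seminorm p"
  shows "determines Q (seminorm_topology Q)"
  unfolding determines_def
proof (intro conjI ballI allI)
  fix p assume p: "p \<in> Q"
  show "seminorm p" using sn p .
  have op: "openin (seminorm_topology Q) {y. \<forall>p\<in>F. p (y - x) < e}" if "finite F" "F \<subseteq> Q" for F x e
    using basic_neighbourhood_open[OF sn openin_seminorm_topology that] .
  show "continuous_map (seminorm_topology Q) euclideanreal p"
  proof (rule continuous_map_dominated_functional)
    show "topspace (seminorm_topology Q) = UNIV"
      using op[of "{}" undefined 1] openin_subset by fastforce
    show "openin (seminorm_topology Q) {y. p (y - x) < e}" for x e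
      using op[of "{p}" x e] p by simp
    show "p 0 = 0" using seminorm_zero sn p by blast
    show "\<bar>p x - p y\<bar> \<le> p (x - y)" for x y
      using seminorm_add[OF sn[OF p], of "x - y" y] seminorm_add[OF sn[OF p], of "y - x" x]
        seminorm_commute[OF sn[OF p], of x y] by simp
  qed
qed (rule openin_seminorm_topology)

lemma locally_convex_of_determines:
  assumes det: "determines Q \<tau>" and sep: "\<And>x. (\<And>p. p \<in> Q \<Longrightarrow> p x = 0) \<Longrightarrow> x = 0"
  shows "locally_convex_topology \<tau>"
  unfolding locally_convex_topology_def
proof (intro conjI allI impI)
  have sn: "seminorm p" if "p \<in> Q" for p using det that by (rule determines_seminorm)
  show top: "topspace \<tau> = UNIV" using det by (rule determines_topspace)
  show "Hausdorff_space \<tau>"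
    unfolding Hausdorff_space_def
  proof (intro allI impI)
    fix x y assume "x \<in> topspace \<tau> \<and> y \<in> topspace \<tau> \<and> x \<noteq> y"
    then obtain p where p: "p \<in> Q" "p (x - y) \<noteq> 0" using sep[of "x - y"] by auto
    define d where "d = p (x - y) / 2"
    have "d > 0" using p seminorm_nonneg[OF sn[OF p(1)], of "x - y"] by (simp add: d_def)
    have "disjnt {z. p (z - x) < d} {z. p (z - y) < d}"
    proof -
      have "\<not> (p (z - x) < d \<and> p (z - y) < d)" for z
        using seminorm_triangle[OF sn[OF p(1)], of x y z] seminorm_commute[OF sn[OF p(1)], of x z]
        by (auto simp: d_def)
      then show ?thesis by (auto simp: disjnt_def)
    qed
    then show "\<exists>U V. openin \<tau> U \<and> openin \<tau> V \<and> x \<in> U \<and> y \<in> V \<and> disjnt U V"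
      using determines_ball_open[OF det p(1)] seminorm_zero[OF sn[OF p(1)]] \<open>d > 0\<close>
      by (intro exI[of _ "{z. p (z - x) < d}"] exI[of _ "{z. p (z - y) < d}"]) auto
  qed
  show "continuous_map (prod_topology \<tau> \<tau>) \<tau> (\<lambda>(x, y). x + y)"
    unfolding continuous_map_def
  proof (intro conjI allI impI)
    fix U assume U: "openin \<tau> U"
    show "openin (prod_topology \<tau> \<tau>) {z \<in> topspace (prod_topology \<tau> \<tau>). (case z of (x, y) \<Rightarrow> x + y) \<in> U}"
      unfolding openin_prod_topology_alt
    proof (intro allI impI)
      fix x y assume "(x, y) \<in> {z \<in> topspace (prod_topology \<tau> \<tau>). (case z of (x, y) \<Rightarrow> x + y) \<in> U}"
      then have "x + y \<in> U" by simp
      then obtain F e where F: "finite F" "F \<subseteq> Q" "e > 0" "{z. \<forall>p\<in>F. p (z - (x + y)) < e} \<subseteq> U"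
        by (rule determines_neighbourhood[OF det U])
      define W where "W x = {z. \<forall>p\<in>F. p (z - x) < e / 2}" for x
      have "x' + y' \<in> U" if "x' \<in> W x" "y' \<in> W y" for x' y'
      proof -
        have "p (x' + y' - (x + y)) < e" if "p \<in> F" for p
        proof -
          have "p (x' - x) < e / 2" "p (y' - y) < e / 2"
            using \<open>x' \<in> W x\<close> \<open>y' \<in> W y\<close> that by (auto simp: W_def)
          moreover have "p ((x' - x) + (y' - y)) \<le> p (x' - x) + p (y' - y)"
            using seminorm_add sn F that by blast
          moreover have "x' + y' - (x + y) = (x' - x) + (y' - y)" by simp
          ultimately show ?thesis by (smt (verit) field_sum_of_halves)
        qed
        then show ?thesis using F(4) by blast
      qed
      moreover have "openin \<tau> (W z)" for z
        unfolding W_def by (rule determines_basic_open[OF det F(1,2)])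
      moreover have "p 0 = 0" if "p \<in> F" for p using that F(2) sn seminorm_zero by blast
      then have "p (z - z) < e / 2" if "p \<in> F" for p z using that F(3) by force
      then have "z \<in> W z" for z unfolding W_def by blast
      ultimately show "\<exists>V W. openin \<tau> V \<and> openin \<tau> W \<and> x \<in> V \<and> y \<in> W \<and>
          V \<times> W \<subseteq> {z \<in> topspace (prod_topology \<tau> \<tau>). (case z of (x, y) \<Rightarrow> x + y) \<in> U}"
        using top by (intro exI[of _ "W x"] exI[of _ "W y"]) auto
    qed
  qed (use top in auto)
  show "continuous_map (prod_topology euclideanreal \<tau>) \<tau> (\<lambda>(c, x). c *\<^sub>R x)"
    unfolding continuous_map_def
  proof (intro conjI allI impI)
    fix U assume U: "openin \<tau> U"
    show "openin (prod_topology euclideanreal \<tau>)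
      {z \<in> topspace (prod_topology euclideanreal \<tau>). (case z of (c, x) \<Rightarrow> c *\<^sub>R x) \<in> U}"
      unfolding openin_prod_topology_alt
    proof (intro allI impI)
      fix c x assume "(c, x) \<in> {z \<in> topspace (prod_topology euclideanreal \<tau>).
        (case z of (c, x) \<Rightarrow> c *\<^sub>R x) \<in> U}"
      then have "c *\<^sub>R x \<in> U" by simp
      then obtain F e where F: "finite F" "F \<subseteq> Q" "e > 0" "{z. \<forall>p\<in>F. p (z - c *\<^sub>R x) < e} \<subseteq> U"
        by (rule determines_neighbourhood[OF det U])
      \<comment> \<open>The difference splits into \<open>c' *\<^sub>R (x' - x)\<close> and
        \<open>(c' - c) *\<^sub>R x\<close>. The radii \<open>d\<close> and \<open>e'\<close> allot
        \<open>e / 2\<close> to each, with \<open>d \<le> 1\<close> bounding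
        \<open>\<bar>c'\<bar>\<close> by \<open>\<bar>c\<bar> + 1\<close>; the \<open>1\<close> in
        \<open>M\<close> avoids division by zero.\<close>
      define M where "M = (\<Sum>p\<in>F. p x) + 1"
      have nn: "p z \<ge> 0" if "p \<in> F" for p z using that F sn seminorm_nonneg by blast
      have M: "M > 0" "\<And>p. p \<in> F \<Longrightarrow> p x \<le> M"
        using F nn sum_nonneg[of F "\<lambda>p. p x"] member_le_sum[of _ F "\<lambda>p. p x"]
        by (auto simp: M_def add_increasing2)
      define d where "d = min 1 (e / (2 * M))"
      define e' where "e' = e / (2 * (\<bar>c\<bar> + 1))"
      have d: "d > 0" "d \<le> 1" "d * M \<le> e / 2" and e': "e' > 0" "(\<bar>c\<bar> + 1) * e' = e / 2"
        using F(3) M(1) by (auto simp: d_def e'_def min_def field_simps)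
      define W where "W = {z. \<forall>p\<in>F. p (z - x) < e'}"
      have "c' *\<^sub>R x' \<in> U" if c': "c' \<in> ball c d" and x': "x' \<in> W" for c' x'
      proof -
        have "p (c' *\<^sub>R x' - c *\<^sub>R x) < e" if p: "p \<in> F" for p
        proof -
          have pn: "seminorm p" using sn F p by blast
          have "c' *\<^sub>R x' - c *\<^sub>R x = c' *\<^sub>R (x' - x) + (c' - c) *\<^sub>R x" by (simp add: algebra_simps)
          then have "p (c' *\<^sub>R x' - c *\<^sub>R x) \<le> \<bar>c'\<bar> * p (x' - x) + \<bar>c' - c\<bar> * p x"
            using seminorm_add[OF pn] seminorm_scale[OF pn] by metis
          also have "\<bar>c'\<bar> * p (x' - x) \<le> (\<bar>c\<bar> + 1) * p (x' - x)"
            using c' d nn[OF p] by (intro mult_right_mono) (auto simp: dist_real_def)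
          also have "\<dots> < (\<bar>c\<bar> + 1) * e'"
            using x' p by (intro mult_strict_left_mono) (auto simp: W_def)
          also have "\<bar>c' - c\<bar> * p x \<le> d * M"
            using c' M(2)[OF p] nn[OF p] d by (intro mult_mono) (auto simp: dist_real_def)
          finally show ?thesis using d e' by simp
        qed
        then show ?thesis using F(4) by blast
      qed
      moreover have "openin \<tau> W"
        unfolding W_def by (rule determines_basic_open[OF det F(1,2)])
      moreover have "p 0 = 0" if "p \<in> F" for p using that F(2) sn seminorm_zero by blast
      then have "p (x - x) < e'" if "p \<in> F" for p using that e' by force
      then have "x \<in> W" unfolding W_def by blast
      ultimately show "\<exists>V W. openin euclideanreal V \<and> openin \<tau> W \<and> c \<in> V \<and> x \<in> W \<and>
          V \<times> W \<subseteq> {z \<in> topspace (prod_topology euclideanreal \<tau>). (case z of (c, x) \<Rightarrow> c *\<^sub>R x) \<in> U}"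
        using top d by (intro exI[of _ "ball c d"] exI[of _ W]) auto
    qed
  qed (use top in auto)
  fix U assume U: "openin \<tau> U \<and> 0 \<in> U"
  obtain F e where F: "finite F" "F \<subseteq> Q" "e > 0" "{z. \<forall>p\<in>F. p (z - 0) < e} \<subseteq> U"
    by (rule determines_neighbourhood[OF det conjunct1[OF U] conjunct2[OF U]])
  define V where "V = {z. \<forall>p\<in>F. p (z - 0) < e}"
  have "convex V"
    unfolding convex_def
  proof (intro ballI allI impI)
    fix x y and u v :: real assume *: "x \<in> V" "y \<in> V" "0 \<le> u" "0 \<le> v" "u + v = 1"
    have "p (u *\<^sub>R x + v *\<^sub>R y) < e" if "p \<in> F" for p
    proof -
      define c where "c = max (p x) (p y)"
      have "p ((u *\<^sub>R x + v *\<^sub>R y) - (u *\<^sub>R 0 + v *\<^sub>R 0)) \<le> c"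
        by (rule seminorm_convex_combination[OF sn]) (use * F(2) that in \<open>auto simp: c_def\<close>)
      moreover have "c < e" using * that by (auto simp: c_def V_def)
      ultimately show ?thesis by simp
    qed
    then show "u *\<^sub>R x + v *\<^sub>R y \<in> V" by (simp add: V_def)
  qed
  moreover have "p (0 - 0) < e" if "p \<in> F" for p
    using seminorm_zero[of p] sn[of p] that F by auto
  then have "0 \<in> V" unfolding V_def by blast
  ultimately show "\<exists>V. openin \<tau> V \<and> convex V \<and> 0 \<in> V \<and> V \<subseteq> U"
    using F(4) determines_basic_open[OF det F(1,2), of 0 e]
    by (intro exI[of _ V]) (simp only: V_def[symmetric] simp_thms)
qed

lemma determines_separating:
  assumes det: "determines Q \<tau>" and haus: "Hausdorff_space \<tau>" and "\<And>p. p \<in> Q \<Longrightarrow> p x = 0"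
  shows "x = 0"
proof (rule ccontr)
  assume "x \<noteq> 0"
  then obtain U V where UV: "openin \<tau> U" "0 \<in> U" "x \<in> V" "disjnt U V"
    using haus determines_topspace[OF det] unfolding Hausdorff_space_def by (metis UNIV_I)
  obtain F e where F: "F \<subseteq> Q" "e > 0" "{y. \<forall>p\<in>F. p (y - 0) < e} \<subseteq> U"
    by (rule determines_neighbourhood[OF det UV(1,2)])
  have "p (x - 0) < e" if "p \<in> F" for p using assms(3)[of p] that F(1,2) by auto
  then have "x \<in> U" using F(3) by blast
  then show False using UV by (auto simp: disjnt_def)
qed

section \<open>Weak topologies\<close>

lemma weak_topology_topspace: "topspace (weak_topology \<tau>) = UNIV"
proof -
  have "linear (\<lambda>x. 0 :: real)" by (intro linearI) auto
  then have "UNIV \<in> {f -` U | f U. linear f \<and> continuous_map \<tau> euclideanreal f \<and> open (U :: real set)}"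
    by (intro CollectI exI[of _ "\<lambda>x. 0"] exI[of _ UNIV]) auto
  then show ?thesis
    unfolding weak_topology_def topology_generated_by_topspace by blast
qed

lemma weak_topology_functional:
  assumes "linear f" "continuous_map \<tau> euclideanreal f"
  shows "continuous_map (weak_topology \<tau>) euclideanreal f"
  unfolding continuous_map_def
proof (intro conjI allI impI)
  fix U :: "real set" assume U: "openin euclidean U"
  have "openin (weak_topology \<tau>) (f -` U)"
    unfolding weak_topology_def using assms U by (intro topology_generated_by_Basis) auto
  moreover have "{x \<in> topspace (weak_topology \<tau>). f x \<in> U} = f -` U"
    by (auto simp: weak_topology_topspace)
  ultimately show "openin (weak_topology \<tau>) {x \<in> topspace (weak_topology \<tau>). f x \<in> U}" by simp
qed auto

lemma continuous_map_into_weak_topology: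
  assumes "\<And>f. linear f \<Longrightarrow> continuous_map \<tau> euclideanreal f \<Longrightarrow> continuous_map X euclideanreal (\<lambda>x. f (g x))"
  shows "continuous_map X (weak_topology \<tau>) g"
proof -
  define S where "S = {f -` U | f U. linear f \<and> continuous_map \<tau> euclideanreal f \<and> open (U :: real set)}"
  have "openin X (g -` W \<inter> topspace X)" if W: "W \<in> S" for W
  proof -
    obtain f and U :: "real set" where f: "W = f -` U" "linear f" "continuous_map \<tau> euclideanreal f" "open U"
      using W by (auto simp: S_def)
    then have "openin X {x \<in> topspace X. f (g x) \<in> U}"
      using openin_continuous_map_preimage[OF assms[OF f(2,3)], of U] by (simp only: open_openin)
    moreover have "{x \<in> topspace X. f (g x) \<in> U} = g -` W \<inter> topspace X" using f by auto
    ultimately show ?thesis by simp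
  qed
  moreover have "g ` topspace X \<subseteq> \<Union>S"
    using weak_topology_topspace[of \<tau>] unfolding weak_topology_def topology_generated_by_topspace S_def
    by simp
  ultimately show ?thesis
    unfolding weak_topology_def continuous_on_generated_topo_iff S_def by blast
qed

lemma weak_topology_coarser: "continuous_map \<tau> (weak_topology \<tau>) (\<lambda>x. x)"
  by (rule continuous_map_into_weak_topology)

lemma weak_openin_imp_openin: 
  assumes "topspace \<tau> = UNIV" "openin (weak_topology \<tau>) U"
  shows "openin \<tau> U"
  using openin_continuous_map_preimage[OF weak_topology_coarser assms(2)] assms(1) by simp

lemma linear_continuous_imp_weakly_continuous:
  assumes "linear g" "continuous_map \<tau> \<sigma> g"
  shows "continuous_map (weak_topology \<tau>) (weak_topology \<sigma>) g"
proof (rule continuous_map_into_weak_topology)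
  fix f assume f: "linear f" "continuous_map \<sigma> euclideanreal f"
  show "continuous_map (weak_topology \<tau>) euclideanreal (\<lambda>x. f (g x))"
    using linear_compose[OF assms(1) f(1)] continuous_map_compose[OF assms(2) f(2)]
    by (intro weak_topology_functional) (auto simp: o_def)
qed

lemma determines_dominated_functional:
  assumes det: "determines Q \<tau>" and p: "p \<in> Q" and f: "linear f" "\<And>x. \<bar>f x\<bar> \<le> p x"
  shows "continuous_map \<tau> euclideanreal f"
proof (rule continuous_map_dominated_functional)
  show "topspace \<tau> = UNIV" using det by (rule determines_topspace)
  show "openin \<tau> {y. p (y - x) < e}" for x e using det p by (rule determines_ball_open)
  show "p 0 = 0" using seminorm_zero determines_seminorm det p by blast
  show "\<bar>f x - f y\<bar> \<le> p (x - y)" for x y using f(2)[of "x - y"] f(1) by (simp add: linear_diff)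
qed

lemma weak_supporting_functional:
  assumes det: "determines Q \<tau>" and p: "p \<in> Q"
  obtains f where "linear f" "continuous_map (weak_topology \<tau>) euclideanreal f"
    "\<And>x. \<bar>f x\<bar> \<le> p x" "f a = p a"
proof -
  obtain f where f: "linear f" "\<And>x. \<bar>f x\<bar> \<le> p x" "f a = p a"
    using seminorm_supporting_functional[OF determines_seminorm[OF det p]] by blast
  with determines_dominated_functional[OF det p] weak_topology_functional that show thesis by blast
qed

text \<open>Weak lower semicontinuity: \<open>p\<close> is the supremum of the functionals that it dominates.\<close>

lemma closedin_seminorm_le:
  assumes det: "determines Q \<tau>" and p: "p \<in> Q"
    and g: "continuous_map X (weak_topology \<tau>) g" and h: "continuous_map X (weak_topology \<tau>) h"
  shows "closedin X {x \<in> topspace X. p (g x - h x) \<le> r}"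
proof -
  define \<F> where "\<F> = {f. linear f \<and> continuous_map (weak_topology \<tau>) euclideanreal f \<and> (\<forall>x. \<bar>f x\<bar> \<le> p x)}"
  define C where "C f = {x \<in> topspace X. f (g x) - f (h x) \<in> {..r}}" for f
  have "{x \<in> topspace X. p (g x - h x) \<le> r} = \<Inter> (C ` \<F>)"
  proof (intro set_eqI iffI)
    fix x assume x: "x \<in> {x \<in> topspace X. p (g x - h x) \<le> r}"
    have "f (g x) - f (h x) \<le> p (g x - h x)" if "f \<in> \<F>" for f
      using that by (auto simp: \<F>_def linear_diff[symmetric] abs_le_iff)
    then show "x \<in> \<Inter> (C ` \<F>)" using x by (force simp: C_def)
  next
    fix x assume x: "x \<in> \<Inter> (C ` \<F>)"
    obtain f where f: "f \<in> \<F>" "f (g x - h x) = p (g x - h x)"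
      using weak_supporting_functional[OF det p] unfolding \<F>_def by blast
    then have "x \<in> C f" using x by blast
    then show "x \<in> {x \<in> topspace X. p (g x - h x) \<le> r}"
      using f by (auto simp: C_def \<F>_def linear_diff)
  qed
  moreover have "closedin X (C f)" if "f \<in> \<F>" for f
  proof -
    have "continuous_map X euclideanreal (\<lambda>x. f (g x) - f (h x))"
      using continuous_map_compose[OF g, of euclideanreal f] continuous_map_compose[OF h, of euclideanreal f] that
      by (intro continuous_map_diff) (auto simp: \<F>_def o_def)
    then show ?thesis
      unfolding C_def by (rule closedin_continuous_map_preimage) simp
  qed
  moreover have "\<F> \<noteq> {}" using weak_supporting_functional[OF det p] unfolding \<F>_def by blast
  ultimately show ?thesis by auto
qed

lemma weak_topology_Hausdorff:
  assumes det: "determines Q \<tau>" and haus: "Hausdorff_space \<tau>"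
  shows "Hausdorff_space (weak_topology \<tau>)"
  unfolding Hausdorff_space_def
proof (intro allI impI)
  fix x y assume "x \<in> topspace (weak_topology \<tau>) \<and> y \<in> topspace (weak_topology \<tau>) \<and> x \<noteq> y"
  then obtain p where p: "p \<in> Q" "p (x - y) \<noteq> 0"
    using determines_separating[OF det haus, of "x - y"] by auto
  obtain f where f: "linear f" "continuous_map (weak_topology \<tau>) euclideanreal f" "f (x - y) = p (x - y)"
    using weak_supporting_functional[OF det p(1)] by metis
  then have "f x \<noteq> f y" using p by (auto simp: linear_diff)
  then obtain U V where "open U" "open V" "f x \<in> U" "f y \<in> V" "U \<inter> V = {}"
    using hausdorff[of "f x" "f y"] by auto
  moreover have "openin (weak_topology \<tau>) {z \<in> topspace (weak_topology \<tau>). f z \<in> W}" if "open W" for W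
    using openin_continuous_map_preimage[OF f(2), of W] that by (simp only: open_openin)
  ultimately show "\<exists>U V. openin (weak_topology \<tau>) U \<and> openin (weak_topology \<tau>) V \<and> x \<in> U \<and> y \<in> V \<and> disjnt U V"
    by (intro exI[of _ "{z \<in> topspace (weak_topology \<tau>). f z \<in> U}"]
        exI[of _ "{z \<in> topspace (weak_topology \<tau>). f z \<in> V}"])
      (auto simp: disjnt_def weak_topology_topspace)
qed

lemma compactin_weak_topology:
  assumes "compactin \<tau> K" shows "compactin (weak_topology \<tau>) K"
  using image_compactin[OF assms weak_topology_coarser] by simp

text \<open>The identity of \<open>K\<close> is a continuous bijection from the compact given
  topology to the Hausdorff weak one, hence a closed map.\<close>

lemma weak_topology_eq_on_compact:
  assumes "determines Q \<tau>" "Hausdorff_space \<tau>" "compactin \<tau> K"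
  shows "weak_on \<tau> K = subtopology \<tau> K"
proof -
  have H: "Hausdorff_space (weak_on \<tau> K)"
    using weak_topology_Hausdorff assms Hausdorff_space_subtopology by blast
  have c: "continuous_map (subtopology \<tau> K) (weak_on \<tau> K) (\<lambda>x. x)"
    by (auto simp: continuous_map_in_subtopology intro!: continuous_map_from_subtopology weak_topology_coarser)
  have top: "topspace (weak_on \<tau> K) = K" "topspace (subtopology \<tau> K) = K"
    using determines_topspace[OF assms(1)] by (auto simp: weak_topology_topspace)
  have cl: "closedin (weak_on \<tau> K) C" if "closedin (subtopology \<tau> K) C" for C
  proof -
    have "compactin (subtopology \<tau> K) C"
      using closedin_compact_space that assms(3) compact_space_subtopology by blast
    from image_compactin[OF this c] have "compactin (weak_on \<tau> K) C" by simp
    then show ?thesis using H compactin_imp_closedin by blast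
  qed
  have "openin (weak_on \<tau> K) U \<longleftrightarrow> openin (subtopology \<tau> K) U" for U
  proof
    assume U: "openin (weak_on \<tau> K) U"
    then have "U \<subseteq> K" using openin_subset top by metis
    then have "{x \<in> K. x \<in> U} = U" by blast
    with openin_continuous_map_preimage[OF c U, unfolded top(2)] show "openin (subtopology \<tau> K) U"
      by (simp only:)
  next
    assume U: "openin (subtopology \<tau> K) U"
    then have "U \<subseteq> K" using openin_subset top by metis
    moreover have "closedin (weak_on \<tau> K) (K - U)" using U cl top by (metis closedin_diff closedin_topspace)
    ultimately show "openin (weak_on \<tau> K) U" using openin_closedin top by metis
  qed
  then show ?thesis by (simp add: topology_eq)
qed

lemma continuous_map_nonexpansive:
  assumes det: "determines Q \<tau>" and f: "f \<in> K \<rightarrow> K"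
    and ne: "\<And>p x y. p \<in> Q \<Longrightarrow> x \<in> K \<Longrightarrow> y \<in> K \<Longrightarrow> p (f x - f y) \<le> p (x - y)"
  shows "continuous_map (subtopology \<tau> K) (subtopology \<tau> K) f"
proof -
  have top: "topspace (subtopology \<tau> K) = K" using determines_topspace[OF det] by simp
  have "openin (subtopology \<tau> K) {x \<in> K. f x \<in> U}" if U: "openin \<tau> U" for U
  proof (subst openin_subopen, intro ballI)
    fix x assume x: "x \<in> {x \<in> K. f x \<in> U}"
    then obtain F e where F: "finite F" "F \<subseteq> Q" "e > 0" "{y. \<forall>p\<in>F. p (y - f x) < e} \<subseteq> U"
      using determines_neighbourhood[OF det U, of "f x"] by auto
    define W where "W = {y. \<forall>p\<in>F. p (y - x) < e}"
    have "openin \<tau> W" unfolding W_def using determines_basic_open[OF det F(1,2)] .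
    then have "openin (subtopology \<tau> K) (K \<inter> W)" by (simp add: openin_subtopology_Int2)
    moreover have z: "p 0 = 0" if "p \<in> F" for p
      using that F(2) determines_seminorm[OF det] seminorm_zero by blast
    have "x \<in> K \<inter> W"
    proof -
      have "p (x - x) < e" if "p \<in> F" for p using z[OF that] F(3) by simp
      then show ?thesis using x by (auto simp: W_def)
    qed
    moreover have "K \<inter> W \<subseteq> {x \<in> K. f x \<in> U}"
    proof
      fix y assume y: "y \<in> K \<inter> W"
      have "p (f y - f x) < e" if "p \<in> F" for p
        using ne[of p y x] y x that F(2) by (force simp: W_def)
      then show "y \<in> {x \<in> K. f x \<in> U}" using F(4) y by blast
    qed
    ultimately show "\<exists>T. openin (subtopology \<tau> K) T \<and> x \<in> T \<and> T \<subseteq> {x \<in> K. f x \<in> U}" by blast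
  qed
  then have "continuous_map (subtopology \<tau> K) \<tau> f"
    unfolding continuous_map_def top using determines_topspace[OF det] by auto
  then show ?thesis using f top by (auto simp: continuous_map_in_subtopology)
qed

section \<open>Total boundedness and Chebyshev centers\<close>

text \<open>Total boundedness for \<open>p\<close>, with sets of small diameter in place of balls:
  nothing has to be recentered when passing to a subset, and isometric preimages of a small set can
  serve as members.\<close>

definition small_covers :: "('x::real_vector \<Rightarrow> real) \<Rightarrow> 'x set \<Rightarrow> bool"
  where "small_covers p A \<longleftrightarrow>
    (\<forall>e>0. \<exists>\<A>. finite \<A> \<and> A \<subseteq> \<Union>\<A> \<and> (\<forall>B\<in>\<A>. \<forall>x\<in>B. \<forall>y\<in>B. p (x - y) \<le> e))"

lemma small_covers_subset: "small_covers p B \<Longrightarrow> A \<subseteq> B \<Longrightarrow> small_covers p A"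
  unfolding small_covers_def by (meson order_trans)

lemma small_covers_compact:
  assumes det: "determines Q \<tau>" and p: "p \<in> Q" and K: "compactin \<tau> K"
  shows "small_covers p K"
  unfolding small_covers_def
proof (intro allI impI)
  fix e :: real assume e: "e > 0"
  have sn: "seminorm p" using det p by (rule determines_seminorm)
  define B where "B x = {y. p (y - x) < e / 2}" for x
  have "\<forall>U\<in>range B. openin \<tau> U" unfolding B_def using determines_ball_open[OF det p] by blast
  moreover have "x \<in> B x" for x using seminorm_zero[OF sn] e by (simp add: B_def)
  then have "K \<subseteq> \<Union> (range B)" by blast
  ultimately obtain \<A> where \<A>: "finite \<A>" "\<A> \<subseteq> range B" "K \<subseteq> \<Union>\<A>"
    using compactinD[OF K, of "range B"] by auto
  have "p (y - z) \<le> e" if "y \<in> B x" "z \<in> B x" for x y z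
    using that seminorm_triangle[OF sn, of y z x] seminorm_commute[OF sn, of x z] by (simp add: B_def)
  then have "\<forall>B\<in>\<A>. \<forall>x\<in>B. \<forall>y\<in>B. p (x - y) \<le> e" using \<A>(2) by auto
  then show "\<exists>\<A>. finite \<A> \<and> K \<subseteq> \<Union>\<A> \<and> (\<forall>B\<in>\<A>. \<forall>x\<in>B. \<forall>y\<in>B. p (x - y) \<le> e)"
    using \<A>(1,3) by (intro exI[of _ \<A>]) simp
qed

text \<open>The center is the mean of a finite \<open>d/2\<close>-net of \<open>A\<close>: each point of \<open>A\<close> is closer than
  the diameter \<open>d\<close> to one of the points of the net.\<close>

lemma small_covers_center:
  assumes sn: "seminorm p" and cov: "small_covers p A" and "A \<noteq> {}" and "d > 0"
    and diam: "\<And>x y. x \<in> A \<Longrightarrow> y \<in> A \<Longrightarrow> p (x - y) \<le> d"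
  obtains u r where "u \<in> convex hull A" "r < d" "\<And>x. x \<in> A \<Longrightarrow> p (x - u) \<le> r"
proof -
  have "d / 2 > 0" using \<open>d > 0\<close> by simp
  then obtain \<A> where \<A>: "finite \<A>" "A \<subseteq> \<Union>\<A>" "\<And>B x y. B \<in> \<A> \<Longrightarrow> x \<in> B \<Longrightarrow> y \<in> B \<Longrightarrow> p (x - y) \<le> d / 2"
    using cov[unfolded small_covers_def, rule_format, of "d / 2"] by auto
  \<comment> \<open>One point of \<open>A\<close> from each member of the cover that meets
    \<open>A\<close>; the members themselves may stick out of \<open>A\<close>.\<close>
  define X where "X = (\<lambda>B. SOME x. x \<in> B \<inter> A) ` {B \<in> \<A>. B \<inter> A \<noteq> {}}"
  have pick: "(SOME x. x \<in> B \<inter> A) \<in> B \<inter> A" if "B \<inter> A \<noteq> {}" for B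
    using that by (simp only: some_in_eq[symmetric])
  have X: "finite X" "X \<subseteq> A" using \<A>(1) pick by (auto simp: X_def)
  have near: "\<exists>x\<in>X. p (a - x) \<le> d / 2" if a: "a \<in> A" for a
  proof -
    obtain B where B: "B \<in> \<A>" "a \<in> B" using a \<A>(2) by blast
    then have "(SOME x. x \<in> B \<inter> A) \<in> B \<inter> A" using a pick by blast
    moreover have "(SOME x. x \<in> B \<inter> A) \<in> X" using B a by (auto simp: X_def)
    ultimately show ?thesis using \<A>(3) B by blast
  qed
  define N where "N = real (card X)"
  have "X \<noteq> {}" using near \<open>A \<noteq> {}\<close> by blast
  then have N: "N \<ge> 1" using X by (simp add: N_def Suc_leI card_gt_0_iff)
  define u where "u = (\<Sum>x\<in>X. (1 / N) *\<^sub>R x)"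
  have "u \<in> convex hull A"
    unfolding u_def using X N hull_subset[of A convex]
    by (intro convex_sum) (auto simp: N_def)
  \<comment> \<open>Of the \<open>N\<close> distances averaged, one is at most \<open>d / 2\<close>
    and the others are at most \<open>d\<close>.\<close>
  moreover have "p (a - u) \<le> d - d / (2 * N)" if a: "a \<in> A" for a
  proof -
    obtain x0 where x0: "x0 \<in> X" "p (a - x0) \<le> d / 2" using near a by blast
    have "a = (\<Sum>x\<in>X. (1 / N) *\<^sub>R a)"
      using N by (simp add: sum_constant_scaleR N_def)
    then have "a - u = (\<Sum>x\<in>X. (1 / N) *\<^sub>R (a - x))"
      unfolding u_def by (simp add: sum_subtractf scaleR_diff_right)
    then have "p (a - u) \<le> (\<Sum>x\<in>X. p ((1 / N) *\<^sub>R (a - x)))" using seminorm_sum[OF sn] by metis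
    also have "\<dots> = (1 / N) * (\<Sum>x\<in>X. p (a - x))"
      using N by (simp add: seminorm_scale[OF sn] sum_distrib_left)
    also have "(\<Sum>x\<in>X. p (a - x)) = p (a - x0) + (\<Sum>x\<in>X - {x0}. p (a - x))"
      using X x0 by (simp add: sum.remove)
    also have "(\<Sum>x\<in>X - {x0}. p (a - x)) \<le> (\<Sum>x\<in>X - {x0}. d)"
      using diam a X by (intro sum_mono) auto
    also have "\<dots> = (N - 1) * d" using X x0 N by (simp add: N_def of_nat_diff Suc_leI card_gt_0_iff)
    finally have "p (a - u) \<le> (1 / N) * (d / 2 + (N - 1) * d)"
      using x0 N by (smt (verit) divide_nonneg_nonneg mult_left_mono)
    also have "\<dots> = d - d / (2 * N)" using N by (simp add: field_simps)
    finally show ?thesis .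
  qed
  moreover have "d - d / (2 * N) < d" using N \<open>d > 0\<close> by simp
  ultimately show thesis using that by blast
qed

lemma small_covers_bounded:
  assumes sn: "seminorm p" and cov: "small_covers p A"
  obtains M where "\<And>x. x \<in> A \<Longrightarrow> p x \<le> M"
proof -
  obtain \<A> where \<A>: "finite \<A>" "A \<subseteq> \<Union>\<A>" "\<And>B x y. B \<in> \<A> \<Longrightarrow> x \<in> B \<Longrightarrow> y \<in> B \<Longrightarrow> p (x - y) \<le> 1"
    using cov[unfolded small_covers_def, rule_format, of 1] by auto
  have "\<exists>M. \<forall>x\<in>B. p x \<le> M" if B: "B \<in> \<A>" for B
  proof (cases "B = {}")
    case False
    then obtain b where b: "b \<in> B" by blast
    have "p x \<le> 1 + p b" if "x \<in> B" for x
      using seminorm_add[OF sn, of "x - b" b] \<A>(3)[OF B that b] by simp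
    then show ?thesis by blast
  qed auto
  then obtain M where M: "\<And>B x. B \<in> \<A> \<Longrightarrow> x \<in> B \<Longrightarrow> p x \<le> M B" by metis
  have "p x \<le> (\<Sum>B\<in>\<A>. \<bar>M B\<bar>)" if "x \<in> A" for x
  proof -
    obtain B where B: "B \<in> \<A>" "x \<in> B" using \<A>(2) \<open>x \<in> A\<close> by blast
    have "p x \<le> \<bar>M B\<bar>" using M[OF B] by simp
    also have "\<dots> \<le> (\<Sum>B\<in>\<A>. \<bar>M B\<bar>)" using \<A>(1) B(1) by (intro member_le_sum) auto
    finally show ?thesis .
  qed
  then show thesis by (rule that)
qed


text \<open>The center for the actual diameter, which is finite by total boundedness and positive
  because of \<open>a\<close> and \<open>b\<close>. It serves both the normal structure of compact
  sets and the final center argument.\<close>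

lemma small_covers_diameter_center:
  assumes sn: "seminorm p" and cov: "small_covers p A" and ab: "a \<in> A" "b \<in> A" "p (a - b) \<noteq> 0"
  obtains u r where "u \<in> convex hull A" "r < (SUP (x, y)\<in>A \<times> A. p (x - y))"
    "\<And>x. x \<in> A \<Longrightarrow> p (x - u) \<le> r"
proof -
  define d where "d = (SUP (x, y)\<in>A \<times> A. p (x - y))"
  obtain M where M: "\<And>x. x \<in> A \<Longrightarrow> p x \<le> M" using small_covers_bounded[OF sn cov] by blast
  have "p (x - y) \<le> M + M" if "x \<in> A" "y \<in> A" for x y
    using seminorm_add[OF sn, of x "- y"] seminorm_minus[OF sn, of y] M[OF that(1)] M[OF that(2)] by simp
  then have bdd: "bdd_above ((\<lambda>(x, y). p (x - y)) ` (A \<times> A))"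
    by (intro bdd_aboveI[of _ "M + M"]) auto
  have diam: "p (x - y) \<le> d" if "x \<in> A" "y \<in> A" for x y
    unfolding d_def using cSUP_upper[OF _ bdd, of "(x, y)"] that by auto
  have "d > 0" using diam[OF ab(1,2)] ab(3) seminorm_nonneg[OF sn, of "a - b"] by simp
  then show thesis
    using small_covers_center[OF sn cov _ _ diam] ab(1) that unfolding d_def by blast
qed

section \<open>Nonexpansive retractions\<close>

text \<open>Zorn's lemma, with compactness supplying nonempty intersections of chains.
  \<open>P\<close> will stand for being a lower set of maps, for being convex and invariant, and for
  being invariant.\<close>

lemma minimal_closed_set:
  assumes comp: "compact_space T" and K: "closedin T K" "K \<noteq> {}" "P K"
    and inter: "\<And>\<G>. \<G> \<noteq> {} \<Longrightarrow> (\<And>G. G \<in> \<G> \<Longrightarrow> closedin T G \<and> P G) \<Longrightarrow> P (\<Inter>\<G>)"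
  obtains G where "closedin T G" "G \<noteq> {}" "G \<subseteq> K" "P G"
    "\<And>H. closedin T H \<Longrightarrow> H \<noteq> {} \<Longrightarrow> H \<subseteq> G \<Longrightarrow> P H \<Longrightarrow> H = G"
proof -
  define A where "A = {G. closedin T G \<and> G \<noteq> {} \<and> G \<subseteq> K \<and> P G}"
  have "\<exists>m\<in>A. \<forall>a\<in>A. m \<supseteq> a \<longrightarrow> a = m"
  proof (rule predicate_Zorn)
    show "partial_order_on A (relation_of (\<lambda>a b. a \<supseteq> b) A)"
      by (intro partial_order_on_relation_ofI) auto
  next
    fix C assume C: "C \<in> Chains (relation_of (\<lambda>a b. a \<supseteq> b) A)"
    then have CA: "C \<subseteq> A" by (auto simp: Chains_def relation_of_def)
    have tot: "a \<subseteq> b \<or> b \<subseteq> a" if "a \<in> C" "b \<in> C" for a b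
      using C that by (auto simp: Chains_def relation_of_def)
    show "\<exists>u\<in>A. \<forall>a\<in>C. a \<supseteq> u"
    proof (cases "C = {}")
      case True
      then show ?thesis using K by (auto simp: A_def)
    next
      case False
      have fin: "\<Inter>\<F> \<in> C" if "finite \<F>" "\<F> \<noteq> {}" "\<F> \<subseteq> C" for \<F>
        using that
      proof (induction rule: finite_ne_induct)
        case (insert F \<F>)
        then have "F \<in> C" "\<Inter>\<F> \<in> C" by auto
        then have "F \<inter> \<Inter>\<F> = F \<or> F \<inter> \<Inter>\<F> = \<Inter>\<F>" using tot by blast
        then show ?case using \<open>F \<in> C\<close> \<open>\<Inter>\<F> \<in> C\<close> by auto
      qed auto
      have "\<Inter>\<F> \<noteq> {}" if "finite \<F>" "\<F> \<subseteq> C" for \<F>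
      proof (cases "\<F> = {}")
        case False
        then show ?thesis using fin[OF that(1) False that(2)] CA by (auto simp: A_def)
      qed auto
      moreover have "closedin T G" if "G \<in> C" for G using that CA by (auto simp: A_def)
      ultimately have "\<Inter>C \<noteq> {}" using comp[unfolded compact_space_fip, rule_format, of C] by auto
      moreover have "closedin T (\<Inter>C)" using False CA by (intro closedin_Inter) (auto simp: A_def)
      moreover have "P (\<Inter>C)" using False CA by (intro inter) (auto simp: A_def)
      moreover have "\<Inter>C \<subseteq> K" using False CA by (auto simp: A_def)
      ultimately show ?thesis by (intro bexI[of _ "\<Inter>C"]) (auto simp: A_def)
    qed
  qed
  then obtain G where G: "G \<in> A" "\<And>H. H \<in> A \<Longrightarrow> H \<subseteq> G \<Longrightarrow> H = G" by blast
  show thesis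
    by (rule that[of G]) (use G in \<open>auto simp: A_def\<close>)
qed

text \<open>Bruck's argument: in the compact set of nonexpansive maps that fix all fixed points, a map
  \<open>r\<close> that is minimal with respect to the contraction of distances sends every \<open>x\<close> to a fixed
  point, because the orbit set \<open>{f (r x)}\<close> is convex and invariant.\<close>

lemma nonexpansive_retract_of_hereditary_fixed_points:
  fixes \<tau> :: "'x::real_vector topology" and act :: "'s::semitopological_semigroup \<Rightarrow> 'x \<Rightarrow> 'x"
  assumes det: "determines Q \<tau>" and haus: "Hausdorff_space \<tau>"
    and K: "compactin (weak_topology \<tau>) K" "convex K"
    and ne: "nonexpansive_action Q K act" and inv: "\<And>s x. x \<in> K \<Longrightarrow> act s x \<in> K"
    and fp: "\<And>C. C \<subseteq> K \<Longrightarrow> C \<noteq> {} \<Longrightarrow> closedin (weak_on \<tau> K) C \<Longrightarrow> convex C \<Longrightarrow>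
      (\<And>s x. x \<in> C \<Longrightarrow> act s x \<in> C) \<Longrightarrow> \<exists>z\<in>C. \<forall>s. act s z = z"
  shows "nonexpansive_retract Q K (fixed_points K act)"
proof -
  have sn: "seminorm p" if "p \<in> Q" for p using det that by (rule determines_seminorm)
  have eqI: "x = y" if "\<And>p. p \<in> Q \<Longrightarrow> p (x - y) \<le> 0" for x y
    using determines_separating[OF det haus, of "x - y"] that seminorm_nonneg[OF sn] by (simp add: antisym)
  define F where "F = fixed_points K act"
  have F: "z \<in> K" "act s z = z" if "z \<in> F" for z s using that by (auto simp: F_def fixed_points_def)
  define T where "T = weak_on \<tau> K"
  have top: "topspace T = K" by (simp add: T_def weak_topology_topspace)
  have haT: "Hausdorff_space T"
    unfolding T_def using weak_topology_Hausdorff[OF det haus] by (rule Hausdorff_space_subtopology)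
  have coT: "compact_space T" unfolding T_def using K(1) by (rule compact_space_subtopology)
  define PT where "PT = product_topology (\<lambda>_. T) K"
  have topP: "topspace PT = (\<Pi>\<^sub>E x\<in>K. K)" by (simp add: PT_def top)
  have coP: "compact_space PT" by (simp add: PT_def compact_space_product_topology coT)
  have projT: "continuous_map PT T (\<lambda>f. f x)" if "x \<in> K" for x
    unfolding PT_def using that by (rule continuous_map_product_projection)
  have proj: "continuous_map PT (weak_topology \<tau>) (\<lambda>f. f x)" if "x \<in> K" for x
    using projT[OF that] unfolding T_def by (rule continuous_map_into_fulltopology)
  define leq where "leq f g \<longleftrightarrow> (\<forall>p\<in>Q. \<forall>x\<in>K. \<forall>y\<in>K. p (f x - f y) \<le> p (g x - g y))" for f g :: "'x \<Rightarrow> 'x"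
  define R where "R = {f \<in> topspace PT. leq f id \<and> (\<forall>z\<in>F. f z = z)}"
  have closed_leq: "closedin PT {f \<in> topspace PT. leq f g}" for g
  proof -
    let ?S = "(\<lambda>(p, x, y). {f \<in> topspace PT. p (f x - f y) \<le> p (g x - g y)}) ` (Q \<times> K \<times> K)"
    \<comment> \<open>Inserting \<open>topspace PT\<close> keeps the intersected family nonempty
      when \<open>Q\<close> or \<open>K\<close> is empty.\<close>
    have eq: "{f \<in> topspace PT. leq f g} = topspace PT \<inter>
      \<Inter> (insert (topspace PT) ?S)"
      by (auto simp: leq_def)
    have "closedin PT {f \<in> topspace PT. p (f x - f y) \<le> p (g x - g y)}"
      if "p \<in> Q" "x \<in> K" "y \<in> K" for p x y
      using closedin_seminorm_le[OF det that(1) proj[OF that(2)] proj[OF that(3)]] .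
    then have "closedin PT (\<Inter> (insert (topspace PT) ?S))"
      by (intro closedin_Inter) auto
    then show ?thesis unfolding eq by (intro closedin_Int closedin_topspace)
  qed
  have "closedin PT R"
  proof -
    let ?S = "(\<lambda>(p, z). {f \<in> topspace PT. p (f z - z) \<le> 0}) ` (Q \<times> F)"
    have eq: "R = {f \<in> topspace PT. leq f id} \<inter>
      \<Inter> (insert (topspace PT) ?S)"
    proof (intro set_eqI iffI)
      fix f assume "f \<in> R"
      moreover have "p (z - z) \<le> 0" if "p \<in> Q" for p z using seminorm_zero[OF sn[OF that]] by simp
      ultimately show "f \<in> {f \<in> topspace PT. leq f id} \<inter>
        \<Inter> (insert (topspace PT) ?S)"
        by (auto simp: R_def)
    next
      fix f assume f: "f \<in> {f \<in> topspace PT. leq f id} \<inter>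
        \<Inter> (insert (topspace PT) ?S)"
      have "f z = z" if "z \<in> F" for z using f that by (intro eqI) auto
      then show "f \<in> R" using f by (auto simp: R_def)
    qed
    have "closedin PT {f \<in> topspace PT. p (f z - z) \<le> 0}" if "p \<in> Q" "z \<in> F" for p z
      using closedin_seminorm_le[OF det that(1) proj[OF F(1)[OF that(2)]], of "\<lambda>_. z" 0]
      by (simp add: weak_topology_topspace)
    then have "closedin PT (\<Inter> (insert (topspace PT) ?S))"
      by (intro closedin_Inter) auto
    then show ?thesis unfolding eq using closed_leq[of id] by (intro closedin_Int)
  qed
  have RK: "f x \<in> K" if "f \<in> R" "x \<in> K" for f x using that by (auto simp: R_def topP)
  have "restrict id K \<in> R" using F by (auto simp: R_def topP leq_def)
  \<comment> \<open>\<open>leq\<close> is only a preorder on maps, so minimality is sought among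
    closed lower sets. The maps below any member of a minimal \<open>G\<close> form a closed lower
    set and hence all of \<open>G\<close>, so every member of \<open>G\<close> is a minimal
    map.\<close>
  define down where "down G \<longleftrightarrow> G \<subseteq> R \<and> (\<forall>f\<in>G. \<forall>g\<in>R. leq g f \<longrightarrow> g \<in> G)" for G
  obtain G where G: "closedin PT G" "G \<noteq> {}" "G \<subseteq> R" "down G"
    and Gmin: "\<And>H. closedin PT H \<Longrightarrow> H \<noteq> {} \<Longrightarrow> H \<subseteq> G \<Longrightarrow> down H \<Longrightarrow> H = G"
  proof (rule minimal_closed_set[OF coP \<open>closedin PT R\<close>, of down])
    show "R \<noteq> {}" using \<open>restrict id K \<in> R\<close> by blast
    show "down R" by (simp add: down_def)
    show "down (\<Inter>\<G>)" if "\<G> \<noteq> {}" "\<And>G. G \<in> \<G> \<Longrightarrow> closedin PT G \<and> down G" for \<G>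
      unfolding down_def
    proof (intro conjI ballI impI)
      show "\<Inter>\<G> \<subseteq> R" using that by (auto simp: down_def)
      fix f g assume "f \<in> \<Inter>\<G>" "g \<in> R" "leq g f"
      then show "g \<in> \<Inter>\<G>" using that(2) unfolding down_def by (meson Inter_iff)
    qed
  qed blast
  have leq_trans: "leq f h" if "leq f g" "leq g h" for f g h
    using that unfolding leq_def by (meson order_trans)
  obtain r where r: "r \<in> G" using G by blast
  have rR: "r \<in> R" using r G by blast
  have minimal: "leq r g" if g: "g \<in> R" "leq g r" for g
  proof -
    have gG: "g \<in> G" using G(4) r g by (auto simp: down_def)
    define D where "D = R \<inter> {f \<in> topspace PT. leq f g}"
    have "g \<in> D" using g by (auto simp: D_def R_def leq_def)
    moreover have "closedin PT D" unfolding D_def using \<open>closedin PT R\<close> closed_leq by (rule closedin_Int)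
    moreover have "D \<subseteq> G" using G(4) gG by (auto simp: D_def down_def)
    moreover have "down D" unfolding down_def D_def using leq_trans by (auto simp: R_def)
    ultimately have "D = G" using Gmin by blast
    then show ?thesis using r by (auto simp: D_def)
  qed
  have inF: "r x \<in> F" if x: "x \<in> K" for x
  proof -
    define C where "C = (\<lambda>f. f (r x)) ` R"
    have rx: "r x \<in> K" using RK rR x by blast
    have CK: "C \<subseteq> K" using RK rx by (auto simp: C_def)
    have "compactin PT R" using coP \<open>closedin PT R\<close> by (rule closedin_compact_space)
    then have "compactin T C" unfolding C_def using projT[OF rx] by (rule image_compactin)
    then have "closedin T C" using haT compactin_imp_closedin by blast
    moreover have "C \<noteq> {}" using rR by (auto simp: C_def)
    moreover have "convex C"
      unfolding convex_def
    proof (intro ballI allI impI)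
      fix a b and u v :: real assume ab: "a \<in> C" "b \<in> C" and uv: "0 \<le> u" "0 \<le> v" "u + v = 1"
      then obtain f g where fg: "f \<in> R" "a = f (r x)" "g \<in> R" "b = g (r x)" by (auto simp: C_def)
      define h where "h = restrict (\<lambda>y. u *\<^sub>R f y + v *\<^sub>R g y) K"
      have "h \<in> topspace PT"
        using K(2) RK[OF fg(1)] RK[OF fg(3)] uv by (auto simp: topP h_def convex_def)
      moreover have "leq h id"
        unfolding leq_def
      proof (intro ballI)
        fix p y z assume p: "p \<in> Q" and y: "y \<in> K" and z: "z \<in> K"
        have "p (f y - f z) \<le> p (y - z)" "p (g y - g z) \<le> p (y - z)"
          using fg(1,3) p y z by (auto simp: R_def leq_def)
        then show "p (h y - h z) \<le> p (id y - id z)"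
          using seminorm_convex_combination[OF sn[OF p] uv, of "f y" "f z" "p (y - z)" "g y" "g z"] y z
          by (simp add: h_def)
      qed
      moreover have "h z = z" if "z \<in> F" for z
        using fg(1,3) that F(1)[OF that] uv(3) by (simp add: h_def R_def scaleR_add_left[symmetric])
      ultimately have "h \<in> R" by (simp add: R_def)
      then have "h (r x) \<in> C" by (auto simp: C_def)
      then show "u *\<^sub>R a + v *\<^sub>R b \<in> C" using fg rx by (simp add: h_def)
    qed
    moreover have "act s c \<in> C" if c: "c \<in> C" for s c
    proof -
      obtain f where f: "f \<in> R" "c = f (r x)" using c by (auto simp: C_def)
      define h where "h = restrict (\<lambda>y. act s (f y)) K"
      have "p (act s (f y) - act s (f z)) \<le> p (y - z)" if "p \<in> Q" "y \<in> K" "z \<in> K" for p y z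
      proof -
        have "p (act s (f y) - act s (f z)) \<le> p (f y - f z)"
          using ne RK[OF f(1)] that by (auto simp: nonexpansive_action_def)
        also have "\<dots> \<le> p (y - z)" using f(1) that by (auto simp: R_def leq_def)
        finally show ?thesis .
      qed
      then have "h \<in> R"
        using f(1) F inv RK[OF f(1)] by (auto simp: h_def R_def topP leq_def)
      then have "h (r x) \<in> C" by (auto simp: C_def)
      then show ?thesis using f rx by (simp add: h_def)
    qed
    ultimately obtain z where z: "z \<in> C" "\<And>s. act s z = z" using fp[OF CK] unfolding T_def by blast
    then have zF: "z \<in> F" using CK by (auto simp: F_def fixed_points_def)
    obtain f where f: "f \<in> R" "z = f (r x)" using z by (auto simp: C_def)
    \<comment> \<open>\<open>h\<close> is \<open>f \<circ> r\<close>; it lies below \<open>r\<close>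
      and sends both \<open>x\<close> and \<open>z\<close> to \<open>z\<close>. Minimality of
      \<open>r\<close> therefore bounds \<open>p (r x - z) = p (r x - r z)\<close> by
      \<open>p (h x - h z) = 0\<close>.\<close>
    define h where "h = restrict (\<lambda>y. f (r y)) K"
    have fr: "p (f (r y) - f (r y')) \<le> p (r y - r y')" if "p \<in> Q" "y \<in> K" "y' \<in> K" for p y y'
      using f(1) RK[OF rR] that by (auto simp: R_def leq_def)
    have "leq h r" using fr by (auto simp: h_def leq_def)
    moreover have "h \<in> R"
    proof -
      have "leq h id" using \<open>leq h r\<close> rR leq_trans by (auto simp: R_def)
      then show ?thesis
        using RK[OF f(1) RK[OF rR]] f(1) rR F(1) by (auto simp: h_def R_def topP)
    qed
    ultimately have "leq r h" using minimal by blast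
    have "r x = z"
    proof (rule eqI)
      fix p assume p: "p \<in> Q"
      have zK: "z \<in> K" "r z = z" "f z = z" using zF F(1) rR f(1) by (auto simp: R_def)
      then have "p (r x - z) \<le> p (h x - h z)" using \<open>leq r h\<close> p x by (metis leq_def)
      also have "h x - h z = 0" using zK x f(2) by (simp add: h_def)
      finally show "p (r x - z) \<le> 0" using seminorm_zero[OF sn[OF p]] by simp
    qed
    then show ?thesis using zF by simp
  qed
  have "r ` K = F"
  proof
    show "r ` K \<subseteq> F" using inF by blast
    show "F \<subseteq> r ` K" using rR F(1) by (force simp: R_def)
  qed
  moreover have "r (r x) = r x" if "x \<in> K" for x using rR inF[OF that] by (auto simp: R_def)
  moreover have "p (r x - r y) \<le> p (x - y)" if "p \<in> Q" "x \<in> K" "y \<in> K" for p x y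
    using rR that by (auto simp: R_def leq_def)
  ultimately show ?thesis
    unfolding nonexpansive_retract_def F_def[symmetric] using RK[OF rR] by (intro exI[of _ r]) auto
qed

section \<open>Transport of the hypotheses along linear embeddings\<close>

text \<open>One seminorm at a time suffices, since a basic neighbourhood involves only finitely
  many.\<close>

lemma continuous_map_into_determined:
  assumes det: "determines Q \<sigma>"
    and near: "\<And>p a e. p \<in> Q \<Longrightarrow> a \<in> topspace X \<Longrightarrow> e > 0 \<Longrightarrow>
      \<exists>W. openin X W \<and> a \<in> W \<and> (\<forall>x\<in>W. p (h x - h a) < e)"
  shows "continuous_map X \<sigma> h"
  unfolding continuous_map_def
proof (intro conjI allI impI)
  show "h \<in> topspace X \<rightarrow> topspace \<sigma>" using determines_topspace[OF det] by simp
  fix U assume U: "openin \<sigma> U"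
  show "openin X {x \<in> topspace X. h x \<in> U}"
  proof (subst openin_subopen, intro ballI)
    fix a assume a: "a \<in> {x \<in> topspace X. h x \<in> U}"
    then have "h a \<in> U" "a \<in> topspace X" by auto
    obtain F e where F: "finite F" "F \<subseteq> Q" "e > 0" "{y. \<forall>p\<in>F. p (y - h a) < e} \<subseteq> U"
      by (rule determines_neighbourhood[OF det U \<open>h a \<in> U\<close>])
    obtain W where W: "\<And>p. p \<in> F \<Longrightarrow> openin X (W p)" "\<And>p. p \<in> F \<Longrightarrow> a \<in> W p"
      "\<And>p x. p \<in> F \<Longrightarrow> x \<in> W p \<Longrightarrow> p (h x - h a) < e"
    proof -
      have "\<forall>p\<in>F. \<exists>W. openin X W \<and> a \<in> W \<and> (\<forall>x\<in>W. p (h x - h a) < e)"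
        using near \<open>a \<in> topspace X\<close> F(2,3) by auto
      from bchoice[OF this] show thesis using that by blast
    qed
    define V where "V = topspace X \<inter> \<Inter> (W ` F)"
    have "openin X V"
      unfolding V_def using F(1) W(1) by (cases "F = {}") (auto intro!: openin_Inter openin_Int)
    moreover have "a \<in> V" using \<open>a \<in> topspace X\<close> W(2) by (auto simp: V_def)
    moreover have "V \<subseteq> {x \<in> topspace X. h x \<in> U}"
    proof
      fix x assume x: "x \<in> V"
      then have "p (h x - h a) < e" if "p \<in> F" for p using W(3) that by (auto simp: V_def)
      then have "h x \<in> {y. \<forall>p\<in>F. p (y - h a) < e}" by simp
      then have "h x \<in> U" using F(4) by (rule subsetD[rotated])
      then show "x \<in> {x \<in> topspace X. h x \<in> U}" using x by (auto simp: V_def)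
    qed
    ultimately show "\<exists>T. openin X T \<and> a \<in> T \<and> T \<subseteq> {x \<in> topspace X. h x \<in> U}" by blast
  qed
qed

lemma continuous_map_into_determined_distance:
  assumes det: "determines Q \<sigma>"
    and cont: "\<And>p a. p \<in> Q \<Longrightarrow> a \<in> topspace X \<Longrightarrow> continuous_map X euclideanreal (\<lambda>x. p (h x - h a))"
  shows "continuous_map X \<sigma> h"
proof (rule continuous_map_into_determined[OF det])
  fix p a and e :: real assume p: "p \<in> Q" and a: "a \<in> topspace X" and e: "e > 0"
  have "openin X {x \<in> topspace X. p (h x - h a) \<in> {..<e}}"
    using cont[OF p a] by (rule openin_continuous_map_preimage) simp
  moreover have "p (h a - h a) = 0" using seminorm_zero determines_seminorm[OF det p] by simp
  ultimately show "\<exists>W. openin X W \<and> a \<in> W \<and> (\<forall>x\<in>W. p (h x - h a) < e)"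
    using a e by (intro exI[of _ "{x \<in> topspace X. p (h x - h a) \<in> {..<e}}"]) auto
qed

lemma determines_continuous_distance:
  assumes det: "determines Q \<tau>" and p: "p \<in> Q"
  shows "continuous_map \<tau> euclideanreal (\<lambda>x. p (x - a))"
proof (rule continuous_map_dominated_functional)
  have sn: "seminorm p" using det p by (rule determines_seminorm)
  show "topspace \<tau> = UNIV" using det by (rule determines_topspace)
  show "openin \<tau> {y. p (y - x) < e}" for x e using det p by (rule determines_ball_open)
  show "p 0 = 0" using sn by (rule seminorm_zero)
  show "\<bar>p (x - a) - p (y - a)\<bar> \<le> p (x - y)" for x y
    using seminorm_triangle[OF sn, of x a y] seminorm_triangle[OF sn, of y a x] seminorm_commute[OF sn, of x y]
    by simp
qed

text \<open>Purely algebraic: the absolute values of these functionals will make an extended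
  topology Hausdorff on a complement of the given space.\<close>

lemma separating_linear_functional:
  fixes y :: "'y::real_vector"
  assumes "y \<noteq> 0"
  obtains l :: "'y \<Rightarrow> real" where "linear l" "l y \<noteq> 0"
proof -
  have "independent {y}" using assms by simp
  then obtain l :: "'y \<Rightarrow> real" where "linear l" "\<forall>x\<in>{y}. l x = 1"
    using linear_independent_extend[of "{y}" "\<lambda>_. 1 :: real"] by blast
  then show thesis using that by simp
qed

section \<open>Conjugation of an action on an invariant subset\<close>

context
  fixes X :: "'x topology" and Y :: "'y topology" and j :: "'x \<Rightarrow> 'y" and g :: "'y \<Rightarrow> 'x"
    and act :: "'s::semitopological_semigroup \<Rightarrow> 'x \<Rightarrow> 'x"
  assumes g: "continuous_map Y X g" and j: "continuous_map (subtopology X (g ` topspace Y)) Y j"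
    and jg: "\<And>y. y \<in> topspace Y \<Longrightarrow> j (g y) = y"
    and inv: "\<And>s y. y \<in> topspace Y \<Longrightarrow> act s (g y) \<in> g ` topspace Y"
begin

lemma transport_topspace: "y \<in> topspace Y \<Longrightarrow> g y \<in> topspace X"
  using g by (auto simp: continuous_map_def)

lemma transport_act: "y \<in> topspace Y \<Longrightarrow> g (j (act s (g y))) = act s (g y)"
  using inv jg by (metis imageE)

lemma transport_continuous:
  assumes "continuous_map Z X h" "\<And>z. z \<in> topspace Z \<Longrightarrow> h z \<in> g ` topspace Y"
  shows "continuous_map Z Y (\<lambda>z. j (h z))"
proof -
  have "continuous_map Z (subtopology X (g ` topspace Y)) h"
    using assms by (intro continuous_map_into_subtopology) auto
  from continuous_map_compose[OF this j] show ?thesis by (simp add: o_def)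
qed

lemma dynamical_system_transport:
  assumes dyn: "dynamical_system X act"
  shows "dynamical_system Y (\<lambda>s y. j (act s (g y)))"
  unfolding dynamical_system_def
proof (intro conjI allI ballI)
  fix s t y assume y: "y \<in> topspace Y"
  have "act s (act t (g y)) = act (s * t) (g y)"
    using dyn transport_topspace[OF y] by (auto simp: dynamical_system_def)
  then show "j (act s (g (j (act t (g y))))) = j (act (s * t) (g y))"
    using transport_act[OF y] by simp
next
  fix y assume y: "y \<in> topspace Y"
  show "continuous_map euclidean Y (\<lambda>s. j (act s (g y)))"
    using dyn transport_topspace[OF y] inv[OF y] by (intro transport_continuous) (auto simp: dynamical_system_def)
next
  fix s
  have "continuous_map X X (act s)" using dyn by (simp add: dynamical_system_def)
  from continuous_map_compose[OF g this] show "continuous_map Y Y (\<lambda>y. j (act s (g y)))"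
    using inv by (intro transport_continuous) (auto simp: o_def)
qed

lemma jointly_continuous_transport:
  assumes "jointly_continuous X act"
  shows "jointly_continuous Y (\<lambda>s y. j (act s (g y)))"
proof -
  have "continuous_map (prod_topology euclidean Y) (prod_topology euclidean X) (\<lambda>(s, y). (s, g y))"
    using g continuous_map_id[of euclidean] by (simp add: continuous_map_prod_top id_def)
  moreover have "continuous_map (prod_topology euclidean X) X (\<lambda>(s, x). act s x)"
    using assms by (simp add: jointly_continuous_def)
  ultimately have "continuous_map (prod_topology euclidean Y) X ((\<lambda>(s, x). act s x) \<circ> (\<lambda>(s, y). (s, g y)))"
    by (rule continuous_map_compose)
  moreover have "(\<lambda>(s, x). act s x) \<circ> (\<lambda>(s, y). (s, g y)) = (\<lambda>(s, y). act s (g y))"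
    by (auto simp: fun_eq_iff)
  ultimately have "continuous_map (prod_topology euclidean Y) X (\<lambda>(s, y). act s (g y))" by simp
  then have "continuous_map (prod_topology euclidean Y) Y (\<lambda>z. j ((\<lambda>(s, y). act s (g y)) z))"
    by (rule transport_continuous) (use inv in auto)
  then show ?thesis by (simp add: jointly_continuous_def case_prod_beta')
qed

text \<open>The map \<open>f \<mapsto> f \<circ> g\<close> sends the enveloping semigroup of \<open>X\<close> to a compact set, which thus
  contains all limits of translations of \<open>Y\<close>.\<close>

lemma enveloping_semigroup_transport:
  assumes dyn: "dynamical_system X act" and coX: "compact_space X" and haX: "Hausdorff_space X"
    and cont: "\<And>f. f \<in> enveloping_semigroup X act \<Longrightarrow> continuous_map X X f"
    and f: "f \<in> enveloping_semigroup Y (\<lambda>s y. j (act s (g y)))"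
  shows "continuous_map Y Y f"
proof -
  define PX where "PX = product_topology (\<lambda>_. X) (topspace X)"
  define PM where "PM = product_topology (\<lambda>_. X) (topspace Y)"
  define PY where "PY = product_topology (\<lambda>_. Y) (topspace Y)"
  define A where "A = range (\<lambda>s. restrict (act s) (topspace X))"
  define B where "B = range (\<lambda>s. restrict (\<lambda>y. j (act s (g y))) (topspace Y))"
  \<comment> \<open>Self-maps of \<open>X\<close> and of \<open>Y\<close> are compared as maps from
    \<open>Y\<close> to \<open>X\<close>: \<open>\<Phi>\<close> precomposes with \<open>g\<close>,
    \<open>\<Psi>\<close> postcomposes with \<open>g\<close>, and on corresponding translations the
    results agree.\<close>
  define \<Phi> where "\<Phi> f = restrict (\<lambda>y. f (g y)) (topspace Y)" for f :: "'x \<Rightarrow> 'x"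
  define \<Psi> where "\<Psi> f = restrict (\<lambda>y. g (f y)) (topspace Y)" for f :: "'y \<Rightarrow> 'y"
  have \<Phi>: "continuous_map PX PM \<Phi>"
    unfolding PM_def continuous_map_componentwise
  proof (intro conjI ballI)
    show "\<Phi> ` topspace PX \<subseteq> extensional (topspace Y)" by (auto simp: \<Phi>_def)
    fix y assume y: "y \<in> topspace Y"
    have "continuous_map PX X (\<lambda>f. f (g y))"
      unfolding PX_def using transport_topspace[OF y] by (rule continuous_map_product_projection)
    then show "continuous_map PX X (\<lambda>f. \<Phi> f y)" using y by (simp add: \<Phi>_def)
  qed
  have \<Psi>: "continuous_map PY PM \<Psi>"
    unfolding PM_def continuous_map_componentwise
  proof (intro conjI ballI)
    show "\<Psi> ` topspace PY \<subseteq> extensional (topspace Y)" by (auto simp: \<Psi>_def)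
    fix y assume y: "y \<in> topspace Y"
    have "continuous_map PY Y (\<lambda>f. f y)"
      unfolding PY_def using y by (rule continuous_map_product_projection)
    from continuous_map_compose[OF this g] show "continuous_map PY X (\<lambda>f. \<Psi> f y)"
      using y by (simp add: \<Psi>_def o_def)
  qed
  have haM: "Hausdorff_space PM" by (simp add: PM_def Hausdorff_space_product_topology haX)
  have coP: "compact_space PX" by (simp add: PX_def compact_space_product_topology coX)
  have AP: "A \<subseteq> topspace PX"
    using dyn by (auto simp: A_def PX_def dynamical_system_def continuous_map_def Pi_iff)
  have eq: "\<Psi> ` B = \<Phi> ` A"
  proof -
    have "\<Psi> (restrict (\<lambda>y. j (act s (g y))) (topspace Y)) = \<Phi> (restrict (act s) (topspace X))" for s
      by (auto simp: \<Psi>_def \<Phi>_def fun_eq_iff transport_act transport_topspace)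
    then show ?thesis by (simp add: A_def B_def image_image)
  qed
  have "compactin PX (PX closure_of A)"
    using coP closedin_closure_of by (rule closedin_compact_space)
  then have "compactin PM (\<Phi> ` (PX closure_of A))" using \<Phi> by (rule image_compactin)
  then have "closedin PM (\<Phi> ` (PX closure_of A))" using haM compactin_imp_closedin by blast
  moreover have "\<Phi> ` A \<subseteq> \<Phi> ` (PX closure_of A)" using closure_of_subset[OF AP] by blast
  ultimately have "PM closure_of (\<Psi> ` B) \<subseteq> \<Phi> ` (PX closure_of A)"
    unfolding eq by (intro closure_of_minimal)
  moreover have fB: "f \<in> PY closure_of B"
    using f by (simp add: enveloping_semigroup_def PY_def B_def)
  ultimately have "\<Psi> f \<in> \<Phi> ` (PX closure_of A)"
    using continuous_map_image_closure_subset[OF \<Psi>, of B] by blast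
  then obtain h where h: "h \<in> PX closure_of A" "\<Psi> f = \<Phi> h" by blast
  have "h \<in> enveloping_semigroup X act" using h(1) by (simp add: enveloping_semigroup_def PX_def A_def)
  then have hc: "continuous_map X X h" by (rule cont)
  have fY: "f y \<in> topspace Y" if "y \<in> topspace Y" for y
    using fB closure_of_subset_topspace[of PY B] that by (auto simp: PY_def)
  have gf: "g (f y) = h (g y)" if "y \<in> topspace Y" for y
    using fun_cong[OF h(2), of y] that by (simp add: \<Psi>_def \<Phi>_def)
  have "continuous_map Y Y (\<lambda>y. j (h (g y)))"
    using continuous_map_compose[OF g hc] gf[symmetric] fY by (intro transport_continuous) (auto simp: o_def)
  then show ?thesis
    by (rule continuous_map_eq) (metis gf jg fY)
qed

end

text \<open>\<open>y \<mapsto> y - j (g y)\<close> projects along the range of \<open>j\<close> onto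
  the kernel of \<open>g\<close>. The absolute values of functionals composed with it make the
  topology Hausdorff on all of \<open>'y\<close>, yet vanish on differences of points in the copy of
  \<open>C\<close>, where only the seminorms pulled back by \<open>g\<close> matter.
  \<open>(E')\<close> is excluded because the centers provided for \<open>K\<close> may lie outside
  the closed convex hull of \<open>C\<close>.\<close>

lemma hypotheses_transport:
  fixes \<tau> :: "'x::real_vector topology" and act :: "'s::semitopological_semigroup \<Rightarrow> 'x \<Rightarrow> 'x"
    and j :: "'x \<Rightarrow> 'y::real_vector"
  assumes H: "hypotheses_of P \<tau> Q K act" and P: "P \<noteq> FP_E'"
    and C: "C \<subseteq> K" "C \<noteq> {}" "convex C" "closedin (weak_on \<tau> K) C"
    and inv: "\<And>s x. x \<in> C \<Longrightarrow> act s x \<in> C"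
    and j: "linear j" and g: "linear g" and gj: "\<And>x. g (j x) = x"
  obtains \<sigma> Q' where "hypotheses_of P \<sigma> Q' (j ` C) (\<lambda>s y. j (act s (g y)))"
proof -
  have lc: "locally_convex_topology \<tau>" and det: "determines Q \<tau>"
    and ne: "nonexpansive_action Q K act"
    using H by (auto simp: hypotheses_of_def)
  have haus: "Hausdorff_space \<tau>" using lc by (simp add: locally_convex_topology_def)
  define Q' where "Q' = (\<lambda>q y. q (g y)) ` Q \<union> {\<lambda>y. \<bar>l (y - j (g y))\<bar> | l. linear (l :: 'y \<Rightarrow> real)}"
  define \<sigma> where "\<sigma> = seminorm_topology Q'"
  have lin: "linear (\<lambda>y. l (y - j (g y)))" if "linear l" for l :: "'y \<Rightarrow> real"
    using linear_compose[OF linear_compose_sub[OF linear_id linear_compose[OF g j]] that] by (simp add: o_def)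
  have "seminorm p" if "p \<in> Q'" for p
    using that lin seminorm_comp_linear[OF determines_seminorm[OF det] g] seminorm_abs_linear
    by (auto simp: Q'_def)
  then have det': "determines Q' \<sigma>" unfolding \<sigma>_def by (rule determines_seminorm_topology)
  have sep: "y = 0" if y: "\<And>p. p \<in> Q' \<Longrightarrow> p y = 0" for y
  proof (rule ccontr)
    assume "y \<noteq> 0"
    have "p (g y) = 0" if "p \<in> Q" for p
      using y[of "\<lambda>y. p (g y)"] that by (auto simp: Q'_def)
    then have "g y = 0" by (rule determines_separating[OF det haus])
    obtain l :: "'y \<Rightarrow> real" where l: "linear l" "l y \<noteq> 0"
      using separating_linear_functional[OF \<open>y \<noteq> 0\<close>] .
    then have "\<bar>l (y - j (g y))\<bar> = 0" using y[of "\<lambda>y. \<bar>l (y - j (g y))\<bar>"] by (auto simp: Q'_def)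
    then show False using l \<open>g y = 0\<close> linear_0[OF j] by simp
  qed
  have lc': "locally_convex_topology \<sigma>" using det' sep by (rule locally_convex_of_determines)
  have cj: "continuous_map \<tau> \<sigma> j"
  proof (rule continuous_map_into_determined_distance[OF det'])
    fix p a assume "p \<in> Q'"
    then consider q where "q \<in> Q" "p = (\<lambda>y. q (g y))"
      | l where "p = (\<lambda>y. \<bar>l (y - j (g y))\<bar>)" "linear (l :: 'y \<Rightarrow> real)"
      by (auto simp: Q'_def)
    then show "continuous_map \<tau> euclideanreal (\<lambda>x. p (j x - j a))"
    proof cases
      case 1
      then have "p (j x - j a) = q (x - a)" for x by (simp add: linear_diff[OF g] gj)
      then show ?thesis using determines_continuous_distance[OF det 1(1), of a] by simp
    next
      case 2
      then have "p (j x - j a) = 0" for x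
        by (simp add: linear_diff[OF g] gj linear_diff[OF j] linear_0)
      then show ?thesis by simp
    qed
  qed
  have cg: "continuous_map \<sigma> \<tau> g"
  proof (rule continuous_map_into_determined_distance[OF det])
    fix p a assume "p \<in> Q"
    then have "(\<lambda>y. p (g y)) \<in> Q'" by (auto simp: Q'_def)
    from determines_continuous_distance[OF det' this, of a]
    show "continuous_map \<sigma> euclideanreal (\<lambda>y. p (g y - g a))" by (simp add: linear_diff[OF g])
  qed
  have wj: "continuous_map (weak_topology \<tau>) (weak_topology \<sigma>) j"
    using j cj by (rule linear_continuous_imp_weakly_continuous)
  have wg: "continuous_map (weak_topology \<sigma>) (weak_topology \<tau>) g"
    using g cg by (rule linear_continuous_imp_weakly_continuous)
  have gjC: "g ` j ` C = C" by (simp add: image_image gj)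
  define act' where "act' = (\<lambda>s y. j (act s (g y)))"
  have "nonexpansive_action Q' (j ` C) act'"
    unfolding nonexpansive_action_def
  proof (intro ballI allI)
    fix p s x y assume "p \<in> Q'" "x \<in> j ` C" "y \<in> j ` C"
    then obtain a b where ab: "x = j a" "y = j b" "a \<in> C" "b \<in> C" by blast
    from \<open>p \<in> Q'\<close> consider q where "q \<in> Q" "p = (\<lambda>y. q (g y))"
      | l where "p = (\<lambda>y. \<bar>l (y - j (g y))\<bar>)" "linear (l :: 'y \<Rightarrow> real)"
      by (auto simp: Q'_def)
    then show "p (act' s x - act' s y) \<le> p (x - y)"
    proof cases
      case 1
      then show ?thesis
        using ne[unfolded nonexpansive_action_def, rule_format, of q a b s] ab C(1)
        by (auto simp: act'_def linear_diff[OF g] gj)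
    next
      case 2
      then show ?thesis
        by (simp add: linear_diff[OF g] gj linear_diff[OF j] linear_0 act'_def ab)
    qed
  qed
  moreover have "convex (j ` C)" using j C(3) by (rule convex_linear_image)
  ultimately have basic: "locally_convex_topology \<sigma> \<and> determines Q' \<sigma> \<and> j ` C \<noteq> {} \<and> convex (j ` C) \<and>
      nonexpansive_action Q' (j ` C) act'"
    using lc' det' C(2) by simp
  \<comment> \<open>Stated for arbitrary \<open>S\<close> and \<open>T\<close>, to be used for the
    determined topologies and again for their weak topologies.\<close>
  have trans: "continuous_map (subtopology S (j ` C)) (subtopology T K) g"
      "continuous_map (subtopology (subtopology T K) (g ` topspace (subtopology S (j ` C)))) (subtopology S (j ` C)) j"
      "\<And>y. y \<in> topspace (subtopology S (j ` C)) \<Longrightarrow> j (g y) = y"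
      "\<And>s y. y \<in> topspace (subtopology S (j ` C)) \<Longrightarrow> act s (g y) \<in> g ` topspace (subtopology S (j ` C))"
    if "continuous_map T S j" "continuous_map S T g" "topspace S = UNIV" for T S
  proof -
    have top: "topspace (subtopology S (j ` C)) = j ` C" using that(3) by simp
    show "continuous_map (subtopology S (j ` C)) (subtopology T K) g"
      using that C(1) by (auto simp: continuous_map_in_subtopology continuous_map_from_subtopology gj)
    show "continuous_map (subtopology (subtopology T K) (g ` topspace (subtopology S (j ` C)))) (subtopology S (j ` C)) j"
      unfolding top gjC using that by (auto simp: continuous_map_in_subtopology continuous_map_from_subtopology)
    show "j (g y) = y" if "y \<in> topspace (subtopology S (j ` C))" for y
      using that unfolding top by (auto simp: gj)
    show "act s (g y) \<in> g ` topspace (subtopology S (j ` C))" if "y \<in> topspace (subtopology S (j ` C))" for s y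
      using that unfolding top gjC by (auto simp: gj inv)
  qed
  note st = trans[OF cj cg determines_topspace[OF det']]
  note wt = trans[OF wj wg weak_topology_topspace]
  have clos: "closedin (subtopology T K) C \<Longrightarrow> compactin T K \<Longrightarrow> continuous_map T S j \<Longrightarrow> compactin S (j ` C)"
    for T S
  proof -
    assume *: "closedin (subtopology T K) C" "compactin T K" "continuous_map T S j"
    have "compactin (subtopology T K) C"
      using closedin_compact_space[OF compact_space_subtopology[OF *(2)] *(1)] .
    then have "compactin T C" by (simp add: compactin_subtopology)
    then show "compactin S (j ` C)" using *(3) by (rule image_compactin)
  qed
  have wcomp: "compactin (weak_topology \<sigma>) (j ` C)" if "compactin (weak_topology \<tau>) K"
    using clos[OF C(4) that wj] .
  have env: "continuous_map (weak_on \<sigma> (j ` C)) (weak_on \<sigma> (j ` C)) f"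
    if "compactin (weak_topology \<tau>) K" "dynamical_system (weak_on \<tau> K) act"
      "\<forall>f\<in>enveloping_semigroup (weak_on \<tau> K) act. continuous_map (weak_on \<tau> K) (weak_on \<tau> K) f"
      "f \<in> enveloping_semigroup (weak_on \<sigma> (j ` C)) act'" for f :: "'y \<Rightarrow> 'y"
  proof (rule enveloping_semigroup_transport[OF wt that(2)])
    show "f \<in> enveloping_semigroup (weak_on \<sigma> (j ` C)) (\<lambda>s y. j (act s (g y)))"
      using that(4) unfolding act'_def .
    show "compact_space (weak_on \<tau> K)" using that(1) by (rule compact_space_subtopology)
    show "Hausdorff_space (weak_on \<tau> K)"
      using weak_topology_Hausdorff[OF det haus] by (rule Hausdorff_space_subtopology)
    show "continuous_map (weak_on \<tau> K) (weak_on \<tau> K) h"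
      if "h \<in> enveloping_semigroup (weak_on \<tau> K) act" for h
      using \<open>\<forall>f\<in>_. _\<close> that by blast
  qed
  have "hypotheses_of P \<sigma> Q' (j ` C) act'"
  proof (cases P)
    case FP_D
    then have K: "compactin \<tau> K" "dynamical_system (subtopology \<tau> K) act"
      using H by (auto simp: hypotheses_of_def)
    have "closedin (subtopology \<tau> K) C"
      using C(4) weak_topology_eq_on_compact[OF det haus K(1)] by simp
    then have "compactin \<sigma> (j ` C)" using clos K(1) cj by blast
    moreover have "dynamical_system (subtopology \<sigma> (j ` C)) act'"
      using dynamical_system_transport[OF st K(2)] by (simp add: act'_def)
    ultimately show ?thesis using basic FP_D by (simp add: hypotheses_of_def)
  next
    case FP_E
    then have K: "compactin (weak_topology \<tau>) K" "dynamical_system (weak_on \<tau> K) act"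
      "equicontinuous_family (weak_topology \<tau>) K (range act)"
      using H by (auto simp: hypotheses_of_def)
    have "equicontinuous_family (weak_topology \<sigma>) (j ` C) (range act')"
      unfolding equicontinuous_family_def
    proof (intro ballI allI impI)
      fix y V assume y: "y \<in> j ` C" and V: "openin (weak_topology \<sigma>) V \<and> 0 \<in> V"
      define V' where "V' = {x. j x \<in> V}"
      have "openin (weak_topology \<tau>) V'" "0 \<in> V'"
        using openin_continuous_map_preimage[OF wj, of V] V linear_0[OF j]
        by (auto simp: V'_def weak_topology_topspace)
      moreover have "g y \<in> K" using y C(1) by (auto simp: gj)
      ultimately obtain W where W: "openin (weak_topology \<tau>) W" "g y \<in> W"
        "\<forall>z\<in>K \<inter> W. \<forall>f\<in>range act. f z - f (g y) \<in> V'"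
        using K(3) unfolding equicontinuous_family_def by meson
      have "openin (weak_topology \<sigma>) {z. g z \<in> W}"
        using openin_continuous_map_preimage[OF wg W(1)] by (simp add: weak_topology_topspace)
      moreover have "f z - f y \<in> V" if z: "z \<in> j ` C \<inter> {z. g z \<in> W}" and f: "f \<in> range act'" for z f
      proof -
        obtain s where f: "f = act' s" using f by blast
        have "g z \<in> K \<inter> W" using z C(1) by (auto simp: gj)
        then have "act s (g z) - act s (g y) \<in> V'" using W(3) by blast
        then show ?thesis by (simp add: f act'_def V'_def linear_diff[OF j])
      qed
      ultimately show "\<exists>W. openin (weak_topology \<sigma>) W \<and> y \<in> W \<and> (\<forall>z\<in>j ` C \<inter> W. \<forall>f\<in>range act'. f z - f y \<in> V)"
        using W(2) by (intro exI[of _ "{z. g z \<in> W}"]) simp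
    qed
    then show ?thesis
      using basic FP_E wcomp[OF K(1)] dynamical_system_transport[OF wt K(2)]
      by (simp add: hypotheses_of_def act'_def)
  next
    case FP_F
    then have K: "compactin (weak_topology \<tau>) K" "dynamical_system (weak_on \<tau> K) act"
      "\<forall>f\<in>enveloping_semigroup (weak_on \<tau> K) act. continuous_map (weak_on \<tau> K) (weak_on \<tau> K) f"
      using H by (auto simp: hypotheses_of_def)
    show ?thesis
      using basic FP_F wcomp[OF K(1)] dynamical_system_transport[OF wt K(2)] env[OF K]
      by (simp add: hypotheses_of_def act'_def)
  next
    case FP_F_star
    then have K: "compactin (weak_topology \<tau>) K" "dynamical_system (weak_on \<tau> K) act"
      "\<forall>f\<in>enveloping_semigroup (weak_on \<tau> K) act. continuous_map (weak_on \<tau> K) (weak_on \<tau> K) f"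
      "jointly_continuous (weak_on \<tau> K) act"
      using H by (auto simp: hypotheses_of_def)
    show ?thesis
      using basic FP_F_star wcomp[OF K(1)] dynamical_system_transport[OF wt K(2)] env[OF K(1-3)]
        jointly_continuous_transport[OF wt K(4)]
      by (simp add: hypotheses_of_def act'_def)
  next
    case FP_G
    then have K: "compactin (weak_topology \<tau>) K" "dynamical_system (weak_on \<tau> K) act"
      using H by (auto simp: hypotheses_of_def)
    show ?thesis
      using basic FP_G wcomp[OF K(1)] dynamical_system_transport[OF wt K(2)]
      by (simp add: hypotheses_of_def act'_def)
  next
    case FP_G_star
    then have K: "compactin (weak_topology \<tau>) K" "dynamical_system (weak_on \<tau> K) act"
      "jointly_continuous (weak_on \<tau> K) act"
      using H by (auto simp: hypotheses_of_def)
    show ?thesis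
      using basic FP_G_star wcomp[OF K(1)] dynamical_system_transport[OF wt K(2)]
        jointly_continuous_transport[OF wt K(3)]
      by (simp add: hypotheses_of_def act'_def)
  qed (use P in simp)
  then show thesis unfolding act'_def by (rule that)
qed

text \<open>Any linear left inverse of \<open>j\<close> will do, since the topology on the target is
  chosen so as to make it continuous.\<close>

lemma fixed_point_of_property:
  fixes \<tau> :: "'x::real_vector topology" and act :: "'s::semitopological_semigroup \<Rightarrow> 'x \<Rightarrow> 'x"
    and j :: "'x \<Rightarrow> 'y::real_vector"
  assumes fpp: "has_fixed_point_property P TYPE('s) TYPE('y)"
    and H: "hypotheses_of P \<tau> Q K act" and P: "P \<noteq> FP_E'"
    and C: "C \<subseteq> K" "C \<noteq> {}" "convex C" "closedin (weak_on \<tau> K) C"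
    and inv: "\<And>s x. x \<in> C \<Longrightarrow> act s x \<in> C"
    and j: "linear j" "inj j"
  shows "\<exists>z\<in>C. \<forall>s. act s z = z"
proof -
  obtain g where g: "linear g" "g \<circ> j = id" using linear_injective_left_inverse[OF j] by blast
  then have gj: "g (j x) = x" for x by (metis comp_apply id_apply)
  obtain \<sigma> Q' where "hypotheses_of P \<sigma> Q' (j ` C) (\<lambda>s y. j (act s (g y)))"
    using hypotheses_transport[OF H P C inv j(1) g(1) gj] by blast
  then have "fixed_points (j ` C) (\<lambda>s y. j (act s (g y))) \<noteq> {}"
    using fpp by (simp add: has_fixed_point_property_def)
  then obtain z where z: "z \<in> C" "\<And>s. j (act s z) = j z" by (auto simp: fixed_points_def gj)
  then have "act s z = z" for s using gj by metis
  then show ?thesis using z(1) by blast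
qed

text \<open>On \<open>K\<close> the weak topology is the given one, so nonexpansiveness itself
  yields weak equicontinuity. Normal structure holds because \<open>K\<close> is totally bounded for
  each \<open>p\<close>, with a center in the convex hull of \<open>A\<close>.\<close>

lemma compact_hypotheses_imp_E':
  assumes H: "hypotheses_of FP_D \<tau> Q K act"
  shows "hypotheses_of FP_E' \<tau> Q K act"
proof -
  have lc: "locally_convex_topology \<tau>" and det: "determines Q \<tau>"
    and ne: "nonexpansive_action Q K act" and K: "compactin \<tau> K" "dynamical_system (subtopology \<tau> K) act"
    and KC: "convex K"
    using H by (auto simp: hypotheses_of_def)
  have haus: "Hausdorff_space \<tau>" using lc by (simp add: locally_convex_topology_def)
  have eq: "weak_on \<tau> K = subtopology \<tau> K" using det haus K(1) by (rule weak_topology_eq_on_compact)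
  have top: "topspace \<tau> = UNIV" using det by (rule determines_topspace)
  have "normal_structure \<tau> Q K"
    unfolding normal_structure_def
  proof (intro allI impI, elim conjE)
    fix A assume A: "A \<subseteq> K" "Q_bounded Q A" "\<exists>a\<in>A. \<exists>b\<in>A. a \<noteq> b"
    then obtain a b where ab: "a \<in> A" "b \<in> A" "a \<noteq> b" by blast
    then obtain p where p: "p \<in> Q" "p (a - b) \<noteq> 0"
      using determines_separating[OF det haus, of "a - b"] by auto
    have sn: "seminorm p" using det p(1) by (rule determines_seminorm)
    have "A \<noteq> {}" using ab by blast
    have "small_covers p A"
      using small_covers_compact[OF det p(1) K(1)] A(1) by (rule small_covers_subset)
    then obtain u r where u: "u \<in> convex hull A" "r < (SUP (x, y)\<in>A \<times> A. p (x - y))"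
      "\<And>x. x \<in> A \<Longrightarrow> p (x - u) \<le> r"
      using small_covers_diameter_center[OF sn _ ab(1,2) p(2)] by blast
    have "(SUP x\<in>A. p (x - u)) \<le> r" using u(3) \<open>A \<noteq> {}\<close> by (intro cSUP_least) auto
    moreover have "u \<in> \<tau> closure_of (convex hull K)"
      using hull_mono[OF A(1)] u(1) closure_of_subset[of "convex hull K" \<tau>] top by blast
    ultimately show "\<exists>u\<in>\<tau> closure_of (convex hull K). \<exists>p\<in>Q.
        (SUP x\<in>A. p (x - u)) < (SUP (x, y)\<in>A \<times> A. p (x - y))"
      using p(1) u(2) by (intro bexI[of _ u] bexI[of _ p]) auto
  qed
  moreover have "equicontinuous_family (weak_topology \<tau>) K (range act)"
    unfolding equicontinuous_family_def
  proof (intro ballI allI impI, elim conjE)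
    fix x V assume x: "x \<in> K" and V: "openin (weak_topology \<tau>) V" "0 \<in> V"
    have "openin \<tau> V" using weak_openin_imp_openin[OF top V(1)] .
    then obtain F e where F: "finite F" "F \<subseteq> Q" "e > 0" "{y. \<forall>p\<in>F. p (y - 0) < e} \<subseteq> V"
      using V(2) by (rule determines_neighbourhood[OF det])
    define N where "N = {y. \<forall>p\<in>F. p (y - x) < e}"
    have "openin \<tau> N" unfolding N_def using det F(1,2) by (rule determines_basic_open)
    then have "openin (weak_on \<tau> K) (K \<inter> N)" unfolding eq by (simp add: openin_subtopology_Int2)
    then obtain W where W: "openin (weak_topology \<tau>) W" "K \<inter> N = W \<inter> K"
      by (auto simp: openin_subtopology)
    have "p (x - x) < e" if "p \<in> F" for p
      using seminorm_zero[OF determines_seminorm[OF det, of p]] that F(2,3) by auto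
    then have "x \<in> N" by (simp add: N_def)
    then have "x \<in> W" using x W(2) by blast
    moreover have "act s y - act s x \<in> V" if y: "y \<in> K \<inter> W" for s y
    proof -
      have "y \<in> N" using y W(2) by blast
      have "p (act s y - act s x - 0) < e" if "p \<in> F" for p
      proof -
        have "p (act s y - act s x) \<le> p (y - x)"
          using ne F(2) that x y by (auto simp: nonexpansive_action_def)
        also have "\<dots> < e" using \<open>y \<in> N\<close> that by (simp add: N_def)
        finally show ?thesis by simp
      qed
      then have "act s y - act s x \<in> {y. \<forall>p\<in>F. p (y - 0) < e}" by simp
      then show ?thesis using F(4) by (rule subsetD[rotated])
    qed
    ultimately show "\<exists>W. openin (weak_topology \<tau>) W \<and> x \<in> W \<and> (\<forall>y\<in>K \<inter> W. \<forall>f\<in>range act. f y - f x \<in> V)"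
      using W(1) by (intro exI[of _ W]) auto
  qed
  ultimately show ?thesis
    using H compactin_weak_topology[OF K(1)] eq by (simp add: hypotheses_of_def)
qed

section \<open>Fragmentability of weakly compact sets\<close>

text \<open>The distance from \<open>span D\<close>; a functional dominated by it is dominated by
  \<open>p\<close> and vanishes on \<open>D\<close>.\<close>

lemma seminorm_quotient:
  assumes sn: "seminorm p"
  shows "seminorm (\<lambda>v. INF w\<in>span D. p (v - w))"
proof -
  define q where "q v = (INF w\<in>span D. p (v - w))" for v
  have bdd: "bdd_below ((\<lambda>w. p (v - w)) ` span D)" for v
    using seminorm_nonneg[OF sn] by (intro bdd_belowI[of _ 0]) auto
  have ne: "span D \<noteq> {}" using span_zero by blast
  have qle: "q v \<le> p (v - w)" if "w \<in> span D" for v w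
    unfolding q_def using bdd that by (rule cINF_lower)
  have qge: "c \<le> q v" if "\<And>w. w \<in> span D \<Longrightarrow> c \<le> p (v - w)" for c v
    unfolding q_def using ne that by (rule cINF_greatest)
  have "q (x + y) \<le> q x + q y" for x y
  proof -
    have "q (x + y) - q x \<le> q y"
    proof (rule qge)
      fix w assume w: "w \<in> span D"
      have "q (x + y) - p (y - w) \<le> q x"
      proof (rule qge)
        fix w' assume w': "w' \<in> span D"
        have "q (x + y) \<le> p (x + y - (w' + w))" using span_add[OF w' w] by (rule qle)
        also have "x + y - (w' + w) = (x - w') + (y - w)" by simp
        also have "p \<dots> \<le> p (x - w') + p (y - w)" using sn by (rule seminorm_add)
        finally show "q (x + y) - p (y - w) \<le> p (x - w')" by simp
      qed
      then show "q (x + y) - q x \<le> p (y - w)" by simp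
    qed
    then show ?thesis by simp
  qed
  moreover have "q (c *\<^sub>R x) \<le> \<bar>c\<bar> * q x" for c x
  proof (cases "c = 0")
    case True
    then show ?thesis using qle[OF span_zero, of 0] seminorm_zero[OF sn] by simp
  next
    case False
    have "q (c *\<^sub>R x) / \<bar>c\<bar> \<le> q x"
    proof (rule qge)
      fix w assume "w \<in> span D"
      then have "q (c *\<^sub>R x) \<le> p (c *\<^sub>R x - c *\<^sub>R w)" by (intro qle span_scale)
      also have "\<dots> = \<bar>c\<bar> * p (x - w)"
        unfolding scaleR_diff_right[symmetric] using sn by (rule seminorm_scale)
      finally show "q (c *\<^sub>R x) / \<bar>c\<bar> \<le> p (x - w)" using False by (simp add: field_simps)
    qed
    then show ?thesis using False by (simp add: field_simps)
  qed
  ultimately show ?thesis unfolding q_def by (rule seminormI)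
qed

text \<open>A functional supporting the distance from \<open>span D\<close> at \<open>z\<close>
  annihilates \<open>D\<close>, so \<open>ann\<close> forces this distance to be zero.\<close>

lemma seminorm_approximation_by_span:
  assumes sn: "seminorm p" and "e > 0"
    and ann: "\<And>f. linear f \<Longrightarrow> (\<And>x. \<bar>f x\<bar> \<le> p x) \<Longrightarrow> (\<And>d. d \<in> D \<Longrightarrow> f d = 0) \<Longrightarrow> f z = (0 :: real)"
  obtains w where "w \<in> span D" "p (z - w) < e"
proof -
  define q where "q v = (INF w\<in>span D. p (v - w))" for v
  have bdd: "bdd_below ((\<lambda>w. p (v - w)) ` span D)" for v
    using seminorm_nonneg[OF sn] by (intro bdd_belowI[of _ 0]) auto
  have qle: "q v \<le> p (v - w)" if "w \<in> span D" for v w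
    unfolding q_def using bdd that by (rule cINF_lower)
  have "seminorm q" using seminorm_quotient[OF sn, of D] by (simp add: q_def[abs_def])
  then obtain f where f: "linear f" "\<And>x. \<bar>f x\<bar> \<le> q x" "f z = q z"
    using seminorm_supporting_functional[of q z] by blast
  have "\<bar>f x\<bar> \<le> p x" for x using f(2)[of x] qle[OF span_zero, of x] by simp
  moreover have "f d = 0" if "d \<in> D" for d
    using f(2)[of d] qle[OF span_base[OF that], of d] seminorm_zero[OF sn] by simp
  ultimately have "q z = 0" using ann[OF f(1)] f(3) by simp
  then have "\<exists>w\<in>span D. p (z - w) < e"
    using cINF_less_iff[OF _ bdd, of z e] span_zero[of D] \<open>e > 0\<close> unfolding q_def by fastforce
  then show thesis using that by blast
qed

text \<open>\<open>E\<close> consists of the rational combinations of \<open>D\<close>, coded by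
  lists; its closure \<open>A\<close> for \<open>p\<close> is a subspace containing
  \<open>D\<close>.\<close>

lemma countable_dense_in_span:
  assumes sn: "seminorm p" and D: "countable D"
  obtains E where "countable E" "\<And>w e. w \<in> span D \<Longrightarrow> e > 0 \<Longrightarrow> \<exists>v\<in>E. p (w - v) < e"
proof -
  define E where "E = (\<lambda>l. sum_list (map (\<lambda>(q, d). of_rat q *\<^sub>R d) l)) ` lists (UNIV \<times> D)"
  have "countable E" unfolding E_def using D by (intro countable_image countable_lists) auto
  define A where "A = {w. \<forall>e>0. \<exists>v\<in>E. p (w - v) < e}"
  have add: "a + b \<in> E" if ab: "a \<in> E" "b \<in> E" for a b
  proof -
    obtain l m where l: "l \<in> lists (UNIV \<times> D)" "a = sum_list (map (\<lambda>(q, d). of_rat q *\<^sub>R d) l)"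
      and m: "m \<in> lists (UNIV \<times> D)" "b = sum_list (map (\<lambda>(q, d). of_rat q *\<^sub>R d) m)"
      using ab unfolding E_def by blast
    have "a + b = sum_list (map (\<lambda>(q, d). of_rat q *\<^sub>R d) (l @ m))" by (simp add: l m)
    moreover have "l @ m \<in> lists (UNIV \<times> D)" using l m by simp
    ultimately show ?thesis unfolding E_def by blast
  qed
  have scale: "of_rat r *\<^sub>R a \<in> E" if a: "a \<in> E" for r a
  proof -
    obtain l where l: "l \<in> lists (UNIV \<times> D)" "a = sum_list (map (\<lambda>(q, d). of_rat q *\<^sub>R d) l)"
      using a unfolding E_def by blast
    have "of_rat r *\<^sub>R sum_list (map (\<lambda>(q, d). of_rat q *\<^sub>R d) l) =
        sum_list (map (\<lambda>(q, d). of_rat q *\<^sub>R d) (map (\<lambda>(q, d). (r * q, d)) l))" for l :: "(rat \<times> 'a) list"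
      by (induction l) (auto simp: scaleR_add_right of_rat_mult)
    moreover have "map (\<lambda>(q, d). (r * q, d)) l \<in> lists (UNIV \<times> D)" using l(1) by (auto simp: in_lists_conv_set)
    ultimately show ?thesis unfolding E_def l(2) by (metis image_eqI)
  qed
  have zero: "0 \<in> E" unfolding E_def by (intro image_eqI[of _ _ "[]"]) auto
  have base: "d \<in> E" if "d \<in> D" for d
    unfolding E_def using that by (intro image_eqI[of _ _ "[(1, d)]"]) auto
  have "subspace A"
    unfolding subspace_def
  proof (intro conjI ballI allI)
    show "0 \<in> A" unfolding A_def using zero seminorm_zero[OF sn] by force
    fix x y assume x: "x \<in> A" and y: "y \<in> A"
    show "x + y \<in> A"
      unfolding A_def
    proof (intro CollectI allI impI)
      fix e :: real assume "e > 0"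
      then have "e / 2 > 0" by simp
      obtain a where a: "a \<in> E" "p (x - a) < e / 2" using x \<open>e / 2 > 0\<close> unfolding A_def by blast
      obtain b where b: "b \<in> E" "p (y - b) < e / 2" using y \<open>e / 2 > 0\<close> unfolding A_def by blast
      have "p (x + y - (a + b)) \<le> p (x - a) + p (y - b)"
        using seminorm_add[OF sn, of "x - a" "y - b"] by (simp add: algebra_simps)
      then show "\<exists>v\<in>E. p (x + y - v) < e" using add[OF a(1) b(1)] a(2) b(2) by force
    qed
  next
    fix c x assume x: "x \<in> A"
    show "c *\<^sub>R x \<in> A"
      unfolding A_def
    proof (intro CollectI allI impI)
      fix e :: real assume e: "e > 0"
      have "e / (2 * (\<bar>c\<bar> + 1)) > 0" using e by simp
      then obtain a where a: "a \<in> E" "p (x - a) < e / (2 * (\<bar>c\<bar> + 1))"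
        using x unfolding A_def by blast
      have nn: "p z \<ge> 0" for z using sn by (rule seminorm_nonneg)
      \<comment> \<open>A rational so close to \<open>c\<close> that replacing \<open>c\<close> by
        it costs at most \<open>e / 2\<close> at \<open>a\<close>; the other half is accounted for
        by the choice of \<open>a\<close>. Each \<open>+ 1\<close> guards against a zero
        denominator.\<close>
      have "c < c + e / (2 * (p a + 1))" using e nn[of a] by simp
      then obtain r where r: "c < of_rat r" "of_rat r < c + e / (2 * (p a + 1))" using of_rat_dense by blast
      have "p (c *\<^sub>R x - of_rat r *\<^sub>R a) \<le> \<bar>c\<bar> * p (x - a) + \<bar>c - of_rat r\<bar> * p a"
        using seminorm_add[OF sn, of "c *\<^sub>R (x - a)" "(c - of_rat r) *\<^sub>R a"]
        unfolding seminorm_scale[OF sn] by (simp add: scaleR_diff_right scaleR_diff_left)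
      also have "\<bar>c\<bar> * p (x - a) \<le> (\<bar>c\<bar> + 1) * p (x - a)"
        using nn by (intro mult_right_mono) auto
      also have "(\<bar>c\<bar> + 1) * p (x - a) < e / 2" using a(2) by (simp add: field_simps)
      also have "\<bar>c - of_rat r\<bar> * p a \<le> (e / (2 * (p a + 1))) * (p a + 1)"
        using r nn[of a] by (intro mult_mono) auto
      also have "(e / (2 * (p a + 1))) * (p a + 1) = e / 2" using nn[of a] by (simp add: field_simps)
      finally have "p (c *\<^sub>R x - of_rat r *\<^sub>R a) < e" by simp
      then show "\<exists>v\<in>E. p (c *\<^sub>R x - v) < e" using scale[OF a(1)] by blast
    qed
  qed
  moreover have "D \<subseteq> A" using base seminorm_zero[OF sn] by (force simp: A_def)
  ultimately have "span D \<subseteq> A" by (simp add: span_minimal)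
  then show thesis using that[OF \<open>countable E\<close>] unfolding A_def by blast
qed

text \<open>Otherwise one can split weakly open sets dyadically by functionals dominated by \<open>p\<close>. The
  cluster points along the branches are \<open>2\<^sup>\<omega>\<close> many points at mutual distance at least \<open>e\<close> in
  the weak closure of a countable set, which is separable for \<open>p\<close>.\<close>

lemma weakly_compact_fragmentable:
  fixes \<tau> :: "'x::real_vector topology"
  assumes det: "determines Q \<tau>" and p: "p \<in> Q"
    and K: "compactin (weak_topology \<tau>) K" "K \<noteq> {}" and e: "e > 0"
  obtains U where "openin (weak_topology \<tau>) U" "U \<inter> K \<noteq> {}"
    "\<And>x y. x \<in> U \<inter> K \<Longrightarrow> y \<in> U \<inter> K \<Longrightarrow> p (x - y) \<le> e"
proof (rule ccontr)
  assume "\<not> thesis"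
  note found = that
  define good where "good U \<longleftrightarrow> openin (weak_topology \<tau>) U \<and> U \<inter> K \<noteq> {}" for U
  have wide: "\<exists>x\<in>U \<inter> K. \<exists>y\<in>U \<inter> K. p (x - y) > e" if "good U" for U
    using \<open>\<not> thesis\<close> \<open>good U\<close> found[of U] unfolding good_def by (meson not_le)
  have sn: "seminorm p" using det p by (rule determines_seminorm)
  define functional where "functional f \<longleftrightarrow>
    linear f \<and> continuous_map (weak_topology \<tau>) euclideanreal f \<and> (\<forall>x. \<bar>f x\<bar> \<le> p x)" for f
  define splits where "splits U ch \<longleftrightarrow> (\<forall>b. good (ch b) \<and> ch b \<subseteq> U) \<and>
    (\<exists>f c. functional f \<and> (\<forall>z\<in>ch True. c + e \<le> f z) \<and> (\<forall>z\<in>ch False. f z \<le> c))"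
    for U and ch :: "bool \<Rightarrow> 'x set"
  have "\<exists>ch. splits U ch" if U: "good U" for U
  proof -
    obtain x y where xy: "x \<in> U \<inter> K" "y \<in> U \<inter> K" "p (x - y) > e" using wide[OF U] by blast
    obtain f where f: "linear f" "continuous_map (weak_topology \<tau>) euclideanreal f"
      "\<And>x. \<bar>f x\<bar> \<le> p x" "f (x - y) = p (x - y)"
      using weak_supporting_functional[OF det p, of "x - y"] by blast
    \<comment> \<open>The excess \<open>p (x - y) - e\<close> is shared equally, which leaves
      \<open>f x\<close> strictly above \<open>c + e\<close> and \<open>f y\<close> strictly below
      \<open>c\<close>; both halves are then weakly open sets that meet \<open>K\<close>.\<close>
    define c where "c = f y + (p (x - y) - e) / 2"
    have fx: "f x > c + e" and fy: "f y < c"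
      using f(1,4) xy(3) by (simp_all add: c_def linear_diff field_simps)
    define ch where "ch b = (if b then {z \<in> U. f z \<in> {c + e<..}} else {z \<in> U. f z \<in> {..<c}})" for b
    have op: "openin (weak_topology \<tau>) {z \<in> U. f z \<in> S}" if "open S" for S
    proof -
      have "openin (weak_topology \<tau>) {z \<in> topspace (weak_topology \<tau>). f z \<in> S}"
        using f(2) that by (intro openin_continuous_map_preimage) auto
      moreover have "{z \<in> U. f z \<in> S} = U \<inter> {z \<in> topspace (weak_topology \<tau>). f z \<in> S}"
        by (auto simp: weak_topology_topspace)
      ultimately show ?thesis using U by (simp add: good_def openin_Int)
    qed
    have "good (ch b)" for b
      using op[of "{c + e<..}"] op[of "{..<c}"] fx fy xy by (cases b) (auto simp: good_def ch_def)
    moreover have "functional f" using f(1-3) by (simp add: functional_def)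
    ultimately have "splits U ch"
      unfolding splits_def by (intro conjI exI[of _ f] exI[of _ c]) (auto simp: ch_def)
    then show ?thesis by blast
  qed
  then obtain ch where ch: "\<And>U. good U \<Longrightarrow> splits U (ch U)" by metis
  \<comment> \<open>A branch is a set \<open>\<sigma>\<close> of naturals that tells at which levels
    the upper half is taken; \<open>N \<sigma> n\<close> depends only on the elements of
    \<open>\<sigma>\<close> below \<open>n\<close>.\<close>
  define N where "N \<sigma> = rec_nat UNIV (\<lambda>n U. ch U (n \<in> \<sigma>))" for \<sigma> :: "nat set"
  have N0: "N \<sigma> 0 = UNIV" and NS: "N \<sigma> (Suc n) = ch (N \<sigma> n) (n \<in> \<sigma>)" for \<sigma> n
    by (simp_all add: N_def)
  have good0: "good UNIV"
    using K(2) openin_topspace[of "weak_topology \<tau>"] by (simp add: good_def weak_topology_topspace)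
  have Ngood: "good (N \<sigma> n)" for \<sigma> n
  proof (induction n)
    case (Suc n)
    then show ?case using ch[OF Suc] by (simp add: NS splits_def)
  qed (simp add: N0 good0)
  have "N \<sigma> (Suc n) \<subseteq> N \<sigma> n" for \<sigma> n using ch[OF Ngood] by (simp add: NS splits_def)
  then have Nmono: "N \<sigma> n \<subseteq> N \<sigma> m" if "m \<le> n" for \<sigma> m n
    using that by (rule lift_Suc_antimono_le)
  have Ncong: "N \<sigma> n = N \<rho> n" if "\<And>k. k < n \<Longrightarrow> k \<in> \<sigma> \<longleftrightarrow> k \<in> \<rho>" for \<sigma> \<rho> n
    using that by (induction n) (simp_all add: N0 NS)
  define d where "d \<sigma> n = (SOME x. x \<in> N \<sigma> n \<inter> K)" for \<sigma> n
  have dN: "d \<sigma> n \<in> N \<sigma> n \<inter> K" for \<sigma> n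
    using Ngood[of \<sigma> n] unfolding d_def good_def some_in_eq by blast
  \<comment> \<open>Finite \<open>\<sigma>\<close> suffice to reach every
    \<open>d \<sigma> n\<close>, which makes \<open>D\<close> countable although there are
    uncountably many branches.\<close>
  define D where "D = (\<lambda>(\<sigma>, n). d \<sigma> n) ` ({\<sigma>. finite \<sigma>} \<times> UNIV)"
  have "countable D"
    unfolding D_def by (intro countable_image countable_SIGMA countable_Collect_finite) auto
  have dD: "d \<sigma> n \<in> D" for \<sigma> n
  proof -
    have "N \<sigma> n = N (\<sigma> \<inter> {..<n}) n" by (rule Ncong) auto
    then have "d \<sigma> n = d (\<sigma> \<inter> {..<n}) n" by (simp add: d_def)
    then show ?thesis unfolding D_def by force
  qed
  define T where "T = weak_on \<tau> K"
  have topT: "topspace T = K" by (simp add: T_def weak_topology_topspace)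
  have coT: "compact_space T" unfolding T_def using K(1) by (rule compact_space_subtopology)
  \<comment> \<open>A weak cluster point of \<open>d \<sigma>\<close>, remembered only through the
    inequalities for dominated functionals that hold eventually along the branch.\<close>
  have "\<exists>z\<in>K. \<forall>f c n. functional f \<and> (\<forall>k\<ge>n. c \<le> f (d \<sigma> k)) \<longrightarrow> c \<le> f z" for \<sigma>
  proof -
    define C where "C n = T closure_of (d \<sigma> ` {n..})" for n
    have sub: "d \<sigma> ` {n..} \<subseteq> C n" for n
      unfolding C_def using dN topT by (intro closure_of_subset) auto
    have "(\<Inter>n. C n) \<noteq> {}"
    proof (rule compact_space_imp_nest[OF coT])
      show "closedin T (C n)" for n by (simp add: C_def)
      show "C n \<noteq> {}" for n using sub[of n] by auto
      show "decseq C"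
        unfolding C_def decseq_def by (intro allI impI closure_of_mono image_mono) auto
    qed
    then obtain z where z: "\<And>n. z \<in> C n" by blast
    have "z \<in> K" using z[of 0] closure_of_subset_topspace[of T] topT by (auto simp: C_def)
    moreover have "c \<le> f z" if f: "functional f" "\<forall>k\<ge>n. c \<le> f (d \<sigma> k)" for f c n
    proof -
      have "continuous_map T euclideanreal f"
        using f(1) unfolding T_def functional_def by (intro continuous_map_from_subtopology) auto
      then have "closedin T {x \<in> topspace T. f x \<in> {c..}}"
        by (rule closedin_continuous_map_preimage) simp
      moreover have "d \<sigma> ` {n..} \<subseteq> {x \<in> topspace T. f x \<in> {c..}}"
        using f(2) dN topT by auto
      ultimately have "C n \<subseteq> {x \<in> topspace T. f x \<in> {c..}}"
        unfolding C_def by (intro closure_of_minimal)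
      then show ?thesis using z[of n] by auto
    qed
    ultimately show ?thesis by blast
  qed
  then obtain z where z: "\<And>\<sigma> f c n. functional f \<Longrightarrow> (\<And>k. k \<ge> n \<Longrightarrow> c \<le> f (d \<sigma> k)) \<Longrightarrow> c \<le> f (z \<sigma>)"
    by metis
  have neg: "functional (\<lambda>x. - f x)" if "functional f" for f
    using that linear_compose_neg[of f] by (auto simp: functional_def)
  have z': "f (z \<sigma>) \<le> c" if "functional f" "\<And>k. k \<ge> n \<Longrightarrow> f (d \<sigma> k) \<le> c" for \<sigma> f c n
    using z[OF neg[OF that(1)], of n "- c" \<sigma>] that(2) by simp
  have apart: "e \<le> p (z \<sigma> - z \<rho>)" if n: "n \<in> \<sigma>" "n \<notin> \<rho>" "\<And>k. k < n \<Longrightarrow> k \<in> \<sigma> \<longleftrightarrow> k \<in> \<rho>" for \<sigma> \<rho> n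
  proof -
    define U where "U = N \<sigma> n"
    have U: "N \<sigma> (Suc n) = ch U True" "N \<rho> (Suc n) = ch U False"
      using n Ncong[of n \<sigma> \<rho>] by (simp_all add: NS U_def)
    obtain f c where f: "functional f" "\<forall>z\<in>ch U True. c + e \<le> f z" "\<forall>z\<in>ch U False. f z \<le> c"
      using ch[OF Ngood[of \<sigma> n]] unfolding splits_def U_def by blast
    have in_ch: "d \<sigma> k \<in> ch U True" "d \<rho> k \<in> ch U False" if "k \<ge> Suc n" for k
      using dN[of \<sigma> k] dN[of \<rho> k] Nmono[OF that, of \<sigma>] Nmono[OF that, of \<rho>] U by auto
    have "c + e \<le> f (z \<sigma>)" using z[OF f(1), of "Suc n" "c + e" \<sigma>] f(2) in_ch by blast
    moreover have "f (z \<rho>) \<le> c" using z'[OF f(1), of "Suc n" \<rho> c] f(3) in_ch by blast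
    moreover have "f (z \<sigma>) - f (z \<rho>) \<le> p (z \<sigma> - z \<rho>)"
      using f(1) linear_diff[of f "z \<sigma>" "z \<rho>"] unfolding functional_def by (metis abs_le_D1)
    ultimately show ?thesis by simp
  qed
  have sep: "e \<le> p (z \<sigma> - z \<rho>)" if "\<sigma> \<noteq> \<rho>" for \<sigma> \<rho>
  proof -
    define n where "n = (LEAST n. (n \<in> \<sigma>) \<noteq> (n \<in> \<rho>))"
    have "\<exists>n. (n \<in> \<sigma>) \<noteq> (n \<in> \<rho>)" using that by blast
    then have n: "(n \<in> \<sigma>) \<noteq> (n \<in> \<rho>)" unfolding n_def by (rule LeastI_ex)
    have "k \<in> \<sigma> \<longleftrightarrow> k \<in> \<rho>" if "k < n" for k using not_less_Least[OF that[unfolded n_def]] by blast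
    then show ?thesis
      using n apart[of n \<sigma> \<rho>] apart[of n \<rho> \<sigma>] seminorm_commute[OF sn, of "z \<sigma>" "z \<rho>"] by metis
  qed
  obtain E where E: "countable E" "\<And>w e. w \<in> span D \<Longrightarrow> e > 0 \<Longrightarrow> \<exists>v\<in>E. p (w - v) < e"
    using countable_dense_in_span[OF sn \<open>countable D\<close>] by blast
  have "\<exists>v\<in>E. p (z \<sigma> - v) < e / 2" for \<sigma>
  proof -
    \<comment> \<open>Approximation by \<open>span D\<close> and then by \<open>E\<close> costs
      \<open>e / 4\<close> each. Two cluster points within \<open>e / 2\<close> of the same
      \<open>v\<close> would be closer than \<open>e\<close>, contradicting
      \<open>sep\<close>.\<close>
    have "e / 4 > 0" using e by simp
    obtain w where w: "w \<in> span D" "p (z \<sigma> - w) < e / 4"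
    proof (rule seminorm_approximation_by_span[OF sn \<open>e / 4 > 0\<close>])
      fix f assume f: "linear f" "\<And>x. \<bar>f x\<bar> \<le> p x" "\<And>d. d \<in> D \<Longrightarrow> f d = (0 :: real)"
      have "functional f"
        using f determines_dominated_functional[OF det p f(1,2)] weak_topology_functional
        by (auto simp: functional_def)
      \<comment> \<open>\<open>f\<close> vanishes along the branch, so both inequalities pass to the
        cluster point.\<close>
      then show "f (z \<sigma>) = 0"
        using z[of f 0 0 \<sigma>] z'[of f 0 \<sigma> 0] f(3)[OF dD] by (simp add: antisym)
    qed
    obtain v where v: "v \<in> E" "p (w - v) < e / 4" using E(2)[OF w(1) \<open>e / 4 > 0\<close>] by blast
    have "p (z \<sigma> - v) < e / 2" using seminorm_triangle[OF sn, of "z \<sigma>" v w] w(2) v(2) by simp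
    then show ?thesis using v(1) by blast
  qed
  then obtain v where v: "\<And>\<sigma>. v \<sigma> \<in> E" "\<And>\<sigma>. p (z \<sigma> - v \<sigma>) < e / 2" by metis
  have "inj v"
  proof (rule injI, rule ccontr)
    fix \<sigma> \<rho> assume *: "v \<sigma> = v \<rho>" "\<sigma> \<noteq> \<rho>"
    show False
      using sep[OF *(2)] seminorm_triangle[OF sn, of "z \<sigma>" "z \<rho>" "v \<sigma>"] v(2)[of \<sigma>] v(2)[of \<rho>] *(1)
        seminorm_commute[OF sn, of "z \<rho>" "v \<rho>"] by simp
  qed
  moreover have "countable (range v)" using E(1) v(1) by (meson countable_subset image_subsetI)
  ultimately have "countable (UNIV :: nat set set)" using countable_image_inj_on by blast
  then have "range (from_nat_into (UNIV :: nat set set)) = UNIV"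
    by (intro range_from_nat_into) auto
  then show False using Cantors_theorem[of "UNIV :: nat set"] by auto
qed

section \<open>Invariant means and invariant closed sets\<close>

text \<open>Equicontinuity of the functions \<open>\<phi> \<circ> act s\<close> for one
  \<open>\<phi>\<close>. It refers to a topology alone, so that means and recurrence can be treated
  without a vector space structure.\<close>

definition equicontinuous_orbits ::
    "'x topology \<Rightarrow> ('s \<Rightarrow> 'x \<Rightarrow> 'x) \<Rightarrow> ('x \<Rightarrow> real) \<Rightarrow> bool"
  where "equicontinuous_orbits T act \<phi> \<longleftrightarrow> (\<forall>x\<in>topspace T. \<forall>e>0. \<exists>W. openin T W \<and> x \<in> W \<and>
    (\<forall>y\<in>W. \<forall>s. \<bar>\<phi> (act s y) - \<phi> (act s x)\<bar> < e))"

text \<open>By compactness, finitely many points approximate every \<open>z\<close> for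
  \<open>\<phi>\<close> and for all its translates at once.\<close>

lemma equicontinuous_orbits_net:
  assumes co: "compact_space T" and \<phi>: "continuous_map T euclideanreal \<phi>"
    and equi: "equicontinuous_orbits T act \<phi>" and e: "e > 0"
  obtains X where "finite X" "X \<subseteq> topspace T"
    "\<And>z. z \<in> topspace T \<Longrightarrow> \<exists>x\<in>X. \<bar>\<phi> z - \<phi> x\<bar> < e \<and> (\<forall>s. \<bar>\<phi> (act s z) - \<phi> (act s x)\<bar> < e)"
proof -
  have "\<exists>W. openin T W \<and> x \<in> W \<and> (\<forall>y\<in>W. \<bar>\<phi> y - \<phi> x\<bar> < e \<and> (\<forall>s. \<bar>\<phi> (act s y) - \<phi> (act s x)\<bar> < e))"
    if x: "x \<in> topspace T" for x
  proof -
    obtain W where W: "openin T W" "x \<in> W" "\<forall>y\<in>W. \<forall>s. \<bar>\<phi> (act s y) - \<phi> (act s x)\<bar> < e"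
      using equi x e unfolding equicontinuous_orbits_def by meson
    have "openin T {y \<in> topspace T. \<phi> y \<in> ball (\<phi> x) e}"
      using \<phi> by (rule openin_continuous_map_preimage) simp
    then show ?thesis
      using W x e by (intro exI[of _ "W \<inter> {y \<in> topspace T. \<phi> y \<in> ball (\<phi> x) e}"])
        (auto simp: dist_real_def abs_minus_commute intro: openin_Int)
  qed
  then obtain W where W: "\<And>x. x \<in> topspace T \<Longrightarrow> openin T (W x) \<and> x \<in> W x"
    "\<And>x y. x \<in> topspace T \<Longrightarrow> y \<in> W x \<Longrightarrow> \<bar>\<phi> y - \<phi> x\<bar> < e \<and> (\<forall>s. \<bar>\<phi> (act s y) - \<phi> (act s x)\<bar> < e)"
    by metis
  have "\<exists>\<F>. finite \<F> \<and> \<F> \<subseteq> W ` topspace T \<and> topspace T \<subseteq> \<Union>\<F>"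
    using co W(1) unfolding compact_space_def by (intro compactinD) auto
  then obtain X where X: "finite X" "X \<subseteq> topspace T" "topspace T \<subseteq> \<Union>(W ` X)"
    by (metis finite_subset_image)
  have "\<exists>x\<in>X. \<bar>\<phi> z - \<phi> x\<bar> < e \<and> (\<forall>s. \<bar>\<phi> (act s z) - \<phi> (act s x)\<bar> < e)" if "z \<in> topspace T" for z
  proof -
    obtain x where "x \<in> X" "z \<in> W x" using X(3) \<open>z \<in> topspace T\<close> by blast
    then show ?thesis using W(2)[of x z] X(2) by blast
  qed
  then show thesis using that X(1,2) by blast
qed

lemma seminorm_SUP:
  assumes sn: "\<And>i. i \<in> I \<Longrightarrow> seminorm (f i)" and "I \<noteq> {}"
    and bdd: "\<And>x. bdd_above ((\<lambda>i. f i x) ` I)"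
  shows "seminorm (\<lambda>x. SUP i\<in>I. f i x)"
proof -
  define q where "q x = (SUP i\<in>I. f i x)" for x
  have ge: "f i x \<le> q x" if "i \<in> I" for i x
    unfolding q_def using that bdd by (rule cSUP_upper)
  have le: "q x \<le> c" if "\<And>i. i \<in> I \<Longrightarrow> f i x \<le> c" for x c
    unfolding q_def using \<open>I \<noteq> {}\<close> that by (rule cSUP_least)
  have add: "q (x + y) \<le> q x + q y" for x y
  proof (rule le)
    fix i assume i: "i \<in> I"
    show "f i (x + y) \<le> q x + q y"
      using seminorm_add[OF sn[OF i], of x y] ge[OF i, of x] ge[OF i, of y] by simp
  qed
  have scale: "q (c *\<^sub>R x) \<le> \<bar>c\<bar> * q x" for c x
  proof (rule le)
    fix i assume i: "i \<in> I"
    show "f i (c *\<^sub>R x) \<le> \<bar>c\<bar> * q x"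
      unfolding seminorm_scale[OF sn[OF i]] using ge[OF i] by (intro mult_left_mono) auto
  qed
  show ?thesis using seminormI[of q, OF add scale] by (simp add: q_def[abs_def])
qed

section \<open>Means on the continuous functions of a compact dynamical system\<close>

context
  fixes T :: "'x topology" and act :: "'s::semitopological_semigroup \<Rightarrow> 'x \<Rightarrow> 'x"
  assumes coT: "compact_space T" and neT: "topspace T \<noteq> {}" and dyn: "dynamical_system T act"
    and equi: "\<And>\<phi>. continuous_map T euclideanreal \<phi> \<Longrightarrow> equicontinuous_orbits T act \<phi>"
begin

text \<open>Values outside \<open>topspace T\<close> are arbitrary; \<open>means_cong\<close> shows
  that means ignore them.\<close>

definition Cont :: "('x \<Rightarrow> real) set"
  where "Cont = {\<phi>. continuous_map T euclideanreal \<phi>}"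

text \<open>\<open>\<phi>\<close> is inserted because the semigroup may lack an identity; a supremum
  over the orbit then controls the value at \<open>\<phi>\<close> itself.\<close>

definition orbit :: "('x \<Rightarrow> real) \<Rightarrow> ('x \<Rightarrow> real) set"
  where "orbit \<phi> = insert \<phi> (range (\<lambda>s x. \<phi> (act s x)))"

text \<open>The analogue of probability measures on the phase space; the value \<open>0\<close> off
  \<open>Cont\<close> makes a mean determined by its restriction to \<open>Cont\<close>.\<close>

definition means :: "(('x \<Rightarrow> real) \<Rightarrow> real) set"
  where "means = {m. (\<forall>\<phi>. \<phi> \<in> Cont \<longrightarrow> (\<forall>\<psi>. \<psi> \<in> Cont \<longrightarrow> m (\<lambda>x. \<phi> x + \<psi> x) = m \<phi> + m \<psi>)) \<and>
    (\<forall>\<phi>. \<phi> \<in> Cont \<longrightarrow> (\<forall>c. m (\<lambda>x. c * \<phi> x) = c * m \<phi>)) \<and>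
    (\<forall>\<phi>. \<phi> \<in> Cont \<longrightarrow> (\<forall>x\<in>topspace T. 0 \<le> \<phi> x) \<longrightarrow> 0 \<le> m \<phi>) \<and>
    m (\<lambda>x. 1) = 1 \<and> (\<forall>\<phi>. \<phi> \<notin> Cont \<longrightarrow> m \<phi> = 0)}"

text \<open>The push-forward of a mean. Composition with translations reverses their order and
  duality reverses it again, so this is a left action.\<close>

definition translate :: "'s \<Rightarrow> (('x \<Rightarrow> real) \<Rightarrow> real) \<Rightarrow> ('x \<Rightarrow> real) \<Rightarrow> real"
  where "translate s m \<phi> = (if \<phi> \<in> Cont then m (\<lambda>x. \<phi> (act s x)) else 0)"

lemma act_in: "x \<in> topspace T \<Longrightarrow> act s x \<in> topspace T"
  using dyn by (auto simp: dynamical_system_def continuous_map_def Pi_iff)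

lemma act_act: "x \<in> topspace T \<Longrightarrow> act s (act t x) = act (s * t) x"
  using dyn by (simp add: dynamical_system_def)

lemma Cont_act: "\<phi> \<in> Cont \<Longrightarrow> (\<lambda>x. \<phi> (act s x)) \<in> Cont"
  using continuous_map_compose[of T T "act s" euclideanreal \<phi>] dyn
  by (simp add: Cont_def dynamical_system_def o_def)

lemma Cont_intros:
  "(\<lambda>x. c) \<in> Cont" "\<phi> \<in> Cont \<Longrightarrow> \<psi> \<in> Cont \<Longrightarrow> (\<lambda>x. \<phi> x + \<psi> x) \<in> Cont"
  "\<phi> \<in> Cont \<Longrightarrow> (\<lambda>x. c * \<phi> x) \<in> Cont"
  by (auto simp: Cont_def intro: continuous_map_add continuous_map_real_mult_left)

lemma orbit_Cont: "\<phi> \<in> Cont \<Longrightarrow> \<psi> \<in> orbit \<phi> \<Longrightarrow> \<psi> \<in> Cont"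
  using Cont_act by (auto simp: orbit_def)

lemma Cont_bounded:
  assumes "\<phi> \<in> Cont"
  obtains B where "B \<ge> 0" "\<And>x. x \<in> topspace T \<Longrightarrow> \<bar>\<phi> x\<bar> \<le> B"
proof -
  have "compactin euclideanreal (\<phi> ` topspace T)"
    using coT assms image_compactin unfolding compact_space_def Cont_def by blast
  then have "bounded (\<phi> ` topspace T)" by (simp add: compact_imp_bounded)
  then obtain B where "\<forall>x\<in>topspace T. \<bar>\<phi> x\<bar> \<le> B" unfolding bounded_iff by auto
  moreover have "B \<ge> 0" using calculation neT by fastforce
  ultimately show thesis using that by blast
qed

lemma
  assumes m: "m \<in> means"
  shows means_add: "\<phi> \<in> Cont \<Longrightarrow> \<psi> \<in> Cont \<Longrightarrow> m (\<lambda>x. \<phi> x + \<psi> x) = m \<phi> + m \<psi>"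
    and means_scale: "\<phi> \<in> Cont \<Longrightarrow> m (\<lambda>x. c * \<phi> x) = c * m \<phi>"
    and means_nonneg: "\<phi> \<in> Cont \<Longrightarrow> (\<And>x. x \<in> topspace T \<Longrightarrow> 0 \<le> \<phi> x) \<Longrightarrow> 0 \<le> m \<phi>"
    and means_one: "m (\<lambda>x. 1) = 1"
    and means_outside: "\<phi> \<notin> Cont \<Longrightarrow> m \<phi> = 0"
  using m unfolding means_def by blast+

lemma means_zero: "m \<in> means \<Longrightarrow> m (\<lambda>x. 0) = 0"
  using means_scale[of m "\<lambda>x. 0" 0] Cont_intros(1)[of 0] by simp

lemma means_mono:
  assumes m: "m \<in> means" and "\<phi> \<in> Cont" "\<psi> \<in> Cont" and le: "\<And>x. x \<in> topspace T \<Longrightarrow> \<phi> x \<le> \<psi> x"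
  shows "m \<phi> \<le> m \<psi>"
proof -
  have "0 \<le> m (\<lambda>x. \<psi> x + (- 1) * \<phi> x)"
    using le by (intro means_nonneg[OF m] Cont_intros assms) simp
  also have "\<dots> = m \<psi> + (- 1) * m \<phi>"
    unfolding means_add[OF m assms(3) Cont_intros(3)[OF assms(2)]] means_scale[OF m assms(2)] ..
  finally show ?thesis by simp
qed

lemma means_cong:
  assumes "m \<in> means" "\<phi> \<in> Cont" "\<psi> \<in> Cont" "\<And>x. x \<in> topspace T \<Longrightarrow> \<phi> x = \<psi> x"
  shows "m \<phi> = m \<psi>"
  using means_mono[OF assms(1,2,3)] means_mono[OF assms(1,3,2)] assms(4) by (simp add: antisym)

lemma means_close:
  assumes m: "m \<in> means" and \<phi>: "\<phi> \<in> Cont" and \<psi>: "\<psi> \<in> Cont"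
    and close: "\<And>x. x \<in> topspace T \<Longrightarrow> \<bar>\<phi> x - \<psi> x\<bar> \<le> e"
  shows "\<bar>m \<phi> - m \<psi>\<bar> \<le> e"
proof -
  have le: "m \<phi> \<le> m \<psi> + e" if "\<phi> \<in> Cont" "\<psi> \<in> Cont" "\<And>x. x \<in> topspace T \<Longrightarrow> \<phi> x \<le> \<psi> x + e" for \<phi> \<psi>
  proof -
    have "m \<phi> \<le> m (\<lambda>x. \<psi> x + e * 1)"
      using that by (intro means_mono[OF m] Cont_intros) auto
    also have "\<dots> = m \<psi> + e"
      using means_add[OF m that(2) Cont_intros(3)[OF Cont_intros(1)], of e 1]
        means_scale[OF m Cont_intros(1), of e 1] means_one[OF m] by simp
    finally show ?thesis .
  qed
  have "\<phi> x \<le> \<psi> x + e" "\<psi> x \<le> \<phi> x + e" if "x \<in> topspace T" for x using close[OF that] by auto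
  then show ?thesis using le[OF \<phi> \<psi>] le[OF \<psi> \<phi>] by auto
qed

lemma translate_means:
  assumes m: "m \<in> means" shows "translate s m \<in> means"
  unfolding means_def mem_Collect_eq
  using Cont_act[of _ s] Cont_intros act_in
  by (auto simp: translate_def means_add[OF m] means_scale[OF m] means_one[OF m]
      intro: means_nonneg[OF m])

text \<open>Arzela-Ascoli for the orbit in the sup norm: values on a finite net, rounded to
  multiples of \<open>d\<close>, leave finitely many patterns, and one representative is kept for
  each. The two moves to the net and the rounding cost \<open>d = e / 3\<close> each.\<close>

lemma orbit_net:
  assumes \<phi>: "\<phi> \<in> Cont" and e: "e > 0"
  obtains \<Psi> where "finite \<Psi>" "\<Psi> \<subseteq> orbit \<phi>"
    "\<And>\<psi>. \<psi> \<in> orbit \<phi> \<Longrightarrow> \<exists>\<psi>'\<in>\<Psi>. \<forall>x\<in>topspace T. \<bar>\<psi> x - \<psi>' x\<bar> \<le> e"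
proof -
  define d where "d = e / 3"
  have d: "d > 0" using e by (simp add: d_def)
  obtain X where X: "finite X" "X \<subseteq> topspace T"
    "\<And>z. z \<in> topspace T \<Longrightarrow> \<exists>x\<in>X. \<bar>\<phi> z - \<phi> x\<bar> < d \<and> (\<forall>s. \<bar>\<phi> (act s z) - \<phi> (act s x)\<bar> < d)"
    using equicontinuous_orbits_net[OF coT _ _ d, of \<phi> act] equi[of \<phi>] \<phi> unfolding Cont_def by blast
  have near: "\<exists>x\<in>X. \<forall>\<psi>\<in>orbit \<phi>. \<bar>\<psi> z - \<psi> x\<bar> < d" if "z \<in> topspace T" for z
    using X(3)[OF that] by (auto simp: orbit_def)
  obtain B where B: "B \<ge> 0" "\<And>x. x \<in> topspace T \<Longrightarrow> \<bar>\<phi> x\<bar> \<le> B" using Cont_bounded[OF \<phi>] by blast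
  have bound: "\<bar>\<psi> x\<bar> \<le> B" if "\<psi> \<in> orbit \<phi>" "x \<in> topspace T" for \<psi> x
    using that B(2) act_in by (auto simp: orbit_def)
  define disc where "disc \<psi> = restrict (\<lambda>x. \<lfloor>\<psi> x / d\<rfloor>) X" for \<psi> :: "'x \<Rightarrow> real"
  have "disc ` orbit \<phi> \<subseteq> (\<Pi>\<^sub>E x\<in>X. {\<lfloor>- B / d\<rfloor>..\<lfloor>B / d\<rfloor>})"
  proof (intro image_subsetI PiE_I)
    fix \<psi> x assume "\<psi> \<in> orbit \<phi>" "x \<in> X"
    then have "- B \<le> \<psi> x" "\<psi> x \<le> B" using bound[of \<psi> x] X(2) by auto
    then have "- B / d \<le> \<psi> x / d" "\<psi> x / d \<le> B / d"
      using d by (meson divide_right_mono less_imp_le)+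
    then show "disc \<psi> x \<in> {\<lfloor>- B / d\<rfloor>..\<lfloor>B / d\<rfloor>}"
      using \<open>x \<in> X\<close> by (auto simp: disc_def intro: floor_mono)
  qed (auto simp: disc_def)
  then have fin: "finite (disc ` orbit \<phi>)"
    using finite_PiE[OF X(1)] by (meson finite_atLeastAtMost_int finite_subset)
  define \<Psi> where "\<Psi> = inv_into (orbit \<phi>) disc ` (disc ` orbit \<phi>)"
  have "finite \<Psi>" unfolding \<Psi>_def using fin by (rule finite_imageI)
  moreover have "\<Psi> \<subseteq> orbit \<phi>" unfolding \<Psi>_def by (auto intro: inv_into_into)
  moreover have "\<exists>\<psi>'\<in>\<Psi>. \<forall>x\<in>topspace T. \<bar>\<psi> x - \<psi>' x\<bar> \<le> e" if \<psi>: "\<psi> \<in> orbit \<phi>" for \<psi>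
  proof -
    define \<psi>' where "\<psi>' = inv_into (orbit \<phi>) disc (disc \<psi>)"
    have "disc \<psi> \<in> disc ` orbit \<phi>" using \<psi> by (rule imageI)
    then have \<psi>': "\<psi>' \<in> orbit \<phi>" "disc \<psi>' = disc \<psi>"
      unfolding \<psi>'_def by (rule inv_into_into, rule f_inv_into_f)
    have "\<bar>\<psi> x - \<psi>' x\<bar> \<le> e" if x: "x \<in> topspace T" for x
    proof -
      obtain y where y: "y \<in> X" "\<bar>\<psi> x - \<psi> y\<bar> < d" "\<bar>\<psi>' x - \<psi>' y\<bar> < d"
        using near[OF x] \<psi> \<psi>'(1) by blast
      have "\<lfloor>\<psi> y / d\<rfloor> = \<lfloor>\<psi>' y / d\<rfloor>" using fun_cong[OF \<psi>'(2), of y] y(1) by (simp add: disc_def)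
      then have "\<bar>\<psi> y / d - \<psi>' y / d\<bar> < 1" by linarith
      then have "\<bar>\<psi> y - \<psi>' y\<bar> / d < 1" using d by (simp add: diff_divide_distrib[symmetric])
      then have "\<bar>\<psi> y - \<psi>' y\<bar> < d" using d by (simp add: field_simps)
      then show ?thesis using y unfolding d_def by linarith
    qed
    moreover have "\<psi>' \<in> \<Psi>" using \<psi> by (auto simp: \<Psi>_def \<psi>'_def)
    ultimately show ?thesis by blast
  qed
  ultimately show thesis using that by blast
qed

text \<open>Banach-Alaoglu for the product topology: every defining condition concerns finitely many
  coordinates, and a bound of \<open>\<phi>\<close> on the phase space bounds
  \<open>m \<phi>\<close>.\<close>

lemma means_compact: "compact means"
proof -
  have "\<exists>B\<ge>0. \<forall>x\<in>topspace T. \<bar>\<phi> x\<bar> \<le> B" if "\<phi> \<in> Cont" for \<phi> using Cont_bounded[OF that] by metis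
  then obtain B where B: "\<And>\<phi>. \<phi> \<in> Cont \<Longrightarrow> B \<phi> \<ge> 0"
    "\<And>\<phi> x. \<phi> \<in> Cont \<Longrightarrow> x \<in> topspace T \<Longrightarrow> \<bar>\<phi> x\<bar> \<le> B \<phi>" by metis
  \<comment> \<open>The choice function \<open>B\<close> is unspecified off \<open>Cont\<close>; its
    absolute value ensures that the interval contains the value \<open>0\<close> which means take
    there.\<close>
  define Box where "Box = (\<Pi>\<^sub>E \<phi>\<in>UNIV. {- \<bar>B \<phi>\<bar>..\<bar>B \<phi>\<bar>})"
  have "compactin (product_topology (\<lambda>\<phi>. euclideanreal) UNIV) Box"
    unfolding Box_def compactin_PiE by simp
  then have "compact Box" by (simp add: euclidean_product_topology)
  moreover have "closed means"
    unfolding means_def Ball_def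
    by (intro closed_Collect_conj closed_Collect_all closed_Collect_imp closed_Collect_eq closed_Collect_le
        open_Collect_const closed_Collect_const continuous_on_add continuous_on_mult continuous_on_const
        continuous_on_product_coordinates)
  moreover have "means \<subseteq> Box"
  proof
    fix m assume m: "m \<in> means"
    have "\<bar>m \<phi>\<bar> \<le> \<bar>B \<phi>\<bar>" for \<phi>
    proof (cases "\<phi> \<in> Cont")
      case True
      have "m (\<lambda>x. 0) = 0" using m by (rule means_zero)
      then show ?thesis
        using means_close[OF m True Cont_intros(1)[of 0], of "B \<phi>"] B[OF True] by simp
    qed (simp add: means_outside[OF m])
    then show "m \<in> Box" by (auto simp: Box_def abs_le_iff minus_le_iff)
  qed
  ultimately show ?thesis using compact_Int_closed[of Box means] by (simp add: Int_absorb1)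
qed

text \<open>On the subspace \<open>tame\<close> the suprema over orbits are finite; they are extended to the whole
  space by a linear projection \<open>g\<close> onto \<open>tame\<close>.\<close>

definition tame :: "(('x \<Rightarrow> real) \<Rightarrow> real) set"
  where "tame = {m. (\<forall>\<phi>\<in>Cont. \<exists>B. \<forall>\<psi>\<in>orbit \<phi>. \<bar>m \<psi>\<bar> \<le> B) \<and> (\<forall>\<phi>. \<phi> \<notin> Cont \<longrightarrow> m \<phi> = 0)}"

lemma subspace_tame: "subspace tame"
  unfolding subspace_def
proof (intro conjI ballI allI)
  show "0 \<in> tame" by (auto simp: tame_def)
  fix m n assume m: "m \<in> tame" and n: "n \<in> tame"
  have "\<exists>B. \<forall>\<psi>\<in>orbit \<phi>. \<bar>(m + n) \<psi>\<bar> \<le> B" if \<phi>: "\<phi> \<in> Cont" for \<phi>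
  proof -
    obtain A B where AB: "\<forall>\<psi>\<in>orbit \<phi>. \<bar>m \<psi>\<bar> \<le> A" "\<forall>\<psi>\<in>orbit \<phi>. \<bar>n \<psi>\<bar> \<le> B"
      using m n \<phi> unfolding tame_def by blast
    have "\<bar>(m + n) \<psi>\<bar> \<le> A + B" if "\<psi> \<in> orbit \<phi>" for \<psi>
      using AB that abs_triangle_ineq[of "m \<psi>" "n \<psi>"] by force
    then show ?thesis by blast
  qed
  then show "m + n \<in> tame" using m n by (auto simp: tame_def)
next
  fix c m assume m: "m \<in> tame"
  have "\<exists>B. \<forall>\<psi>\<in>orbit \<phi>. \<bar>(c *\<^sub>R m) \<psi>\<bar> \<le> B" if \<phi>: "\<phi> \<in> Cont" for \<phi>
  proof -
    obtain A where A: "\<forall>\<psi>\<in>orbit \<phi>. \<bar>m \<psi>\<bar> \<le> A" using m \<phi> unfolding tame_def by blast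
    have "\<bar>(c *\<^sub>R m) \<psi>\<bar> \<le> \<bar>c\<bar> * A" if "\<psi> \<in> orbit \<phi>" for \<psi>
      using A that by (auto simp: scaleR_fun_def abs_mult intro: mult_left_mono)
    then show ?thesis by blast
  qed
  then show "c *\<^sub>R m \<in> tame" using m by (auto simp: tame_def scaleR_fun_def)
qed

lemma means_tame: "means \<subseteq> tame"
proof
  fix m assume m: "m \<in> means"
  have "\<exists>B. \<forall>\<psi>\<in>orbit \<phi>. \<bar>m \<psi>\<bar> \<le> B" if \<phi>: "\<phi> \<in> Cont" for \<phi>
  proof -
    obtain B where B: "\<And>x. x \<in> topspace T \<Longrightarrow> \<bar>\<phi> x\<bar> \<le> B" using Cont_bounded[OF \<phi>] by blast
    have "\<bar>m \<psi>\<bar> \<le> B" if \<psi>: "\<psi> \<in> orbit \<phi>" for \<psi>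
    proof -
      have "\<bar>\<psi> x\<bar> \<le> B" if "x \<in> topspace T" for x using \<psi> B act_in that by (auto simp: orbit_def)
      moreover have "m (\<lambda>x. 0) = 0" using m by (rule means_zero)
      ultimately show ?thesis
        using means_close[OF m orbit_Cont[OF \<phi> \<psi>] Cont_intros(1)[of 0], of B] by simp
    qed
    then show ?thesis by blast
  qed
  then show "m \<in> tame" using means_outside[OF m] by (auto simp: tame_def)
qed

text \<open>Property \<open>(D)\<close> is applied to the means with the seminorms
  \<open>q \<phi>\<close>. Precomposition with a translation maps \<open>orbit \<phi>\<close> into
  itself on the phase space, whence nonexpansiveness; on means \<open>orbit_net\<close> reduces the
  supremum to finitely many functions, whence compactness.\<close>

lemma invariant_mean_exists:
  assumes fpp: "has_fixed_point_property FP_D TYPE('s) TYPE(('x \<Rightarrow> real) \<Rightarrow> real)"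
  obtains m where "m \<in> means" "\<And>\<phi> s. \<phi> \<in> Cont \<Longrightarrow> m (\<lambda>x. \<phi> (act s x)) = m \<phi>"
proof -
  obtain g where g: "linear g" "\<And>m. g m \<in> tame" "\<And>m. m \<in> tame \<Longrightarrow> g m = m"
  proof -
    have "\<exists>g. range g \<subseteq> tame \<and> linear g \<and> (\<forall>v\<in>tame. g (id v) = v)"
      by (rule linear_exists_left_inverse_on) (simp_all add: subspace_tame linear_id[unfolded id_def] id_def)
    then show thesis using that by auto
  qed
  have g_diff: "g (m - n) = m - n" if "m \<in> means" "n \<in> means" for m n
    using that means_tame subspace_diff[OF subspace_tame] g(3) by blast
  define q where "q \<phi> m = (SUP \<psi>\<in>orbit \<phi>. \<bar>g m \<psi>\<bar>)" for \<phi> m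
  have orbit_ne: "orbit \<phi> \<noteq> {}" for \<phi> by (simp add: orbit_def)
  have bdd: "bdd_above ((\<lambda>\<psi>. \<bar>g m \<psi>\<bar>) ` orbit \<phi>)" if "\<phi> \<in> Cont" for \<phi> m
    using g(2)[of m] that unfolding tame_def bdd_above_def by blast
  have q_ge: "\<bar>g m \<psi>\<bar> \<le> q \<phi> m" if "\<phi> \<in> Cont" "\<psi> \<in> orbit \<phi>" for \<phi> \<psi> m
    unfolding q_def using that(2) bdd[OF that(1)] by (rule cSUP_upper)
  have q_le: "q \<phi> m \<le> c" if "\<And>\<psi>. \<psi> \<in> orbit \<phi> \<Longrightarrow> \<bar>g m \<psi>\<bar> \<le> c" for \<phi> m c
    unfolding q_def using orbit_ne that by (rule cSUP_least)
  \<comment> \<open>The second family separates the points of the kernel of \<open>g\<close> from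
    zero and vanishes on differences of means, which \<open>g\<close> fixes.\<close>
  define Q where "Q = q ` Cont \<union> {\<lambda>m. \<bar>l (m - g m)\<bar> | l. linear (l :: _ \<Rightarrow> real)}"
  have lin: "linear (\<lambda>m. l (m - g m))" if "linear l" for l :: "(('x \<Rightarrow> real) \<Rightarrow> real) \<Rightarrow> real"
    using linear_compose[OF linear_compose_sub[OF linear_id g(1)] that] by (simp add: o_def)
  have sn: "seminorm p" if p: "p \<in> Q" for p
  proof -
    consider \<phi> where "\<phi> \<in> Cont" "p = q \<phi>"
      | l where "p = (\<lambda>m. \<bar>l (m - g m)\<bar>)" "linear (l :: _ \<Rightarrow> real)"
      using p by (auto simp: Q_def)
    then show ?thesis
    proof cases
      case 1
      have "linear (\<lambda>m. g m \<psi>)" for \<psi>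
      proof (rule linearI)
        show "g (m + n) \<psi> = g m \<psi> + g n \<psi>" for m n by (simp add: linear_add[OF g(1)])
        have "g (c *\<^sub>R m) = c *\<^sub>R g m" for c m using g(1) by (rule linear_scale)
        then show "g (c *\<^sub>R m) \<psi> = c *\<^sub>R g m \<psi>" for c m by (simp only: scaleR_fun_def)
      qed
      then show ?thesis
        unfolding 1(2) q_def[abs_def] using orbit_ne bdd[OF 1(1)]
        by (intro seminorm_SUP seminorm_abs_linear) auto
    qed (use lin seminorm_abs_linear in blast)
  qed
  define \<sigma> where "\<sigma> = seminorm_topology Q"
  have det: "determines Q \<sigma>" unfolding \<sigma>_def using sn by (rule determines_seminorm_topology)
  have "m = 0" if m: "\<And>p. p \<in> Q \<Longrightarrow> p m = 0" for m
  proof (rule ccontr)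
    assume "m \<noteq> 0"
    have "g m \<phi> = 0" for \<phi>
    proof (cases "\<phi> \<in> Cont")
      case True
      then have "q \<phi> m = 0" using m[of "q \<phi>"] by (simp add: Q_def)
      then show ?thesis using q_ge[OF True, of \<phi> m] by (simp add: orbit_def)
    qed (use g(2)[of m] in \<open>simp add: tame_def\<close>)
    then have "g m = 0" by (simp add: fun_eq_iff)
    obtain l :: "(('x \<Rightarrow> real) \<Rightarrow> real) \<Rightarrow> real" where l: "linear l" "l m \<noteq> 0"
      using separating_linear_functional[OF \<open>m \<noteq> 0\<close>] .
    then have "\<bar>l (m - g m)\<bar> = 0" using m[of "\<lambda>m. \<bar>l (m - g m)\<bar>"] by (auto simp: Q_def)
    then show False using l \<open>g m = 0\<close> by simp
  qed
  then have lc: "locally_convex_topology \<sigma>" using locally_convex_of_determines[OF det] by blast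
  \<comment> \<open>On \<open>means\<close> pointwise convergence implies convergence for
    \<open>q \<phi>\<close>, so compactness carries over from the product topology.\<close>
  have id_cont: "continuous_map (top_of_set means) \<sigma> (\<lambda>m. m)"
  proof (rule continuous_map_into_determined[OF det])
    fix p a and e :: real assume p: "p \<in> Q" and "a \<in> topspace (top_of_set means)" and e: "e > 0"
    then have a: "a \<in> means" by simp
    consider \<phi> where "\<phi> \<in> Cont" "p = q \<phi>"
      | l where "p = (\<lambda>m. \<bar>l (m - g m)\<bar>)" "linear (l :: _ \<Rightarrow> real)"
      using p by (auto simp: Q_def)
    then show "\<exists>W. openin (top_of_set means) W \<and> a \<in> W \<and> (\<forall>m\<in>W. p (m - a) < e)"
    proof cases
      case 1
      have "e / 4 > 0" using e by simp
      obtain \<Psi> where \<Psi>: "finite \<Psi>" "\<Psi> \<subseteq> orbit \<phi>"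
        "\<And>\<psi>. \<psi> \<in> orbit \<phi> \<Longrightarrow> \<exists>\<psi>'\<in>\<Psi>. \<forall>x\<in>topspace T. \<bar>\<psi> x - \<psi>' x\<bar> \<le> e / 4"
        using orbit_net[OF 1(1) \<open>e / 4 > 0\<close>] by blast
      \<comment> \<open>Three errors of \<open>e / 4\<close> arise: from \<open>\<psi>\<close> to
        \<open>\<psi>'\<close> under \<open>m\<close>, the same under \<open>a\<close>, and between
        \<open>m\<close> and \<open>a\<close> at \<open>\<psi>'\<close>. The total stays strictly
        below \<open>e\<close>.\<close>
      define O' where "O' = (\<Inter>\<psi>\<in>\<Psi>. {m. \<bar>m \<psi> - a \<psi>\<bar> < e / 4})"
      have "open {m :: ('x \<Rightarrow> real) \<Rightarrow> real. \<bar>m \<psi> - a \<psi>\<bar> < e / 4}" for \<psi>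
        by (intro open_Collect_less continuous_on_rabs continuous_on_diff continuous_on_const
            continuous_on_product_coordinates)
      then have "open O'" unfolding O'_def using \<Psi>(1) by (intro open_INT) auto
      then have "openin (top_of_set means) (means \<inter> O')" by (rule openin_open_Int)
      moreover have "a \<in> means \<inter> O'" using a e by (auto simp: O'_def)
      moreover have "p (m - a) < e" if m: "m \<in> means \<inter> O'" for m
      proof -
        have "q \<phi> (m - a) \<le> 3 * e / 4"
        proof (rule q_le)
          fix \<psi> assume \<psi>: "\<psi> \<in> orbit \<phi>"
          obtain \<psi>' where \<psi>': "\<psi>' \<in> \<Psi>" "\<forall>x\<in>topspace T. \<bar>\<psi> x - \<psi>' x\<bar> \<le> e / 4" using \<Psi>(3)[OF \<psi>] by blast
          have C: "\<psi> \<in> Cont" "\<psi>' \<in> Cont" using orbit_Cont[OF 1(1)] \<psi> \<psi>'(1) \<Psi>(2) by auto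
          have "\<bar>m \<psi> - m \<psi>'\<bar> \<le> e / 4" "\<bar>a \<psi> - a \<psi>'\<bar> \<le> e / 4"
            using means_close[OF _ C, of _ "e / 4"] m a \<psi>'(2) by blast+
          moreover have "\<bar>m \<psi>' - a \<psi>'\<bar> < e / 4" using m \<psi>'(1) by (auto simp: O'_def)
          moreover have "g (m - a) \<psi> = m \<psi> - a \<psi>" using g_diff m a by simp
          ultimately show "\<bar>g (m - a) \<psi>\<bar> \<le> 3 * e / 4" by linarith
        qed
        then show ?thesis using e 1(2) by simp
      qed
      ultimately show ?thesis by blast
    next
      case 2
      then have "p (m - a) = 0" if "m \<in> means" for m using g_diff[OF that a] by (simp add: linear_0)
      then show ?thesis using a e by (intro exI[of _ means]) auto
    qed
  qed
  have top: "topspace \<sigma> = UNIV" using det by (rule determines_topspace)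
  have compact: "compactin \<sigma> means"
    using image_compactin[OF _ id_cont, of means] means_compact by simp
  have conv: "convex means"
    unfolding convex_def
  proof (intro ballI allI impI)
    fix m n and u v :: real assume m: "m \<in> means" and n: "n \<in> means" and uv: "0 \<le> u" "0 \<le> v" "u + v = 1"
    have *: "(u *\<^sub>R m + v *\<^sub>R n) \<phi> = u * m \<phi> + v * n \<phi>" for \<phi> by (simp add: scaleR_fun_def)
    show "u *\<^sub>R m + v *\<^sub>R n \<in> means"
      unfolding means_def mem_Collect_eq *
      using uv by (auto simp: means_add[OF m] means_add[OF n] means_scale[OF m] means_scale[OF n]
          means_one[OF m] means_one[OF n] means_outside[OF m] means_outside[OF n] algebra_simps
          intro!: add_nonneg_nonneg mult_nonneg_nonneg means_nonneg[OF m] means_nonneg[OF n])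
  qed
  obtain x0 where x0: "x0 \<in> topspace T" using neT by blast
  have ne: "means \<noteq> {}"
  proof -
    have "(\<lambda>\<phi>. if \<phi> \<in> Cont then \<phi> x0 else 0) \<in> means"
      unfolding means_def using Cont_intros x0 by auto
    then show ?thesis by blast
  qed
  have nonexp: "p (translate s m - translate s n) \<le> p (m - n)"
    if p: "p \<in> Q" and m: "m \<in> means" and n: "n \<in> means" for p s m n
  proof -
    have mn: "translate s m \<in> means" "translate s n \<in> means" using translate_means m n by auto
    consider \<phi> where "\<phi> \<in> Cont" "p = q \<phi>"
      | l where "p = (\<lambda>m. \<bar>l (m - g m)\<bar>)" "linear (l :: _ \<Rightarrow> real)"
      using p by (auto simp: Q_def)
    then show ?thesis
    proof cases
      case 1
      have "q \<phi> (translate s m - translate s n) \<le> q \<phi> (m - n)"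
      proof (rule q_le)
        fix \<psi> assume \<psi>: "\<psi> \<in> orbit \<phi>"
        \<comment> \<open>\<open>t\<close> is \<open>s\<close> if \<open>\<psi>\<close> is
          \<open>\<phi>\<close>, and \<open>t' * s\<close> if \<open>\<psi>\<close> is the translate
          of \<open>\<phi>\<close> by \<open>t'\<close>. The equality holds only on the phase space,
          hence the appeal to \<open>means_cong\<close>.\<close>
        obtain t where t: "\<And>x. x \<in> topspace T \<Longrightarrow> \<psi> (act s x) = \<phi> (act t x)"
          using \<psi> act_act by (auto simp: orbit_def)
        have C: "\<psi> \<in> Cont" "(\<lambda>x. \<psi> (act s x)) \<in> Cont" "(\<lambda>x. \<phi> (act t x)) \<in> Cont"
          using orbit_Cont[OF 1(1) \<psi>] Cont_act 1(1) by auto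
        have "translate s k \<psi> = k (\<lambda>x. \<phi> (act t x))" if "k \<in> means" for k
          using means_cong[OF that C(2,3)] t C(1) by (simp add: translate_def)
        then have "g (translate s m - translate s n) \<psi> = g (m - n) (\<lambda>x. \<phi> (act t x))"
          using g_diff[OF mn] g_diff[OF m n] m n by simp
        also have "\<bar>\<dots>\<bar> \<le> q \<phi> (m - n)"
          by (rule q_ge[OF 1(1)]) (auto simp: orbit_def)
        finally show "\<bar>g (translate s m - translate s n) \<psi>\<bar> \<le> q \<phi> (m - n)" .
      qed
      then show ?thesis using 1(2) by simp
    next
      case 2
      then show ?thesis using g_diff[OF mn] g_diff[OF m n] by (simp add: linear_0)
    qed
  qed
  have "dynamical_system (subtopology \<sigma> means) translate"
    unfolding dynamical_system_def
  proof (intro conjI allI ballI)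
    fix s t m assume "m \<in> topspace (subtopology \<sigma> means)"
    then have m: "m \<in> means" by simp
    show "translate s (translate t m) = translate (s * t) m"
    proof
      fix \<phi>
      show "translate s (translate t m) \<phi> = translate (s * t) m \<phi>"
      proof (cases "\<phi> \<in> Cont")
        case True
        have "m (\<lambda>x. \<phi> (act s (act t x))) = m (\<lambda>x. \<phi> (act (s * t) x))"
          using Cont_act[OF Cont_act[OF True]] Cont_act[OF True] act_act by (intro means_cong[OF m]) auto
        then show ?thesis using True Cont_act[OF True] by (simp add: translate_def)
      qed (simp add: translate_def)
    qed
  next
    fix m assume "m \<in> topspace (subtopology \<sigma> means)"
    then have m: "m \<in> means" by simp
    have "continuous_on UNIV (\<lambda>s. translate s m \<phi>)" for \<phi>
    proof (cases "\<phi> \<in> Cont")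
      case True
      \<comment> \<open>Separate continuity gives convergence of \<open>\<phi> (act s x)\<close>
        only pointwise in \<open>x\<close>; the finite net makes it uniform, so that
        \<open>means_close\<close> applies.\<close>
      have "isCont (\<lambda>s. translate s m \<phi>) s0" for s0
        unfolding isCont_def tendsto_iff
      proof (intro allI impI)
        fix e :: real assume "e > 0"
        then have e: "e / 4 > 0" by simp
        obtain X where X: "finite X" "X \<subseteq> topspace T"
          "\<And>z. z \<in> topspace T \<Longrightarrow> \<exists>x\<in>X. \<bar>\<phi> z - \<phi> x\<bar> < e / 4 \<and> (\<forall>s. \<bar>\<phi> (act s z) - \<phi> (act s x)\<bar> < e / 4)"
          using equicontinuous_orbits_net[OF coT _ _ e, of \<phi> act] equi[of \<phi>] True unfolding Cont_def by blast
        have "\<forall>\<^sub>F s in at s0. \<bar>\<phi> (act s x) - \<phi> (act s0 x)\<bar> < e / 4" if x: "x \<in> X" for x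
        proof -
          have "continuous_map euclidean T (\<lambda>s. act s x)" using dyn x X(2) by (auto simp: dynamical_system_def)
          from continuous_map_compose[OF this, of euclideanreal \<phi>] True
          have "continuous_on UNIV (\<lambda>s. \<phi> (act s x))" by (simp add: Cont_def o_def)
          then have "((\<lambda>s. \<phi> (act s x)) \<longlongrightarrow> \<phi> (act s0 x)) (at s0)"
            by (simp add: continuous_on_eq_continuous_at isCont_def)
          then show ?thesis using e unfolding tendsto_iff dist_real_def by blast
        qed
        then have "\<forall>\<^sub>F s in at s0. \<forall>x\<in>X. \<bar>\<phi> (act s x) - \<phi> (act s0 x)\<bar> < e / 4"
          using X(1) by (simp add: eventually_ball_finite)
        then show "\<forall>\<^sub>F s in at s0. dist (translate s m \<phi>) (translate s0 m \<phi>) < e"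
        proof eventually_elim
          case (elim s)
          have "\<bar>m (\<lambda>x. \<phi> (act s x)) - m (\<lambda>x. \<phi> (act s0 x))\<bar> \<le> 3 * (e / 4)"
          proof (rule means_close[OF m Cont_act[OF True] Cont_act[OF True]])
            fix z assume "z \<in> topspace T"
            then obtain x where "x \<in> X" "\<forall>s. \<bar>\<phi> (act s z) - \<phi> (act s x)\<bar> < e / 4" using X(3) by blast
            then have "\<bar>\<phi> (act s z) - \<phi> (act s x)\<bar> < e / 4" "\<bar>\<phi> (act s0 z) - \<phi> (act s0 x)\<bar> < e / 4"
              "\<bar>\<phi> (act s x) - \<phi> (act s0 x)\<bar> < e / 4" using elim by auto
            then show "\<bar>\<phi> (act s z) - \<phi> (act s0 z)\<bar> \<le> 3 * (e / 4)" by linarith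
          qed
          then show ?case using True \<open>e > 0\<close> by (simp add: translate_def dist_real_def)
        qed
      qed
      then show ?thesis by (simp add: continuous_on_eq_continuous_at)
    qed (simp add: translate_def)
    then have "continuous_map euclidean (product_topology (\<lambda>_. euclideanreal) UNIV) (\<lambda>s. translate s m)"
      by (simp add: continuous_map_componentwise_UNIV)
    then have "continuous_map euclidean (top_of_set means) (\<lambda>s. translate s m)"
      using translate_means[OF m] by (simp add: euclidean_product_topology continuous_map_in_subtopology)
    from continuous_map_compose[OF this id_cont]
    have "continuous_map euclidean \<sigma> (\<lambda>s. translate s m)" by (simp add: o_def)
    then show "continuous_map euclidean (subtopology \<sigma> means) (\<lambda>s. translate s m)"
      using translate_means[OF m] by (simp add: continuous_map_in_subtopology)
  next
    fix s
    show "continuous_map (subtopology \<sigma> means) (subtopology \<sigma> means) (translate s)"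
      using det translate_means nonexp by (intro continuous_map_nonexpansive) auto
  qed
  then have "hypotheses_of FP_D \<sigma> Q means translate"
    using lc det ne conv nonexp compact by (simp add: hypotheses_of_def nonexpansive_action_def)
  then have "fixed_points means translate \<noteq> {}"
    using fpp by (simp add: has_fixed_point_property_def)
  then obtain m where m: "m \<in> means" "\<And>s. translate s m = m" by (auto simp: fixed_points_def)
  have "m (\<lambda>x. \<phi> (act s x)) = m \<phi>" if "\<phi> \<in> Cont" for \<phi> s
    using fun_cong[OF m(2)[of s], of \<phi>] that by (simp add: translate_def)
  then show thesis using m(1) that by blast
qed

text \<open>The witness is the support of an invariant mean.\<close>

lemma invariant_closed_set:
  assumes haT: "Hausdorff_space T"
    and fpp: "has_fixed_point_property FP_D TYPE('s) TYPE(('x \<Rightarrow> real) \<Rightarrow> real)"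
  obtains A where "closedin T A" "A \<noteq> {}" "\<And>s. act s ` A = A"
proof -
  obtain m where m: "m \<in> means" and inv: "\<And>\<phi> s. \<phi> \<in> Cont \<Longrightarrow> m (\<lambda>x. \<phi> (act s x)) = m \<phi>"
    using invariant_mean_exists[OF fpp] by blast
  define pos where "pos \<phi> \<longleftrightarrow> \<phi> \<in> Cont \<and> (\<forall>x\<in>topspace T. 0 \<le> \<phi> x)" for \<phi>
  define A where "A = {x \<in> topspace T. \<forall>\<phi>. pos \<phi> \<and> \<phi> x > 0 \<longrightarrow> m \<phi> > 0}"
  \<comment> \<open>Near each point some nonnegative function of mean zero dominates
    \<open>\<psi>\<close> up to \<open>e\<close>; by compactness a finite sum of such functions does
    so everywhere.\<close>
  have null: "m \<psi> = 0" if \<psi>: "pos \<psi>" "\<And>x. x \<in> A \<Longrightarrow> \<psi> x = 0" for \<psi>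
  proof -
    have "m \<psi> \<le> e" if e: "e > 0" for e
    proof -
      define N where "N = {\<phi>. pos \<phi> \<and> m \<phi> = 0}"
      define O' where "O' \<phi> = {x \<in> topspace T. \<psi> x - \<phi> x \<in> {..<e}}" for \<phi>
      have N_cont: "\<phi> \<in> Cont" if "\<phi> \<in> N" for \<phi> using that by (simp add: N_def pos_def)
      have op: "openin T (O' \<phi>)" if "\<phi> \<in> N" for \<phi>
        unfolding O'_def using N_cont[OF that] \<psi>(1)
        by (intro openin_continuous_map_preimage[of T euclideanreal] continuous_map_diff)
          (auto simp: Cont_def pos_def)
      have cov: "\<exists>\<phi>\<in>N. x \<in> O' \<phi>" if x: "x \<in> topspace T" for x
      proof (cases "x \<in> A")
        case True
        have "m (\<lambda>x. 0) = 0" using m by (rule means_zero)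
        then have "(\<lambda>x. 0) \<in> N" by (auto simp: N_def pos_def Cont_intros)
        then show ?thesis using \<psi>(2)[OF True] e x by (intro bexI[of _ "\<lambda>x. 0"]) (auto simp: O'_def)
      next
        case False
        then obtain \<phi> where \<phi>: "pos \<phi>" "\<phi> x > 0" "\<not> m \<phi> > 0" using x by (auto simp: A_def)
        have "m \<phi> = 0" using \<phi>(1,3) means_nonneg[OF m, of \<phi>] by (auto simp: pos_def)
        \<comment> \<open>Scaling \<open>\<phi>\<close> to the value \<open>\<psi> x\<close> at
          \<open>x\<close> makes it dominate \<open>\<psi>\<close> up to \<open>e\<close> near
          \<open>x\<close>.\<close>
        define c where "c = \<psi> x / \<phi> x"
        have "c \<ge> 0" using \<psi>(1) \<phi>(2) x by (simp add: c_def pos_def)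
        then have "(\<lambda>x. c * \<phi> x) \<in> N"
          using \<phi>(1) \<open>m \<phi> = 0\<close> means_scale[OF m, of \<phi> c] by (auto simp: N_def pos_def Cont_intros)
        moreover have "c * \<phi> x = \<psi> x" using \<phi>(2) by (simp add: c_def)
        ultimately show ?thesis using e x by (intro bexI[of _ "\<lambda>x. c * \<phi> x"]) (auto simp: O'_def)
      qed
      have "\<exists>\<F>. finite \<F> \<and> \<F> \<subseteq> O' ` N \<and> topspace T \<subseteq> \<Union>\<F>"
        using coT op cov unfolding compact_space_def by (intro compactinD) auto
      then obtain P where P: "finite P" "P \<subseteq> N" "topspace T \<subseteq> \<Union> (O' ` P)" by (metis finite_subset_image)
      have sum: "(\<lambda>x. \<Sum>\<phi>\<in>P. \<phi> x) \<in> N" using P(1,2)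
      proof (induction P rule: finite_induct)
        case empty
        have "m (\<lambda>x. 0) = 0" using m by (rule means_zero)
        then show ?case by (auto simp: N_def pos_def Cont_intros)
      next
        case (insert \<phi> P)
        then have "\<phi> \<in> N" "(\<lambda>x. \<Sum>\<phi>\<in>P. \<phi> x) \<in> N" by auto
        then show ?case
          using means_add[OF m, of \<phi> "\<lambda>x. \<Sum>\<phi>\<in>P. \<phi> x"] insert(1,2)
          by (auto simp: N_def pos_def Cont_intros)
      qed
      have "\<psi> x \<le> (\<Sum>\<phi>\<in>P. \<phi> x) + e * 1" if x: "x \<in> topspace T" for x
      proof -
        obtain \<phi> where \<phi>: "\<phi> \<in> P" "x \<in> O' \<phi>" using P(3) x by blast
        have "\<phi> x \<le> (\<Sum>\<phi>\<in>P. \<phi> x)"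
          using \<phi>(1) P(1,2) x by (intro member_le_sum) (auto simp: N_def pos_def)
        then show ?thesis using \<phi>(2) by (simp add: O'_def)
      qed
      then have "m \<psi> \<le> m (\<lambda>x. (\<Sum>\<phi>\<in>P. \<phi> x) + e * 1)"
        using \<psi>(1) N_cont[OF sum] by (intro means_mono[OF m] Cont_intros) (auto simp: pos_def)
      also have "\<dots> = m (\<lambda>x. \<Sum>\<phi>\<in>P. \<phi> x) + e"
        using means_add[OF m N_cont[OF sum] Cont_intros(3)[OF Cont_intros(1)], of e 1]
          means_scale[OF m Cont_intros(1), of e 1] means_one[OF m] by simp
      finally show ?thesis using sum by (simp add: N_def)
    qed
    then have "m \<psi> \<le> 0" by (meson dense not_less)
    moreover have "0 \<le> m \<psi>" using \<psi>(1) means_nonneg[OF m, of \<psi>] by (simp add: pos_def)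
    ultimately show ?thesis by simp
  qed
  have AT: "A \<subseteq> topspace T" by (auto simp: A_def)
  have "A \<noteq> {}" using null[of "\<lambda>x. 1"] means_one[OF m] by (auto simp: pos_def Cont_intros)
  have clA: "closedin T A"
    unfolding closedin_def
  proof (intro conjI AT)
    show "openin T (topspace T - A)"
    proof (subst openin_subopen, intro ballI)
      fix x assume x: "x \<in> topspace T - A"
      then obtain \<phi> where \<phi>: "pos \<phi>" "\<phi> x > 0" "\<not> m \<phi> > 0" by (auto simp: A_def)
      have "openin T {y \<in> topspace T. \<phi> y \<in> {0<..}}"
        using \<phi>(1) by (intro openin_continuous_map_preimage[of T euclideanreal]) (auto simp: pos_def Cont_def)
      then show "\<exists>U. openin T U \<and> x \<in> U \<and> U \<subseteq> topspace T - A"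
        using \<phi> x by (intro exI[of _ "{y \<in> topspace T. \<phi> y \<in> {0<..}}"]) (auto simp: A_def)
    qed
  qed
  have pos_act: "pos (\<lambda>x. \<phi> (act s x))" if "pos \<phi>" for \<phi> s
    using that Cont_act act_in by (auto simp: pos_def)
  have "act s ` A \<subseteq> A" for s
  proof
    fix y assume "y \<in> act s ` A"
    then obtain x where x: "x \<in> A" "y = act s x" by blast
    have "m \<phi> > 0" if \<phi>: "pos \<phi>" "\<phi> y > 0" for \<phi>
    proof -
      have "m (\<lambda>x. \<phi> (act s x)) > 0"
        using x pos_act[OF \<phi>(1), of s] \<phi>(2) unfolding A_def by blast
      then show ?thesis using inv \<phi>(1) by (simp add: pos_def)
    qed
    then show "y \<in> A" using x AT act_in by (auto simp: A_def)
  qed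
  moreover have "A \<subseteq> act s ` A" for s
  proof (rule ccontr)
    assume "\<not> A \<subseteq> act s ` A"
    then obtain y where y: "y \<in> A" "y \<notin> act s ` A" by blast
    have "compactin T A" using coT clA by (rule closedin_compact_space)
    moreover have "continuous_map T T (act s)" using dyn by (simp add: dynamical_system_def)
    ultimately have "compactin T (act s ` A)" by (rule image_compactin)
    then have cl: "closedin T (act s ` A)" using haT compactin_imp_closedin by blast
    \<comment> \<open>A nonnegative function that vanishes on the image of \<open>A\<close> and is
      positive at \<open>y\<close> has positive mean since \<open>y \<in> A\<close>; but its
      translate by \<open>s\<close> vanishes on \<open>A\<close> and so has mean zero, against
      invariance.\<close>
    have "completely_regular_space T"
      using compact_Hausdorff_or_regular_imp_normal_space coT haT Hausdorff_imp_t1_space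
        normal_imp_completely_regular_space by blast
    then obtain f where f: "continuous_map T (top_of_set {0..1}) f" "f y = (0::real)" "f ` (act s ` A) \<subseteq> {1}"
      using cl y AT unfolding completely_regular_space_def by blast
    define \<phi> where "\<phi> x = 1 + (- 1) * f x" for x
    have fC: "f \<in> Cont" "\<And>x. x \<in> topspace T \<Longrightarrow> f x \<in> {0..1}"
      using f(1) by (auto simp: Cont_def continuous_map_in_subtopology Pi_iff)
    have "\<phi> \<in> Cont" unfolding \<phi>_def[abs_def] by (intro Cont_intros fC(1))
    then have "pos \<phi>" using fC(2) by (auto simp: pos_def \<phi>_def)
    moreover have "\<phi> y > 0" using f(2) by (simp add: \<phi>_def)
    ultimately have "m \<phi> > 0" using y(1) by (auto simp: A_def)
    moreover have "m (\<lambda>x. \<phi> (act s x)) = 0"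
      using f(3) by (intro null pos_act[OF \<open>pos \<phi>\<close>]) (auto simp: \<phi>_def)
    ultimately show False using inv \<open>pos \<phi>\<close> by (simp add: pos_def)
  qed
  ultimately show thesis using that[OF clA \<open>A \<noteq> {}\<close>] by (meson subset_antisym)
qed

end

section \<open>Fixed points of weakly equicontinuous actions\<close>

text \<open>Exhibits the weak topology as one determined by seminorms, so that the neighbourhood
  arguments for \<open>determines\<close> apply to it as well.\<close>

lemma weak_topology_eq_seminorm_topology:
  "weak_topology \<tau> = seminorm_topology {\<lambda>x. \<bar>f x\<bar> | f. linear f \<and> continuous_map \<tau> euclideanreal f}"
proof -
  define Q where "Q = {\<lambda>x. \<bar>f x\<bar> | f. linear f \<and> continuous_map \<tau> euclideanreal f}"
  define \<sigma> where "\<sigma> = seminorm_topology Q"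
  have det: "determines Q \<sigma>"
    unfolding \<sigma>_def by (rule determines_seminorm_topology) (auto simp: Q_def seminorm_abs_linear)
  have "continuous_map (weak_topology \<tau>) \<sigma> (\<lambda>x. x)"
  proof (rule continuous_map_into_determined_distance[OF det])
    fix p a assume "p \<in> Q"
    then obtain f where f: "linear f" "continuous_map \<tau> euclideanreal f" "p = (\<lambda>x. \<bar>f x\<bar>)"
      by (auto simp: Q_def)
    have "continuous_map (weak_topology \<tau>) euclideanreal (\<lambda>x. \<bar>f x - f a\<bar>)"
      using weak_topology_functional[OF f(1,2)] by (intro continuous_map_real_abs continuous_map_diff) auto
    then show "continuous_map (weak_topology \<tau>) euclideanreal (\<lambda>x. p (x - a))"
      by (simp add: f(3) linear_diff[OF f(1)])
  qed
  moreover have "continuous_map \<sigma> (weak_topology \<tau>) (\<lambda>x. x)"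
  proof (rule continuous_map_into_weak_topology)
    fix f assume f: "linear f" "continuous_map \<tau> euclideanreal f"
    then have "(\<lambda>x. \<bar>f x\<bar>) \<in> Q" by (auto simp: Q_def)
    then show "continuous_map \<sigma> euclideanreal f"
      using f(1) by (rule determines_dominated_functional[OF det]) simp
  qed
  ultimately have "openin \<sigma> U = openin (weak_topology \<tau>) U" for U
    using openin_continuous_map_preimage[of \<sigma> "weak_topology \<tau>" "\<lambda>x. x" U]
      openin_continuous_map_preimage[of "weak_topology \<tau>" \<sigma> "\<lambda>x. x" U]
      determines_topspace[OF det] weak_topology_topspace[of \<tau>] by auto
  then show ?thesis unfolding \<sigma>_def Q_def by (simp add: topology_eq)
qed

lemma weak_topology_determined:
  obtains Q where "determines Q (weak_topology \<tau>)"
proof -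
  have "determines {\<lambda>x. \<bar>f x\<bar> | f. linear f \<and> continuous_map \<tau> euclideanreal f} (weak_topology \<tau>)"
    unfolding weak_topology_eq_seminorm_topology
    by (rule determines_seminorm_topology) (auto simp: seminorm_abs_linear)
  then show thesis by (rule that)
qed

text \<open>Heine-Cantor for the translation-invariant uniformity: the cover uses neighbourhoods of
  half the size, and the other half absorbs the displacement \<open>x - y\<close>.\<close>

lemma continuous_imp_uniformly_continuous:
  assumes det: "determines Q \<sigma>" and K: "compactin \<sigma> K"
    and \<phi>: "continuous_map (subtopology \<sigma> K) euclideanreal \<phi>" and e: "e > 0"
  obtains V where "openin \<sigma> V" "0 \<in> V" "\<And>x y. x \<in> K \<Longrightarrow> y \<in> K \<Longrightarrow> x - y \<in> V \<Longrightarrow> \<bar>\<phi> x - \<phi> y\<bar> < e"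
proof -
  have sn: "seminorm p" if "p \<in> Q" for p using det that by (rule determines_seminorm)
  have "\<exists>F d. finite F \<and> F \<subseteq> Q \<and> d > 0 \<and> (\<forall>y\<in>K. (\<forall>p\<in>F. p (y - x) < d) \<longrightarrow> \<bar>\<phi> y - \<phi> x\<bar> < e / 2)"
    if x: "x \<in> K" for x
  proof -
    have "openin (subtopology \<sigma> K) {y \<in> topspace (subtopology \<sigma> K). \<phi> y \<in> ball (\<phi> x) (e / 2)}"
      using \<phi> by (rule openin_continuous_map_preimage) simp
    then obtain O' where O': "openin \<sigma> O'" "{y \<in> topspace (subtopology \<sigma> K). \<phi> y \<in> ball (\<phi> x) (e / 2)} = O' \<inter> K"
      unfolding openin_subtopology by (elim exE conjE) (rule that)
    have top: "topspace (subtopology \<sigma> K) = K" using determines_topspace[OF det] by simp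
    note O' = O'(1) O'(2)[unfolded top, symmetric]
    have "x \<in> {y \<in> K. \<phi> y \<in> ball (\<phi> x) (e / 2)}" using x e by simp
    then have "x \<in> O'" unfolding O'(2)[symmetric] by (rule IntD1)
    obtain F d where F: "finite F" "F \<subseteq> Q" "d > 0" "{y. \<forall>p\<in>F. p (y - x) < d} \<subseteq> O'"
      by (rule determines_neighbourhood[OF det O'(1) \<open>x \<in> O'\<close>])
    have "\<bar>\<phi> y - \<phi> x\<bar> < e / 2" if y: "y \<in> K" "\<forall>p\<in>F. p (y - x) < d" for y
    proof -
      have "y \<in> {y. \<forall>p\<in>F. p (y - x) < d}" using y(2) by simp
      then have "y \<in> O'" using F(4) by (rule subsetD[rotated])
      then have "y \<in> O' \<inter> K" using y(1) by (rule IntI)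
      then have "y \<in> {y \<in> K. \<phi> y \<in> ball (\<phi> x) (e / 2)}" unfolding O'(2) .
      then show ?thesis by (simp add: dist_real_def abs_minus_commute)
    qed
    then show ?thesis using F(1-3) by (intro exI[of _ F] exI[of _ d]) simp
  qed
  then have ex: "\<forall>x\<in>K. \<exists>F d. finite F \<and> F \<subseteq> Q \<and> d > 0 \<and>
      (\<forall>y\<in>K. (\<forall>p\<in>F. p (y - x) < d) \<longrightarrow> \<bar>\<phi> y - \<phi> x\<bar> < e / 2)"
    by (rule ballI)
  from bchoice[OF ex] obtain F where F0: "\<forall>x\<in>K. \<exists>d. finite (F x) \<and> F x \<subseteq> Q \<and> d > 0 \<and>
      (\<forall>y\<in>K. (\<forall>p\<in>F x. p (y - x) < d) \<longrightarrow> \<bar>\<phi> y - \<phi> x\<bar> < e / 2)" by (elim exE) (rule that)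
  from bchoice[OF F0] obtain d where d0: "\<forall>x\<in>K. finite (F x) \<and> F x \<subseteq> Q \<and> d x > 0 \<and>
      (\<forall>y\<in>K. (\<forall>p\<in>F x. p (y - x) < d x) \<longrightarrow> \<bar>\<phi> y - \<phi> x\<bar> < e / 2)" by (elim exE) (rule that)
  have F: "finite (F x)" "F x \<subseteq> Q" "d x > 0" if "x \<in> K" for x using bspec[OF d0 that] by simp_all
  have close: "\<bar>\<phi> y - \<phi> x\<bar> < e / 2" if "x \<in> K" "y \<in> K" "\<And>p. p \<in> F x \<Longrightarrow> p (y - x) < d x" for x y
    using bspec[OF d0 that(1)] that(2,3) by simp
  define N where "N x = {y. \<forall>p\<in>F x. p (y - x) < d x / 2}" for x
  have "\<exists>\<F>. finite \<F> \<and> \<F> \<subseteq> N ` K \<and> K \<subseteq> \<Union>\<F>"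
  proof (rule compactinD[OF K])
    have "openin \<sigma> (N x)" if "x \<in> K" for x
      unfolding N_def using det F(1,2)[OF that] by (rule determines_basic_open)
    then show "openin \<sigma> U" if "U \<in> N ` K" for U using that by blast
    have "x \<in> N x" if x: "x \<in> K" for x
    proof -
      have "p (x - x) < d x / 2" if "p \<in> F x" for p
        using seminorm_zero[OF sn, of p] that F(2,3)[OF x] by auto
      then show ?thesis by (simp add: N_def)
    qed
    then show "K \<subseteq> \<Union> (N ` K)" by blast
  qed
  then obtain X where X: "finite X" "X \<subseteq> K" "K \<subseteq> \<Union> (N ` X)" by (metis finite_subset_image)
  define G where "G = \<Union> (F ` X)"
  define r where "r = Min (insert 1 ((\<lambda>x. d x / 2) ` X))"
  have "finite G" unfolding G_def using X(1,2) F(1) by (intro finite_Union) auto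
  moreover have "G \<subseteq> Q" unfolding G_def using X(2) F(2) by blast
  ultimately have G: "finite G" "G \<subseteq> Q" .
  have r: "r > 0" using X F(3) by (auto simp: r_def)
  have r_le: "r \<le> d x / 2" if "x \<in> X" for x
    unfolding r_def using X(1) that by (intro Min_le) auto
  define V where "V = {y. \<forall>p\<in>G. p (y - 0) < r}"
  have "openin \<sigma> V" unfolding V_def using det G by (rule determines_basic_open)
  moreover have "p (0 - 0) < r" if "p \<in> G" for p
    using seminorm_zero[OF sn, of p] that G(2) r by auto
  then have "0 \<in> V" by (simp add: V_def)
  moreover have "\<bar>\<phi> x - \<phi> y\<bar> < e" if x: "x \<in> K" and y: "y \<in> K" and xy: "x - y \<in> V" for x y
  proof -
    obtain a where a: "a \<in> X" "y \<in> N a" using X(3) y by blast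
    have aK: "a \<in> K" using a X by blast
    have ya: "p (y - a) < d a / 2" if "p \<in> F a" for p using a(2) that by (simp add: N_def)
    have xa: "p (x - a) < d a" if p: "p \<in> F a" for p
    proof -
      have "p \<in> G" using p a by (auto simp: G_def)
      then have "p (x - y) < r" using xy by (auto simp: V_def)
      then show ?thesis
        using seminorm_triangle[OF sn, of p x a y] ya[OF p] r_le[OF a(1)] \<open>p \<in> G\<close> G(2) by fastforce
    qed
    have "\<bar>\<phi> x - \<phi> a\<bar> < e / 2" using close[OF aK x] xa by blast
    moreover have "\<bar>\<phi> y - \<phi> a\<bar> < e / 2"
    proof (rule close[OF aK y])
      fix p assume "p \<in> F a"
      then show "p (y - a) < d a" using ya[of p] F(3)[OF aK] by linarith
    qed
    ultimately show ?thesis by linarith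
  qed
  ultimately show thesis using that by blast
qed

text \<open>\<open>\<phi>\<close> is merely continuous, not linear, so it takes uniform continuity
  on \<open>K\<close> to convert \<open>f y - f x \<in> V\<close> into closeness of values.\<close>

lemma equicontinuous_family_orbits:
  assumes K: "compactin (weak_topology \<tau>) K" and inv: "\<And>s x. x \<in> K \<Longrightarrow> act s x \<in> K"
    and equi: "equicontinuous_family (weak_topology \<tau>) K (range act)"
    and \<phi>: "continuous_map (weak_on \<tau> K) euclideanreal \<phi>"
  shows "equicontinuous_orbits (weak_on \<tau> K) act \<phi>"
  unfolding equicontinuous_orbits_def
proof (intro ballI allI impI)
  fix x and e :: real assume "x \<in> topspace (weak_on \<tau> K)" and e: "e > 0"
  then have x: "x \<in> K" by simp
  obtain Q where det: "determines Q (weak_topology \<tau>)" by (rule weak_topology_determined)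
  obtain V where V: "openin (weak_topology \<tau>) V" "0 \<in> V"
    "\<And>x y. x \<in> K \<Longrightarrow> y \<in> K \<Longrightarrow> x - y \<in> V \<Longrightarrow> \<bar>\<phi> x - \<phi> y\<bar> < e"
    using continuous_imp_uniformly_continuous[OF det K \<phi> e] by blast
  obtain W where W: "openin (weak_topology \<tau>) W" "x \<in> W" "\<forall>y\<in>K \<inter> W. \<forall>f\<in>range act. f y - f x \<in> V"
    using equi x V(1,2) unfolding equicontinuous_family_def by meson
  have "openin (weak_on \<tau> K) (K \<inter> W)" using W(1) by (simp add: openin_subtopology_Int2)
  moreover have "\<bar>\<phi> (act s y) - \<phi> (act s x)\<bar> < e" if "y \<in> K \<inter> W" for y s
    using V(3) W(3) that inv x by auto
  ultimately show "\<exists>W. openin (weak_on \<tau> K) W \<and> x \<in> W \<and> (\<forall>y\<in>W. \<forall>s. \<bar>\<phi> (act s y) - \<phi> (act s x)\<bar> < e)"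
    using W(2) x by (intro exI[of _ "K \<inter> W"]) auto
qed

text \<open>The exponent is a successor because the identity need not be a translation.\<close>

lemma act_funpow:
  assumes dyn: "dynamical_system T act"
  obtains t where "\<And>x. x \<in> topspace T \<Longrightarrow> (act s ^^ Suc n) x = act t x"
proof -
  have "\<exists>t. \<forall>x\<in>topspace T. (act s ^^ Suc n) x = act t x"
  proof (induction n)
    case (Suc n)
    then obtain t where t: "\<forall>x\<in>topspace T. (act s ^^ Suc n) x = act t x" by blast
    have "(act s ^^ Suc (Suc n)) x = act (s * t) x" if "x \<in> topspace T" for x
      using t dyn that by (simp add: dynamical_system_def)
    then show ?case by blast
  qed auto
  then show thesis using that by blast
qed

text \<open>Two points of a backward orbit are close in every coordinate; equicontinuity pushes this
  forward to a return of the orbit to its starting point.\<close>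

lemma recurrence:
  assumes co: "compact_space T" and dyn: "dynamical_system T act"
    and \<phi>: "continuous_map T euclideanreal \<phi>" and equi: "equicontinuous_orbits T act \<phi>"
    and A: "A \<subseteq> topspace T" "act s ` A = A" and xy: "x \<in> A" "y \<in> A" and e: "e > 0"
  obtains n where "\<bar>\<phi> ((act s ^^ Suc n) x) - \<phi> x\<bar> < e" "\<bar>\<phi> ((act s ^^ Suc n) y) - \<phi> y\<bar> < e"
proof -
  have backward: "\<exists>b. \<forall>n. b n \<in> A \<and> (act s ^^ n) (b n) = x"
    if "x \<in> A" for x
  proof -
    \<comment> \<open>The clause for \<open>n = 0\<close> fixes the starting point of the backward
      orbit, which dependent choice would otherwise leave open.\<close>
    have "\<exists>b. \<forall>n. (b n \<in> A \<and> (n = 0 \<longrightarrow> b n = x)) \<and> act s (b (Suc n)) = b n"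
    proof (rule dependent_nat_choice)
      fix z and n :: nat assume "z \<in> A \<and> (n = 0 \<longrightarrow> z = x)"
      then have "z \<in> act s ` A" using A(2) by simp
      then show "\<exists>w. (w \<in> A \<and> (Suc n = 0 \<longrightarrow> w = x)) \<and> act s w = z" by auto
    qed (use that in auto)
    then obtain b where b: "\<And>n. b n \<in> A" "b 0 = x" "\<And>n. act s (b (Suc n)) = b n" by blast
    have "(act s ^^ n) (b n) = x" for n
      by (induction n) (simp_all add: funpow_swap1 b(2,3))
    then show ?thesis using b(1) by blast
  qed
  obtain b where b: "\<And>n. b n \<in> A" "\<And>n. (act s ^^ n) (b n) = x" using backward[OF xy(1)] by blast
  obtain c where c: "\<And>n. c n \<in> A" "\<And>n. (act s ^^ n) (c n) = y" using backward[OF xy(2)] by blast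
  have e2: "e / 2 > 0" using e by simp
  obtain X where X: "finite X" "X \<subseteq> topspace T"
    "\<And>z. z \<in> topspace T \<Longrightarrow> \<exists>x\<in>X. \<bar>\<phi> z - \<phi> x\<bar> < e / 2 \<and> (\<forall>s. \<bar>\<phi> (act s z) - \<phi> (act s x)\<bar> < e / 2)"
    using equicontinuous_orbits_net[OF co \<phi> equi e2] by blast
  then obtain \<pi> where \<pi>: "\<And>z. z \<in> topspace T \<Longrightarrow> \<pi> z \<in> X"
    "\<And>z s. z \<in> topspace T \<Longrightarrow> \<bar>\<phi> (act s z) - \<phi> (act s (\<pi> z))\<bar> < e / 2" by metis
  \<comment> \<open>The pigeonhole principle is applied to pairs, so that one return time serves
    \<open>x\<close> and \<open>y\<close> simultaneously.\<close>
  have "\<not> inj (\<lambda>n. (\<pi> (b n), \<pi> (c n)))"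
  proof
    assume "inj (\<lambda>n. (\<pi> (b n), \<pi> (c n)))"
    moreover have "range (\<lambda>n. (\<pi> (b n), \<pi> (c n))) \<subseteq> X \<times> X" using \<pi>(1) b(1) c(1) A(1) by blast
    ultimately have "finite (UNIV :: nat set)" using X(1) by (meson finite_SigmaI finite_subset finite_imageD)
    then show False by simp
  qed
  then obtain k l where kl: "k < l" "\<pi> (b k) = \<pi> (b l)" "\<pi> (c k) = \<pi> (c l)"
    by (auto simp: inj_on_def) (metis linorder_neqE_nat)
  obtain l' where l': "l = Suc l'" using kl(1) by (cases l) auto
  obtain n where n: "l - k = Suc n" using kl(1) by (cases "l - k") auto
  obtain t where t: "\<And>x. x \<in> topspace T \<Longrightarrow> (act s ^^ l) x = act t x"
    using act_funpow[OF dyn, of l' s] unfolding l' by blast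
  have return: "\<bar>\<phi> ((act s ^^ Suc n) x) - \<phi> x\<bar> < e"
    if b: "\<And>n. b n \<in> A" "\<And>n. (act s ^^ n) (b n) = x" and \<pi>b: "\<pi> (b k) = \<pi> (b l)" for b x
  proof -
    have T: "b k \<in> topspace T" "b l \<in> topspace T" using b(1) A(1) by auto
    \<comment> \<open>The \<open>l\<close>-th power, a translation because \<open>l > 0\<close>,
      takes \<open>b l\<close> back to \<open>x\<close> but carries \<open>b k\<close> on to the
      \<open>(l - k)\<close>-th iterate of \<open>x\<close>.\<close>
    have "(act s ^^ l) (b k) = (act s ^^ (l - k)) ((act s ^^ k) (b k))"
      using fun_cong[OF funpow_add[of "l - k" k "act s"], of "b k"] kl(1) by simp
    then have "act t (b k) = (act s ^^ Suc n) x" using t[OF T(1)] b(2)[of k] n by simp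
    moreover have "act t (b l) = x" using t[OF T(2)] b(2)[of l] by simp
    ultimately show ?thesis
      using \<pi>(2)[OF T(1), of t] \<pi>(2)[OF T(2), of t] \<pi>b by (simp only:)
  qed
  show thesis
    by (rule that[of n]) (use return[OF b kl(2)] return[OF c kl(3)] in simp_all)
qed

text \<open>On a minimal closed convex invariant set \<open>C\<close>, a minimal closed invariant part \<open>B\<close> of a
  set that all translations map onto itself is totally bounded for every seminorm \<open>p\<close>: it is
  covered by isometric preimages of a relatively open set of small diameter. The points of \<open>C\<close>
  in the intersection of balls around \<open>B\<close> form an invariant set, so by minimality \<open>B\<close> is a
  single point.\<close>

lemma weakly_equicontinuous_fixed_point:
  fixes \<tau> :: "'x::real_vector topology" and act :: "'s::semitopological_semigroup \<Rightarrow> 'x \<Rightarrow> 'x"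
  assumes fpp: "has_fixed_point_property FP_D TYPE('s) TYPE(('x \<Rightarrow> real) \<Rightarrow> real)"
    and haus: "Hausdorff_space \<tau>" and det: "determines Q \<tau>"
    and K: "compactin (weak_topology \<tau>) K" and dyn: "dynamical_system (weak_on \<tau> K) act"
    and ne: "nonexpansive_action Q K act"
    and equi: "equicontinuous_family (weak_topology \<tau>) K (range act)"
    and C: "C \<noteq> {}" "closedin (weak_on \<tau> K) C" "convex C" "\<And>s x. x \<in> C \<Longrightarrow> act s x \<in> C"
  shows "\<exists>z\<in>C. \<forall>s. act s z = z"
proof -
  have sn: "seminorm p" if "p \<in> Q" for p using det that by (rule determines_seminorm)
  have haT: "Hausdorff_space (weak_topology \<tau>)" using det haus by (rule weak_topology_Hausdorff)
  have topK: "topspace (weak_on \<tau> K) = K" by (simp add: weak_topology_topspace)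
  have coK: "compact_space (weak_on \<tau> K)" using K by (rule compact_space_subtopology)
  define P where "P G \<longleftrightarrow> convex G \<and> (\<forall>s. \<forall>x\<in>G. act s x \<in> G)" for G
  obtain G where G: "closedin (weak_on \<tau> K) G" "G \<noteq> {}" "G \<subseteq> C" "P G"
    and Gmin: "\<And>H. closedin (weak_on \<tau> K) H \<Longrightarrow> H \<noteq> {} \<Longrightarrow> H \<subseteq> G \<Longrightarrow> P H \<Longrightarrow> H = G"
  proof (rule minimal_closed_set[OF coK C(2,1), of P])
    show "P C" using C(3,4) by (simp add: P_def)
    show "P (\<Inter>\<G>)" if "\<And>G. G \<in> \<G> \<Longrightarrow> closedin (weak_on \<tau> K) G \<and> P G" for \<G>
      unfolding P_def
    proof (intro conjI allI ballI)
      show "convex (\<Inter>\<G>)" using that by (intro convex_Inter) (simp add: P_def)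
      show "act s x \<in> \<Inter>\<G>" if "x \<in> \<Inter>\<G>" for s x
        using that \<open>\<And>G. G \<in> \<G> \<Longrightarrow> closedin (weak_on \<tau> K) G \<and> P G\<close> by (auto simp: P_def)
    qed
  qed blast
  have GK: "G \<subseteq> K" using closedin_subset[OF G(1)] topK by simp
  have invG: "act s x \<in> G" if "x \<in> G" for s x using G(4) that by (simp add: P_def)
  define T where "T = weak_on \<tau> G"
  have topT: "topspace T = G" by (simp add: T_def weak_topology_topspace)
  have subT: "T = subtopology (weak_on \<tau> K) G"
    using GK by (simp add: T_def subtopology_subtopology Int_absorb1)
  have coG: "compactin (weak_topology \<tau>) G"
    using closedin_compact_space[OF coK G(1)] by (simp add: compactin_subtopology)
  have coT: "compact_space T" unfolding T_def using coG by (rule compact_space_subtopology)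
  have haT: "Hausdorff_space T" unfolding T_def using haT by (rule Hausdorff_space_subtopology)
  have dynT: "dynamical_system T act"
    using dyn GK invG unfolding dynamical_system_def topT topK subT
    by (auto simp: continuous_map_in_subtopology intro: continuous_map_from_subtopology)
  have neG: "p (act s x - act s y) \<le> p (x - y)" if "p \<in> Q" "x \<in> G" "y \<in> G" for p s x y
    using ne[unfolded nonexpansive_action_def] that GK by blast
  have eqG: "equicontinuous_family (weak_topology \<tau>) G (range act)"
    unfolding equicontinuous_family_def
  proof (intro ballI allI impI)
    fix x V assume x: "x \<in> G" and V: "openin (weak_topology \<tau>) V \<and> 0 \<in> V"
    have "x \<in> K" using x GK by blast
    from equi[unfolded equicontinuous_family_def, rule_format, OF this V]
    obtain W where W: "openin (weak_topology \<tau>) W" "x \<in> W" "\<forall>y\<in>K \<inter> W. \<forall>f\<in>range act. f y - f x \<in> V"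
      by (elim exE conjE) (rule that)
    have "\<forall>y\<in>G \<inter> W. \<forall>f\<in>range act. f y - f x \<in> V" using W(3) GK by (intro ballI) blast
    then show "\<exists>W. openin (weak_topology \<tau>) W \<and> x \<in> W \<and> (\<forall>y\<in>G \<inter> W. \<forall>f\<in>range act. f y - f x \<in> V)"
      using W(1,2) by (intro exI[of _ W] conjI)
  qed
  have equiT: "equicontinuous_orbits T act \<phi>" if "continuous_map T euclideanreal \<phi>" for \<phi>
    unfolding T_def
    by (rule equicontinuous_family_orbits[OF coG _ eqG]) (use invG that in \<open>auto simp: T_def\<close>)
  obtain A where A: "closedin T A" "A \<noteq> {}" "\<And>s. act s ` A = A"
    using invariant_closed_set[OF coT _ dynT equiT haT fpp] G(2) topT by blast
  have AG: "A \<subseteq> topspace T" using A(1) by (rule closedin_subset)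
  define I where "I B \<longleftrightarrow> (\<forall>s. \<forall>x\<in>B. act s x \<in> B)" for B
  obtain B where B: "closedin T B" "B \<noteq> {}" "B \<subseteq> A" "I B"
    and Bmin: "\<And>H. closedin T H \<Longrightarrow> H \<noteq> {} \<Longrightarrow> H \<subseteq> B \<Longrightarrow> I H \<Longrightarrow> H = B"
  proof (rule minimal_closed_set[OF coT A(1,2), of I])
    show "I A" using A(3) by (auto simp: I_def)
    show "I (\<Inter>\<G>)" if "\<And>G. G \<in> \<G> \<Longrightarrow> closedin T G \<and> I G" for \<G>
      using that by (auto simp: I_def)
  qed blast
  have BG: "B \<subseteq> G" using B(3) AG topT by simp
  have contT: "continuous_map T T (act s)" for s using dynT by (simp add: dynamical_system_def)
  have iso: "p (x - y) \<le> p (act s x - act s y)" if p: "p \<in> Q" and xy: "x \<in> A" "y \<in> A" for p s x y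
  proof (rule field_le_epsilon)
    fix e :: real assume "e > 0"
    then have e: "e / 2 > 0" by simp
    \<comment> \<open>A functional that attains \<open>p (x - y)\<close> detects the return: up to
      \<open>e\<close>, that distance is the difference of its values at a common return time, which
      is at most \<open>p (act s x - act s y)\<close> because the remaining iterates are
      nonexpansive.\<close>
    obtain f where f: "linear f" "continuous_map (weak_topology \<tau>) euclideanreal f"
      "\<And>x. \<bar>f x\<bar> \<le> p x" "f (x - y) = p (x - y)"
      using weak_supporting_functional[OF det p, of "x - y"] by blast
    have fT: "continuous_map T euclideanreal f"
      unfolding T_def using f(2) by (rule continuous_map_from_subtopology)
    obtain n where n: "\<bar>f ((act s ^^ Suc n) x) - f x\<bar> < e / 2" "\<bar>f ((act s ^^ Suc n) y) - f y\<bar> < e / 2"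
      using recurrence[OF coT dynT fT equiT[OF fT] AG A(3) xy e] by blast
    have inG: "(act s ^^ k) x \<in> G" if "x \<in> G" for k x using that invG by (induction k) auto
    have "p ((act s ^^ k) x - (act s ^^ k) y) \<le> p (x - y)" if "x \<in> G" "y \<in> G" for k x y
    proof (induction k)
      case (Suc k)
      show ?case using neG[OF p inG[OF that(1)] inG[OF that(2)], of s k k] Suc by simp
    qed simp
    from this[of "act s x" "act s y" n]
    have "p ((act s ^^ Suc n) x - (act s ^^ Suc n) y) \<le> p (act s x - act s y)"
      using xy AG topT invG by (auto simp: funpow_swap1)
    moreover have "f ((act s ^^ Suc n) x) - f ((act s ^^ Suc n) y) \<le> p ((act s ^^ Suc n) x - (act s ^^ Suc n) y)"
      using f(3) linear_diff[OF f(1)] by (metis abs_le_D1)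
    moreover have "p (x - y) = f x - f y" using f(4) linear_diff[OF f(1)] by simp
    ultimately show "p (x - y) \<le> p (act s x - act s y) + e" using n by linarith
  qed
  \<comment> \<open>The image of \<open>B\<close> need not be invariant when the semigroup is
    noncommutative, so minimality does not give this. Recurrence does: a point \<open>x\<close> of
    \<open>B\<close> outside the closed image would have to return close to itself, while all its
    later iterates stay in the image.\<close>
  have onto: "B \<subseteq> act s ` B" for s
  proof (rule ccontr)
    assume "\<not> B \<subseteq> act s ` B"
    then obtain x where x: "x \<in> B" "x \<notin> act s ` B" by blast
    have "compactin T (act s ` B)"
      using closedin_compact_space[OF coT B(1)] contT by (rule image_compactin)
    then have cl: "closedin T (act s ` B)" using haT compactin_imp_closedin by blast
    have "completely_regular_space T"
      using compact_Hausdorff_or_regular_imp_normal_space coT haT Hausdorff_imp_t1_space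
        normal_imp_completely_regular_space by blast
    then obtain f where f: "continuous_map T euclideanreal f" "f x = (0::real)" "f ` (act s ` B) \<subseteq> {1}"
      using cl x BG topT unfolding completely_regular_space_alt by (metis Diff_iff subsetD)
    have xA: "x \<in> A" using x B(3) by blast
    obtain n where n: "\<bar>f ((act s ^^ Suc n) x) - f x\<bar> < 1"
      using recurrence[OF coT dynT f(1) equiT[OF f(1)] AG A(3) xA xA zero_less_one] by blast
    have "(act s ^^ n) x \<in> B" using x(1) B(4) by (induction n) (auto simp: I_def)
    then have "f ((act s ^^ Suc n) x) = 1" using f(3) by auto
    then show False using n f(2) by simp
  qed
  have cover: "small_covers p B" if p: "p \<in> Q" for p
    unfolding small_covers_def
  proof (intro allI impI)
    fix e :: real assume e: "e > 0"
    have coB: "compactin T B" using coT B(1) by (rule closedin_compact_space)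
    then have "compactin (weak_topology \<tau>) B" by (simp add: T_def compactin_subtopology)
    then obtain U where U: "openin (weak_topology \<tau>) U" "U \<inter> B \<noteq> {}"
      "\<And>x y. x \<in> U \<inter> B \<Longrightarrow> y \<in> U \<inter> B \<Longrightarrow> p (x - y) \<le> e"
      using weakly_compact_fragmentable[OF det p _ B(2) e] by blast
    have UT: "openin T (G \<inter> U)" unfolding T_def using U(1) by (rule openin_subtopology_Int2)
    define W where "W s = {x \<in> topspace T. act s x \<in> G \<inter> U}" for s
    have W: "openin T (W s)" for s
      unfolding W_def using contT UT by (rule openin_continuous_map_preimage)
    have "\<exists>s. b \<in> W s" if b: "b \<in> B" for b
    proof -
      \<comment> \<open>By minimality the orbit of \<open>b\<close> is dense in \<open>B\<close>, so
        some translate of \<open>b\<close> falls into \<open>U\<close>.\<close>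
      define O' where "O' = range (\<lambda>s. act s b)"
      have OB: "O' \<subseteq> B" using B(4) b by (auto simp: O'_def I_def)
      have OT: "O' \<subseteq> topspace T" using OB BG topT by simp
      have "act t ` (T closure_of O') \<subseteq> T closure_of O'" for t
      proof -
        have "act t ` O' \<subseteq> O'"
          using dynT b BG topT by (auto simp: O'_def dynamical_system_def)
        then show ?thesis
          using continuous_map_image_closure_subset[OF contT, of t O'] closure_of_mono by (meson order_trans)
      qed
      then have "I (T closure_of O')" by (auto simp: I_def)
      moreover have "T closure_of O' \<noteq> {}"
        using closure_of_subset[OF OT] by (auto simp: O'_def)
      moreover have "T closure_of O' \<subseteq> B" using OB B(1) by (rule closure_of_minimal)
      ultimately have eq: "T closure_of O' = B" using Bmin closedin_closure_of by blast
      obtain x where x: "x \<in> U" "x \<in> T closure_of O'" using U(2) eq by blast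
      have "x \<in> G \<inter> U" using x eq BG by blast
      then have "\<exists>y\<in>O'. y \<in> G \<inter> U" using x(2) UT unfolding in_closure_of by blast
      then show ?thesis using b BG topT by (auto simp: O'_def W_def)
    qed
    then have "B \<subseteq> \<Union> (range W)" by blast
    moreover have "openin T V" if "V \<in> range W" for V using that W by blast
    ultimately obtain \<F> where \<F>: "finite \<F>" "\<F> \<subseteq> range W" "B \<subseteq> \<Union>\<F>"
      using compactinD[OF coB, of "range W"] by auto
    have "p (x - y) \<le> e" if V: "V \<in> \<F>" and xy: "x \<in> V \<inter> B" "y \<in> V \<inter> B" for V x y
    proof -
      obtain s where s: "V = W s" using V \<F>(2) by blast
      have "act s x \<in> U \<inter> B" "act s y \<in> U \<inter> B"
        using xy B(4) by (auto simp: s W_def I_def)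
      then have "p (act s x - act s y) \<le> e" by (rule U(3))
      moreover have "p (x - y) \<le> p (act s x - act s y)" using xy B(3) by (intro iso[OF p]) auto
      ultimately show ?thesis by simp
    qed
    then have "\<forall>V\<in>(\<lambda>V. V \<inter> B) ` \<F>. \<forall>x\<in>V. \<forall>y\<in>V. p (x - y) \<le> e" by auto
    then show "\<exists>\<A>. finite \<A> \<and> B \<subseteq> \<Union>\<A> \<and> (\<forall>B\<in>\<A>. \<forall>x\<in>B. \<forall>y\<in>B. p (x - y) \<le> e)"
      using \<F>(1,3) by (intro exI[of _ "(\<lambda>V. V \<inter> B) ` \<F>"] conjI) auto
  qed
  have dist0: "p (a - b) = 0" if p: "p \<in> Q" and ab: "a \<in> B" "b \<in> B" for p a b
  proof (rule ccontr)
    assume "p (a - b) \<noteq> 0"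
    obtain u r where u: "u \<in> convex hull B" "r < (SUP (x, y)\<in>B \<times> B. p (x - y))"
      "\<And>x. x \<in> B \<Longrightarrow> p (x - u) \<le> r"
      using small_covers_diameter_center[OF sn[OF p] cover[OF p] ab] \<open>p (a - b) \<noteq> 0\<close> by blast
    define H where "H = (\<Inter>x\<in>B. {v \<in> topspace (weak_on \<tau> K). p (x - v) \<le> r}) \<inter> G"
    have idK: "continuous_map (weak_on \<tau> K) (weak_topology \<tau>) (\<lambda>v. v)"
      by (intro continuous_map_from_subtopology) simp
    have "closedin (weak_on \<tau> K) {v \<in> topspace (weak_on \<tau> K). p (x - v) \<le> r}" for x
      using closedin_seminorm_le[OF det p _ idK, of "\<lambda>_. x"] by (simp add: weak_topology_topspace)
    then have "closedin (weak_on \<tau> K) H"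
      unfolding H_def using B(2) G(1) by (intro closedin_Int closedin_INT) auto
    moreover have "u \<in> G"
      using u(1) hull_minimal[of B G convex] BG G(4) by (auto simp: P_def)
    then have "u \<in> H" using u(3) GK by (auto simp: H_def weak_topology_topspace)
    then have "H \<noteq> {}" by blast
    moreover have "convex H"
      unfolding convex_def
    proof (intro ballI allI impI)
      fix v w and s t :: real assume vw: "v \<in> H" "w \<in> H" and st: "0 \<le> s" "0 \<le> t" "s + t = 1"
      have inG: "s *\<^sub>R v + t *\<^sub>R w \<in> G" using vw st G(4) by (auto simp: H_def P_def convex_def)
      moreover have "p (x - (s *\<^sub>R v + t *\<^sub>R w)) \<le> r" if "x \<in> B" for x
      proof -
        have "p (x - v) \<le> r" "p (x - w) \<le> r" using vw that by (auto simp: H_def)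
        from seminorm_convex_combination[OF sn[OF p] st this] show ?thesis
          using st(3) by (simp add: scaleR_add_left[symmetric])
      qed
      ultimately show "s *\<^sub>R v + t *\<^sub>R w \<in> H" using GK by (auto simp: H_def weak_topology_topspace)
    qed
    \<comment> \<open>Each \<open>x \<in> B\<close> has a preimage \<open>y \<in> B\<close> by
      \<open>onto\<close>, and nonexpansiveness carries the bound for \<open>y\<close> over to
      \<open>x\<close>.\<close>
    moreover have "act s v \<in> H" if v: "v \<in> H" for s v
    proof -
      have vG: "v \<in> G" using v by (simp add: H_def)
      have "p (x - act s v) \<le> r" if x: "x \<in> B" for x
      proof -
        obtain y where y: "y \<in> B" "x = act s y" using onto[of s] x by blast
        have "p (act s y - act s v) \<le> p (y - v)" using neG[OF p] y(1) BG vG by blast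
        also have "\<dots> \<le> r" using v y(1) by (auto simp: H_def)
        finally show ?thesis using y(2) by simp
      qed
      then show ?thesis using invG[OF vG] GK by (auto simp: H_def weak_topology_topspace)
    qed
    ultimately have "H = G" by (intro Gmin) (auto simp: P_def H_def)
    \<comment> \<open>\<open>B\<close> lies in \<open>G = H\<close>, so \<open>r\<close> would bound
      the diameter that it is strictly below.\<close>
    then have "p (x - y) \<le> r" if "x \<in> B" "y \<in> B" for x y using that BG by (auto simp: H_def)
    then have "(SUP (x, y)\<in>B \<times> B. p (x - y)) \<le> r" using B(2) by (intro cSUP_least) auto
    then show False using u(2) by simp
  qed
  obtain b where b: "b \<in> B" using B(2) by blast
  have "act s b = b" for s
  proof -
    have "act s b \<in> B" using B(4) b by (simp add: I_def)
    then have "act s b - b = 0" using dist0 b by (intro determines_separating[OF det haus]) auto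
    then show ?thesis by simp
  qed
  then show ?thesis using b BG G(3) by blast
qed

section \<open>Fixed points in invariant subsets and the retraction\<close>

theorem theorem3p10:
  fixes P :: fixed_point_property_name
    and \<tau> :: "'x::real_vector topology"
    and Q :: "('x \<Rightarrow> real) set"
    and K :: "'x set"
    and act :: "'s::semitopological_semigroup \<Rightarrow> 'x \<Rightarrow> 'x"
  assumes "has_fixed_point_property P TYPE('s) TYPE(('x \<Rightarrow> real) \<Rightarrow> 'x)"
    and "hypotheses_of P \<tau> Q K act"
  shows "nonexpansive_retract Q K (fixed_points K act)"
proof -
  have lc: "locally_convex_topology \<tau>" and det: "determines Q \<tau>" and conv: "convex K"
    and ne: "nonexpansive_action Q K act"
    using assms(2) by (auto simp: hypotheses_of_def)
  have haus: "Hausdorff_space \<tau>" using lc by (simp add: locally_convex_topology_def)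
  have K: "compactin (weak_topology \<tau>) K"
    using assms(2) compactin_weak_topology by (cases P) (auto simp: hypotheses_of_def)
  have inv: "act s x \<in> K" if x: "x \<in> K" for s x
  proof -
    \<comment> \<open>\<open>(D)\<close> provides continuity in the given topology, the other
      properties in the weak one; either way \<open>act s\<close> maps \<open>K\<close> into
      itself.\<close>
    have "continuous_map (subtopology \<tau> K) (subtopology \<tau> K) (act s) \<or>
        continuous_map (weak_on \<tau> K) (weak_on \<tau> K) (act s)"
      using assms(2) by (cases P) (auto simp: hypotheses_of_def dynamical_system_def)
    then show ?thesis
      using x determines_topspace[OF det] weak_topology_topspace[of \<tau>]
      by (auto simp: continuous_map_def Pi_iff)
  qed
  show ?thesis
  proof (rule nonexpansive_retract_of_hereditary_fixed_points[OF det haus K conv ne inv])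
    fix C assume C: "C \<subseteq> K" "C \<noteq> {}" "closedin (weak_on \<tau> K) C" "convex C"
      and invC: "\<And>s x. x \<in> C \<Longrightarrow> act s x \<in> C"
    show "\<exists>z\<in>C. \<forall>s. act s z = z"
    proof (cases "P = FP_E'")
      case False
      define j where "j x = (\<lambda>_ :: 'x \<Rightarrow> real. x)" for x :: 'x
      have "linear j" by (rule linearI) (simp_all add: j_def fun_eq_iff scaleR_fun_def)
      moreover have "inj j" by (rule injI) (metis j_def)
      ultimately show ?thesis
        using fixed_point_of_property[OF assms False C(1,2,4,3) invC] by blast
    next
      case True
      show ?thesis
      \<comment> \<open>Embedding real-valued functionals requires a nonzero vector; in the zero
        space every point is fixed.\<close>
      proof (cases "\<exists>v :: 'x. v \<noteq> 0")
        case False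
        then have "x = y" for x y :: 'x by metis
        then show ?thesis using C(2) by blast
      next
        case True
        then obtain v :: 'x where v: "v \<noteq> 0" by blast
        define j where "j m = (\<lambda>\<phi>. m \<phi> *\<^sub>R v)" for m :: "('x \<Rightarrow> real) \<Rightarrow> real"
        have j: "linear j"
          by (rule linearI) (simp_all add: j_def fun_eq_iff scaleR_fun_def scaleR_add_left)
        have "inj j" using v by (auto intro!: injI simp: j_def fun_eq_iff)
        have D: "has_fixed_point_property FP_D TYPE('s) TYPE(('x \<Rightarrow> real) \<Rightarrow> 'x)"
          using assms(1) compact_hypotheses_imp_E' \<open>P = FP_E'\<close>
          unfolding has_fixed_point_property_def by blast
        \<comment> \<open>\<open>(D)\<close> descends along \<open>j\<close> to the functionals on
          real functions on \<open>'x\<close>, the space in which the invariant mean is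
          sought.\<close>
        have "has_fixed_point_property FP_D TYPE('s) TYPE(('x \<Rightarrow> real) \<Rightarrow> real)"
          unfolding has_fixed_point_property_def
        proof (intro allI impI)
          fix \<sigma> :: "(('x \<Rightarrow> real) \<Rightarrow> real) topology" and R L
            and act' :: "'s \<Rightarrow> (('x \<Rightarrow> real) \<Rightarrow> real) \<Rightarrow> ('x \<Rightarrow> real) \<Rightarrow> real"
          assume H: "hypotheses_of FP_D \<sigma> R L act'"
          then have L: "compactin \<sigma> L" "L \<noteq> {}" "convex L" "dynamical_system (subtopology \<sigma> L) act'"
            "locally_convex_topology \<sigma>"
            by (auto simp: hypotheses_of_def)
          have top: "topspace \<sigma> = UNIV" using L(5) by (simp add: locally_convex_topology_def)
          have "closedin (weak_on \<sigma> L) (topspace (weak_on \<sigma> L))" by (rule closedin_topspace)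
          then have "closedin (weak_on \<sigma> L) L" by (simp add: weak_topology_topspace)
          moreover have "act' s x \<in> L" if "x \<in> L" for s x
            using L(4) that top by (auto simp: dynamical_system_def continuous_map_def Pi_iff)
          ultimately have "\<exists>z\<in>L. \<forall>s. act' s z = z"
            using fixed_point_of_property[OF D H _ order_refl L(2,3) _ _ j \<open>inj j\<close>] by blast
          then show "fixed_points L act' \<noteq> {}" by (auto simp: fixed_points_def)
        qed
        moreover have "dynamical_system (weak_on \<tau> K) act"
          "equicontinuous_family (weak_topology \<tau>) K (range act)"
          using assms(2) \<open>P = FP_E'\<close> by (auto simp: hypotheses_of_def)
        ultimately show ?thesis
          using weakly_equicontinuous_fixed_point[OF _ haus det K _ ne _ C(2,3,4) invC] by blast
      qed
    qed
  qed
qed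

end
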